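(* Let $D\subset\mathbb{R}^d$ be a bounded domain, $0<H_0<\tfrac12$, and let $\{B^H\}_{H\in(0,H_0)}$ be one of the three families of fractional Brownian fields (a), (b) (both with $d=1$) or (c) (with $d\ge1$) described in the context. Let $\psi\in\mathcal N_{H_0}(D)$ be a normalizing kernel. Then $$X^H(x):=\Gamma(H)^{1/2}\Big(B^H(x)-\int_{\mathbb{R}^d}B^H(u)\,\psi(u,x)\,du\Big),\qquad x\in D,\ H\in(0,H_0),$$ is a family of centred Gaussian fields whose covariance is of the form $$E[X^H(x)X^h(y)]=C_{H,h}\Big(\frac{1-\|x-y\|^{H+h}}{H+h}+g^{H,h}(x,y)\Big),\qquad x,y\in D,\ H,h\in(0,H_0),$$ with constants $C_{H,h}>0$ and bounded functions $g^{H,h}:D\times D\to\mathbb{R}$ satisfying: (1) $\lim_{\bar H\to0}\big(\sup_{0<h,H<\bar H}|C_{h,H}-1|\big)=0$; (2) there is a bounded function $g:D\times D\to\mathbb{R}$ such that $\lim_{(H,h)\to0}\sup_{x,y\in D}|g^{H,h}(x,y)-g(x,y)|=0$ (limit in $\mathbb{R}^2$).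
   Context: $\|\cdot\|$ is the Euclidean norm, $\Gamma$ is the Gamma function, $t_+=\max(t,0)$. Families of fractional Brownian fields (continuous versions are taken, and all $B^H$ in a family are built from the same noise): (a) ($d=1$, Mandelbrot–van Ness) $B^H(t)=m_H\int_{\mathbb{R}}\big((t-s)_+^{H-\frac12}-(-s)_+^{H-\frac12}\big)dW_s$, $t\in\mathbb{R}$, where $W$ is a two-sided standard Brownian motion and $m_H=\frac{\sqrt{\Gamma(2H+1)\sin(\pi H)}}{\Gamma(H+\frac12)}$. (b) ($d=1$, well-balanced) $B^H(t)=k^1_H\int_{\mathbb{R}}\big(|t-s|^{H-\frac12}-|s|^{H-\frac12}\big)dW_s$, $t\in\mathbb{R}$, with $W$ a two-sided standard Brownian motion. (c) ($d\ge1$) $B^H(x)=k^d_H\int_{\mathbb{R}^d}\big(\|x-y\|^{H-\frac d2}-\|y\|^{H-\frac d2}\big)W(dy)$, $x\in\mathbb{R}^d$, with $W$ a (Gaussian) white noise measure on $\mathbb{R}^d$. Here $$k^d_H=\sqrt{\frac{\Gamma(\frac d4-\frac H2)^2\,\Gamma(H+\frac d2)\,H\,\Gamma(2H)\sin(\pi H)}{2^{2H}\pi^{\frac{d+1}2}\,\Gamma(\frac d4+\frac H2)^2\,\Gamma(H+\frac12)}},$$ so that in all cases $E[B^H(x)B^H(y)]=\frac12(\|x\|^{2H}+\|y\|^{2H}-\|x-y\|^{2H})$. Normalizing kernels: a measurable function $\psi:\mathbb{R}^d\times\mathbb{R}^d\to\mathbb{R}_+$ belongs to $\mathcal N_{H_0}(D)$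 if (i) for every $y\in D$, $x\mapsto\psi(x,y)$ is continuous almost everywhere and $\int_{\mathbb{R}^d}\psi(x,y)\,dx=1$; (ii) with $\log_-(r)=\min(\log r,0)$, $$\sup_{y\in D}\int_{\mathbb{R}^d}\|x\|^{2H_0}\psi(x,y)\,dx<\infty,\qquad \sup_{y\in D}\int_{\mathbb{R}^d}(\log_-\|x-y\|)^2\psi(x,y)\,dx<\infty,$$ $$\sup_{y,w\in D}\int_{\mathbb{R}^d}\int_{\mathbb{R}^d}(\log_-\|x-v\|)^2\psi(x,y)\psi(v,w)\,dx\,dv<\infty.$$
   Formalization: The normalizing kernel is also assumed to satisfy sup over y,w in D of ∫ (log_-‖x−w‖)² ψ(x,y) dx < ∞ (second bound of (ii) with two independent points); without it the cross terms ∫ log‖u−y‖ ψ(u,x) du may diverge and the claim fails. *)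

theory Defs
  imports "HOL-Probability.Probability"
begin

section \<open>Gaussian families, Brownian motion, white noise\<close>

text \<open>Degenerate (almost surely zero) variables count as Gaussian.\<close>

definition centred_gaussian_rv :: "'w measure \<Rightarrow> ('w \<Rightarrow> real) \<Rightarrow> bool" where
  "centred_gaussian_rv M Y \<longleftrightarrow>
     Y \<in> borel_measurable M \<and>
     ((AE \<omega> in M. Y \<omega> = 0) \<or> (\<exists>\<sigma>>0. distributed M lborel Y (normal_density 0 \<sigma>)))"

definition centred_gaussian_family :: "'w measure \<Rightarrow> 'i set \<Rightarrow> ('i \<Rightarrow> 'w \<Rightarrow> real) \<Rightarrow> bool" where
  "centred_gaussian_family M I Y \<longleftrightarrow>
     (\<forall>J c. finite J \<and> J \<subseteq> I \<longrightarrow> centred_gaussian_rv M (\<lambda>\<omega>. \<Sum>i\<in>J. c i * Y i \<omega>))"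

definition two_sided_BM :: "'w measure \<Rightarrow> (real \<Rightarrow> 'w \<Rightarrow> real) \<Rightarrow> bool" where
  "two_sided_BM M W \<longleftrightarrow>
     (\<forall>t. W t \<in> borel_measurable M) \<and>
     (AE \<omega> in M. W 0 \<omega> = 0) \<and>
     (\<forall>s t. s < t \<longrightarrow> distributed M lborel (\<lambda>\<omega>. W t \<omega> - W s \<omega>) (normal_density 0 (sqrt (t - s)))) \<and>
     (\<forall>(t :: nat \<Rightarrow> real) n. strict_mono t \<longrightarrow>
        prob_space.indep_vars M (\<lambda>_. borel) (\<lambda>i \<omega>. W (t (Suc i)) \<omega> - W (t i) \<omega>) {..<n}) \<and>
     (AE \<omega> in M. continuous_on UNIV (\<lambda>t. W t \<omega>))"

definition finite_borel_sets :: "'a::euclidean_space set set" where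
  "finite_borel_sets = {A \<in> sets borel. emeasure lborel A < \<infinity>}"

definition gaussian_white_noise ::
  "'w measure \<Rightarrow> ('a::euclidean_space set \<Rightarrow> 'w \<Rightarrow> real) \<Rightarrow> bool" where
  "gaussian_white_noise M W \<longleftrightarrow>
     centred_gaussian_family M finite_borel_sets W \<and>
     (\<forall>A\<in>finite_borel_sets. \<forall>B\<in>finite_borel_sets.
        prob_space.expectation M (\<lambda>\<omega>. W A \<omega> * W B \<omega>) = measure lborel (A \<inter> B))"

section \<open>Wiener integrals\<close>

text \<open>
  A noise assigns to every index \<open>i \<in> I\<close> a set \<open>S i\<close> and a random variable \<open>Z i\<close>, the mass of
  \<open>S i\<close>. \<open>wiener_integral M I S Z f Y\<close> says that \<open>Y\<close> is a version of the Wiener integral of \<open>f\<close>: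
  for some step functions \<open>\<phi>\<^sub>k = (\<Sum>i<n k. c k i * indicator (S (a k i)))\<close> converging to \<open>f\<close> in
  \<open>L\<^sup>2\<close> of Lebesgue measure, the sums \<open>\<Sum>i<n k. c k i * Z (a k i)\<close> converge to \<open>Y\<close> in \<open>L\<^sup>2\<close> of \<open>M\<close>.
\<close>

definition wiener_integral ::
  "'w measure \<Rightarrow> 'i set \<Rightarrow> ('i \<Rightarrow> 'a::euclidean_space set) \<Rightarrow> ('i \<Rightarrow> 'w \<Rightarrow> real) \<Rightarrow>
     ('a \<Rightarrow> real) \<Rightarrow> ('w \<Rightarrow> real) \<Rightarrow> bool" where
  "wiener_integral M I S Z f Y \<longleftrightarrow>
     f \<in> borel_measurable borel \<and> Y \<in> borel_measurable M \<and>
     (\<exists>(n :: nat \<Rightarrow> nat) (c :: nat \<Rightarrow> nat \<Rightarrow> real) (a :: nat \<Rightarrow> nat \<Rightarrow> 'i).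
        (\<forall>k. \<forall>i<n k. a k i \<in> I) \<and>
        ((\<lambda>k. \<integral>\<^sup>+ s. ennreal ((f s - (\<Sum>i<n k. c k i * indicator (S (a k i)) s))\<^sup>2) \<partial>lborel)
           \<longlonglongrightarrow> 0) \<and>
        ((\<lambda>k. \<integral>\<^sup>+ \<omega>. ennreal ((Y \<omega> - (\<Sum>i<n k. c k i * Z (a k i) \<omega>))\<^sup>2) \<partial>M) \<longlonglongrightarrow> 0))"

definition BM_integral ::
  "'w measure \<Rightarrow> (real \<Rightarrow> 'w \<Rightarrow> real) \<Rightarrow> (real \<Rightarrow> real) \<Rightarrow> ('w \<Rightarrow> real) \<Rightarrow> bool" where
  "BM_integral M W =
     wiener_integral M {(s, t). s \<le> t} (\<lambda>(s, t). {s<..t}) (\<lambda>(s, t) \<omega>. W t \<omega> - W s \<omega>)"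

definition white_noise_integral ::
  "'w measure \<Rightarrow> ('a::euclidean_space set \<Rightarrow> 'w \<Rightarrow> real) \<Rightarrow> ('a \<Rightarrow> real) \<Rightarrow> ('w \<Rightarrow> real) \<Rightarrow> bool" where
  "white_noise_integral M W = wiener_integral M finite_borel_sets (\<lambda>A. A) W"

section \<open>The three families of fractional Brownian fields\<close>

definition mvn_const :: "real \<Rightarrow> real" where
  "mvn_const H = sqrt (Gamma (2 * H + 1) * sin (pi * H)) / Gamma (H + 1/2)"

definition wb_const :: "real \<Rightarrow> real \<Rightarrow> real" where
  "wb_const d H =
     sqrt ((Gamma (d/4 - H/2))\<^sup>2 * Gamma (H + d/2) * H * Gamma (2 * H) * sin (pi * H) /
           (2 powr (2 * H) * pi powr ((d + 1) / 2) * (Gamma (d/4 + H/2))\<^sup>2 * Gamma (H + 1/2)))"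

text \<open>
  Since \<open>0 powr a = 0\<close>, the term \<open>max (t - s) 0 powr (H - 1/2)\<close> vanishes for \<open>s \<ge> t\<close> although the
  exponent is negative. The kernels with absolute values or norms get the value 0 at their
  singularities, which form a null set.
\<close>

definition mvn_family ::
  "'w measure \<Rightarrow> real \<Rightarrow> (real \<Rightarrow> 'w \<Rightarrow> real) \<Rightarrow> (real \<Rightarrow> real \<Rightarrow> 'w \<Rightarrow> real) \<Rightarrow> bool" where
  "mvn_family M H0 W B \<longleftrightarrow> (\<forall>H\<in>{0<..<H0}.
     (\<forall>t. \<exists>Y. BM_integral M W
              (\<lambda>s. (max (t - s) 0) powr (H - 1/2) - (max (- s) 0) powr (H - 1/2)) Y \<and>
            (\<forall>\<omega>\<in>space M. B H t \<omega> = mvn_const H * Y \<omega>)) \<and>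
     (\<forall>\<omega>\<in>space M. continuous_on UNIV (\<lambda>t. B H t \<omega>)))"

definition well_balanced_family ::
  "'w measure \<Rightarrow> real \<Rightarrow> (real \<Rightarrow> 'w \<Rightarrow> real) \<Rightarrow> (real \<Rightarrow> real \<Rightarrow> 'w \<Rightarrow> real) \<Rightarrow> bool" where
  "well_balanced_family M H0 W B \<longleftrightarrow> (\<forall>H\<in>{0<..<H0}.
     (\<forall>t. \<exists>Y. BM_integral M W
              (\<lambda>s. \<bar>t - s\<bar> powr (H - 1/2) - \<bar>s\<bar> powr (H - 1/2)) Y \<and>
            (\<forall>\<omega>\<in>space M. B H t \<omega> = wb_const 1 H * Y \<omega>)) \<and>
     (\<forall>\<omega>\<in>space M. continuous_on UNIV (\<lambda>t. B H t \<omega>)))"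

definition white_noise_family ::
  "'w measure \<Rightarrow> real \<Rightarrow> ('a::euclidean_space set \<Rightarrow> 'w \<Rightarrow> real) \<Rightarrow>
     (real \<Rightarrow> 'a \<Rightarrow> 'w \<Rightarrow> real) \<Rightarrow> bool" where
  "white_noise_family M H0 W B \<longleftrightarrow> (\<forall>H\<in>{0<..<H0}.
     (\<forall>x. \<exists>Y. white_noise_integral M W
              (\<lambda>y. norm (x - y) powr (H - real DIM('a) / 2) - norm y powr (H - real DIM('a) / 2)) Y \<and>
            (\<forall>\<omega>\<in>space M. B H x \<omega> = wb_const (real DIM('a)) H * Y \<omega>)) \<and>
     (\<forall>\<omega>\<in>space M. continuous_on UNIV (\<lambda>x. B H x \<omega>)))"

section \<open>Normalizing kernels and normalized fields\<close>

definition bounded_domain :: "'a::euclidean_space set \<Rightarrow> bool" where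
  "bounded_domain D \<longleftrightarrow> open D \<and> connected D \<and> D \<noteq> {} \<and> bounded D"

text \<open>Here \<open>ln 0 = 0\<close> instead of minus infinity; only null sets of the integrals are affected.\<close>

definition ln_minus :: "real \<Rightarrow> real" where
  "ln_minus r = min (ln r) 0"

definition normalizing_kernels ::
  "real \<Rightarrow> 'a::euclidean_space set \<Rightarrow> ('a \<Rightarrow> 'a \<Rightarrow> real) set" where
  "normalizing_kernels H0 D = {\<psi>.
     (\<lambda>(x, y). \<psi> x y) \<in> borel_measurable borel \<and> (\<forall>x y. 0 \<le> \<psi> x y) \<and>
     (\<forall>y\<in>D. (AE x in lborel. isCont (\<lambda>x. \<psi> x y) x) \<and> (\<integral>x. \<psi> x y \<partial>lborel) = 1) \<and>
     (SUP y\<in>D. \<integral>\<^sup>+ x. ennreal (norm x powr (2 * H0) * \<psi> x y) \<partial>lborel) < \<infinity> \<and>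
     (SUP y\<in>D. \<integral>\<^sup>+ x. ennreal ((ln_minus (norm (x - y)))\<^sup>2 * \<psi> x y) \<partial>lborel) < \<infinity> \<and>
     (SUP (y, w)\<in>D \<times> D. \<integral>\<^sup>+ v. \<integral>\<^sup>+ x.
        ennreal ((ln_minus (norm (x - v)))\<^sup>2 * \<psi> x y * \<psi> v w) \<partial>lborel \<partial>lborel) < \<infinity>}"

text \<open>
  The second bound of \<^const>\<open>normalizing_kernels\<close> only controls the logarithmic singularity at the
  base point \<open>y\<close> of \<open>\<psi> \<sqdot> y\<close>. The covariance of the normalized field also involves
  \<open>\<integral> ln (norm (x - w)) * \<psi> x y dx\<close> for \<open>w \<noteq> y\<close>, which may diverge for a normalizing kernel;
  the following is the same bound, uniform in both points.
\<close>

definition uniform_log_bound :: "'a::euclidean_space set \<Rightarrow> ('a \<Rightarrow> 'a \<Rightarrow> real) \<Rightarrow> bool" where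
  "uniform_log_bound D \<psi> \<longleftrightarrow>
     (SUP (y, w)\<in>D \<times> D. \<integral>\<^sup>+ x. ennreal ((ln_minus (norm (x - w)))\<^sup>2 * \<psi> x y) \<partial>lborel) < \<infinity>"

definition normalized_field ::
  "('a::euclidean_space \<Rightarrow> 'a \<Rightarrow> real) \<Rightarrow> (real \<Rightarrow> 'a \<Rightarrow> 'w \<Rightarrow> real) \<Rightarrow> real \<Rightarrow> 'a \<Rightarrow> 'w \<Rightarrow> real" where
  "normalized_field \<psi> B H x \<omega> =
     Gamma H powr (1/2) * (B H x \<omega> - (\<integral>u. B H u \<omega> * \<psi> u x \<partial>lborel))"

text \<open>
  The suprema are taken in the extended reals, so that convergence to 0 includes their being
  eventually finite.
\<close>

definition approx_log_correlated ::
  "'w measure \<Rightarrow> real \<Rightarrow> 'a::euclidean_space set \<Rightarrow> (real \<Rightarrow> 'a \<Rightarrow> 'w \<Rightarrow> real) \<Rightarrow> bool" where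
  "approx_log_correlated M H0 D X \<longleftrightarrow>
     (\<exists>(C :: real \<Rightarrow> real \<Rightarrow> real) (g :: real \<Rightarrow> real \<Rightarrow> 'a \<Rightarrow> 'a \<Rightarrow> real).
        (\<forall>H\<in>{0<..<H0}. \<forall>h\<in>{0<..<H0}.
           C H h > 0 \<and> bounded ((\<lambda>(x, y). g H h x y) ` (D \<times> D)) \<and>
           (\<forall>x\<in>D. \<forall>y\<in>D. prob_space.expectation M (\<lambda>\<omega>. X H x \<omega> * X h y \<omega>) =
              C H h * ((1 - norm (x - y) powr (H + h)) / (H + h) + g H h x y))) \<and>
        ((\<lambda>Hbar. SUP (h, H)\<in>{0<..<Hbar} \<times> {0<..<Hbar}. ereal \<bar>C h H - 1\<bar>) \<longlongrightarrow> 0) (at_right 0) \<and>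
        (\<exists>g0 :: 'a \<Rightarrow> 'a \<Rightarrow> real. bounded ((\<lambda>(x, y). g0 x y) ` (D \<times> D)) \<and>
           ((\<lambda>(H, h). SUP (x, y)\<in>D \<times> D. ereal \<bar>g H h x y - g0 x y\<bar>) \<longlongrightarrow> 0)
             (at (0, 0) within {0<..<H0} \<times> {0<..<H0})))"

end

theory Submission
  imports Defs
begin

text \<open>
  With \<open>v\<^sub>H(s) = |s| powr (H - d/2)\<close> restricted to a cone \<open>K\<close> (the whole space, or the positive half-line for
  the Mandelbrot-van Ness family), all three fields are Wiener integrals of \<open>v\<^sub>H(x - s) - v\<^sub>H(-s)\<close>.
  Since \<open>H + h < 1\<close>, the integral \<open>\<phi>(z) = \<integral> (v\<^sub>H(z + s) - v\<^sub>H(s)) v\<^sub>h(s) ds\<close> converges absolutely, and up to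
  constants the covariance of the increments \<open>B\<^sub>H(x) - B\<^sub>H(u)\<close> and \<open>B\<^sub>h(y) - B\<^sub>h(w)\<close> is
  \<open>\<phi>(x - y) - \<phi>(x - w) - \<phi>(u - y) + \<phi>(u - w)\<close>. Because \<open>\<psi>\<close> is a probability density, the normalized field is an
  average of such increments, so its covariance is the integral of this expression against \<open>\<psi>(u, x) \<psi>(w, y)\<close>.
  The function \<open>\<phi>\<close> is homogeneous of degree \<open>p = H + h\<close>, and \<open>\<phi>(z) \<approx> - c |z| powr p\<close> with \<open>p c\<close> converging to a
  constant as \<open>(H, h)\<close> tends to 0; the singularity of the integrand at the origin alone determines this
  limit. Dividing by \<open>p c\<close> replaces \<open>\<phi>(z)\<close> by \<open>(1 - |z| powr p)/p\<close>, which tends to \<open>- ln |z|\<close> with an error of order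
  \<open>p (ln |z|)\<^sup>2\<close>. This is what the moment conditions on the kernel control, uniformly on \<open>D\<close>.
\<close>

section \<open>Gaussian variables and Wiener integrals\<close>

text \<open>The approximation of \<open>\<phi>\<close> on the unit sphere by a constant decides the
  shape of the proof. For \<open>K = UNIV\<close> it is an identity, by reflection invariance. For
  the half-line the values at 1 and -1 may differ when \<open>H \<noteq> h\<close>, and the
  difference has no obvious rate of decay. No rate is required: \<open>c\<close> itself grows like
  1/p, so division by \<open>p c\<close> multiplies the defect only by a bounded factor, and it is
  enough that the defect tends to 0. That follows by dominated convergence down to
  \<open>H = h = 0\<close>, although \<open>\<phi>\<close> diverges there: the integrands for 1 and
  -1 have the same singular part, and the limit of their difference is of the form f(s) - f(s - 1),
  whose integral telescopes to 0. The Gamma function formulas enter only through the sign and the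
  limit of the normalizing constants; the exact covariance of the fields is never evaluated.
  Positivity of the constants \<open>C\<close> for all parameters, not just small ones, comes from
  choosing \<open>c\<close> as half the inner product of two kernels whose pointwise product is
  nonnegative.\<close>

lemma integrable_mult_of_squares:
  fixes f g :: "'a \<Rightarrow> real"
  assumes [measurable]: "f \<in> borel_measurable M" "g \<in> borel_measurable M"
    and "integrable M (\<lambda>x. (f x)\<^sup>2)" "integrable M (\<lambda>x. (g x)\<^sup>2)"
  shows "integrable M (\<lambda>x. f x * g x)"
proof (rule Bochner_Integration.integrable_bound)
  show "integrable M (\<lambda>x. (f x)\<^sup>2 + (g x)\<^sup>2)" using assms by simp
  have "\<bar>a * b\<bar> \<le> \<bar>a\<^sup>2 + b\<^sup>2\<bar>" for a b :: real
    using sum_squares_bound[of a b] sum_squares_bound[of a "-b"] by (auto simp: abs_le_iff)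
  then show "AE x in M. norm (f x * g x) \<le> norm ((f x)\<^sup>2 + (g x)\<^sup>2)" by simp
qed measurable

lemma integrable_square_add:
  fixes f g :: "'a \<Rightarrow> real"
  assumes "f \<in> borel_measurable M" "g \<in> borel_measurable M"
    and "integrable M (\<lambda>x. (f x)\<^sup>2)" "integrable M (\<lambda>x. (g x)\<^sup>2)"
  shows "integrable M (\<lambda>x. (f x + g x)\<^sup>2)" "integrable M (\<lambda>x. (f x - g x)\<^sup>2)"
  using integrable_mult_of_squares[OF assms] assms by (simp_all add: power2_sum power2_diff mult.assoc)

text \<open>The absolute value stays inside the integral because the estimate serves two purposes:
  bounding the integral of a product and, with the second function equal to 1, bounding a first
  absolute moment.\<close>

lemma integral_Cauchy_Schwarz:
  fixes f g :: "'a \<Rightarrow> real"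
  assumes [measurable]: "f \<in> borel_measurable M" "g \<in> borel_measurable M"
    and f: "integrable M (\<lambda>x. (f x)\<^sup>2)" and g: "integrable M (\<lambda>x. (g x)\<^sup>2)"
  shows "(\<integral>x. \<bar>f x * g x\<bar> \<partial>M) \<le> sqrt (\<integral>x. (f x)\<^sup>2 \<partial>M) * sqrt (\<integral>x. (g x)\<^sup>2 \<partial>M)"
proof -
  define A B C where "A = (\<integral>x. (f x)\<^sup>2 \<partial>M)" and "B = (\<integral>x. \<bar>f x * g x\<bar> \<partial>M)" and "C = (\<integral>x. (g x)\<^sup>2 \<partial>M)"
  have fg: "integrable M (\<lambda>x. \<bar>f x * g x\<bar>)"
    using integrable_mult_of_squares[OF assms] by simp
  have quad: "0 \<le> t\<^sup>2 * A - 2 * t * B + C" for t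
  proof -
    have "0 \<le> (\<integral>x. (t * \<bar>f x\<bar> - \<bar>g x\<bar>)\<^sup>2 \<partial>M)" by simp
    also have "(\<lambda>x. (t * \<bar>f x\<bar> - \<bar>g x\<bar>)\<^sup>2) = (\<lambda>x. t\<^sup>2 * (f x)\<^sup>2 - 2 * t * \<bar>f x * g x\<bar> + (g x)\<^sup>2)"
      by (auto simp: power2_diff power_mult_distrib abs_mult)
    also have "(\<integral>x. t\<^sup>2 * (f x)\<^sup>2 - 2 * t * \<bar>f x * g x\<bar> + (g x)\<^sup>2 \<partial>M) = t\<^sup>2 * A - 2 * t * B + C"
      using f g fg by (simp add: A_def B_def C_def del: abs_mult)
    finally show ?thesis .
  qed
  have A: "0 \<le> A" and C: "0 \<le> C" and B: "0 \<le> B" by (simp_all add: A_def B_def C_def)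
  have "B\<^sup>2 \<le> A * C"
  proof (cases "A = 0")
    case True
    then have "AE x in M. (f x)\<^sup>2 = 0"
      using integral_nonneg_eq_0_iff_AE[OF f] by (simp add: A_def)
    then have "AE x in M. \<bar>f x * g x\<bar> = 0" by eventually_elim simp
    then have "B = 0" unfolding B_def by (subst integral_cong_AE[where g="\<lambda>_. 0"]) auto
    then show ?thesis using True by simp
  next
    case False
    then have "A > 0" using A by simp
    \<comment> \<open>The quadratic in \<open>t\<close> attains its minimum at
      \<open>B / A\<close>.\<close>
    have "0 \<le> (B / A)\<^sup>2 * A - 2 * (B / A) * B + C" by (rule quad)
    also have "\<dots> = C - B\<^sup>2 / A" using \<open>A > 0\<close> by (simp add: power2_eq_square field_simps)
    finally show ?thesis using \<open>A > 0\<close> by (simp add: field_simps)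
  qed
  then have "sqrt (B\<^sup>2) \<le> sqrt (A * C)" by (rule real_sqrt_le_mono)
  then show ?thesis using B by (simp add: real_sqrt_mult A_def B_def C_def)
qed

text \<open>Convergence is expressed by \<open>nn_integral\<close>, as in
  \<open>wiener_integral\<close>, since square integrability of \<open>f\<close> is not known
  beforehand: it follows from the finite distance to a single \<open>F k\<close>.\<close>

lemma L2_limit:
  fixes f :: "'a \<Rightarrow> real" and F :: "nat \<Rightarrow> 'a \<Rightarrow> real"
  assumes [measurable]: "f \<in> borel_measurable M" "\<And>k. F k \<in> borel_measurable M"
    and F: "\<And>k. integrable M (\<lambda>x. (F k x)\<^sup>2)"
    and lim: "(\<lambda>k. \<integral>\<^sup>+ x. ennreal ((f x - F k x)\<^sup>2) \<partial>M) \<longlonglongrightarrow> 0"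
  shows "integrable M (\<lambda>x. (f x)\<^sup>2)"
    and "(\<lambda>k. \<integral>x. (f x - F k x)\<^sup>2 \<partial>M) \<longlonglongrightarrow> 0"
    and "(\<lambda>k. \<integral>x. (F k x)\<^sup>2 \<partial>M) \<longlonglongrightarrow> (\<integral>x. (f x)\<^sup>2 \<partial>M)"
proof -
  have "\<forall>\<^sub>F k in sequentially. (\<integral>\<^sup>+ x. ennreal ((f x - F k x)\<^sup>2) \<partial>M) < 1"
    using lim by (rule order_tendstoD) simp
  then obtain k where k: "(\<integral>\<^sup>+ x. ennreal ((f x - F k x)\<^sup>2) \<partial>M) < 1"
    by (meson eventually_happens trivial_limit_sequentially)
  have "integrable M (\<lambda>x. (f x - F k x)\<^sup>2)"
    by (rule integrableI_nonneg) (use k in \<open>auto intro: order_less_trans\<close>)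
  from integrable_square_add(1)[OF _ _ this F[of k]]
  show f: "integrable M (\<lambda>x. (f x)\<^sup>2)" by simp
  have D: "integrable M (\<lambda>x. (f x - F k x)\<^sup>2)" for k
    by (rule integrable_square_add(2)) (use f F in auto)
  let ?\<delta> = "\<lambda>k. \<integral>x. (f x - F k x)\<^sup>2 \<partial>M"
  have "(\<integral>\<^sup>+ x. ennreal ((f x - F k x)\<^sup>2) \<partial>M) = ennreal (?\<delta> k)" for k
    by (rule nn_integral_eq_integral[OF D]) simp
  then have "(\<lambda>k. ennreal (?\<delta> k)) \<longlonglongrightarrow> ennreal 0" using lim by simp
  then show \<delta>: "?\<delta> \<longlonglongrightarrow> 0"
    by (subst (asm) tendsto_ennreal_iff) auto
  show "(\<lambda>k. \<integral>x. (F k x)\<^sup>2 \<partial>M) \<longlonglongrightarrow> (\<integral>x. (f x)\<^sup>2 \<partial>M)"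
  proof (rule LIM_zero_cancel, rule Lim_null_comparison)
    show "(\<lambda>k. ?\<delta> k + 2 * (sqrt (\<integral>x. (f x)\<^sup>2 \<partial>M) * sqrt (?\<delta> k))) \<longlonglongrightarrow> 0"
      using \<delta> by (auto intro!: tendsto_eq_intros)
    have "norm ((\<integral>x. (F k x)\<^sup>2 \<partial>M) - (\<integral>x. (f x)\<^sup>2 \<partial>M)) \<le> ?\<delta> k + 2 * (sqrt (\<integral>x. (f x)\<^sup>2 \<partial>M) * sqrt (?\<delta> k))" for k
    proof -
      have P: "integrable M (\<lambda>x. f x * (f x - F k x))"
        by (rule integrable_mult_of_squares) (use f D in auto)
      \<comment> \<open>Expanding around \<open>f\<close> leaves one mixed term, which pairs
        \<open>f\<close> with the small difference, so that Cauchy-Schwarz applies.\<close>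
      have "(\<lambda>x. (F k x)\<^sup>2) = (\<lambda>x. (f x)\<^sup>2 + ((f x - F k x)\<^sup>2 - 2 * (f x * (f x - F k x))))"
        by (auto simp: power2_eq_square algebra_simps)
      then have "(\<integral>x. (F k x)\<^sup>2 \<partial>M) = (\<integral>x. (f x)\<^sup>2 \<partial>M) + (?\<delta> k - 2 * (\<integral>x. f x * (f x - F k x) \<partial>M))"
        using f D P by simp
      moreover have "\<bar>\<integral>x. f x * (f x - F k x) \<partial>M\<bar> \<le> sqrt (\<integral>x. (f x)\<^sup>2 \<partial>M) * sqrt (?\<delta> k)"
        by (rule order_trans[OF integral_abs_bound integral_Cauchy_Schwarz]) (use f D in auto)
      moreover have "0 \<le> ?\<delta> k" by simp
      ultimately show ?thesis unfolding real_norm_def abs_le_iff by linarith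
    qed
    then show "\<forall>\<^sub>F k in sequentially. norm ((\<integral>x. (F k x)\<^sup>2 \<partial>M) - (\<integral>x. (f x)\<^sup>2 \<partial>M)) \<le> ?\<delta> k + 2 * (sqrt (\<integral>x. (f x)\<^sup>2 \<partial>M) * sqrt (?\<delta> k))"
      by simp
  qed
qed

section \<open>Gaussian variables, characteristic functions and mean-square limits\<close>

lemma iexp_lipschitz: "cmod (iexp x - iexp y) \<le> \<bar>x - y\<bar>"
proof -
  have "iexp x - iexp y = iexp y * (iexp (x - y) - 1)"
    by (simp add: algebra_simps flip: exp_add)
  then have "cmod (iexp x - iexp y) = cmod (iexp (x - y) - 1)"
    by (simp add: norm_mult)
  also have "\<dots> \<le> \<bar>x - y\<bar>" using iexp_approx1[of "x - y" 0] by simp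
  finally show ?thesis .
qed

context prob_space begin

lemma char_distr: "Y \<in> borel_measurable M \<Longrightarrow> char (distr M borel Y) t = (CLINT \<omega>|M. iexp (t * Y \<omega>))"
  by (simp add: char_def integral_distr)

lemma normal_second_moment:
  assumes "0 < \<sigma>" "distributed M lborel Y (normal_density 0 \<sigma>)"
  shows "integrable M (\<lambda>\<omega>. (Y \<omega>)\<^sup>2)" "expectation (\<lambda>\<omega>. (Y \<omega>)\<^sup>2) = \<sigma>\<^sup>2"
proof -
  show "integrable M (\<lambda>\<omega>. (Y \<omega>)\<^sup>2)"
    using distributed_integrable[OF assms(2), of "\<lambda>x. x\<^sup>2"] integrable_normal_moment[OF assms(1), of 0 2] by simp
  show "expectation (\<lambda>\<omega>. (Y \<omega>)\<^sup>2) = \<sigma>\<^sup>2"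
    using normal_distributed_variance[OF assms] normal_distributed_expectation[OF assms] by simp
qed

lemma centred_gaussian_square_integrable:
  assumes "centred_gaussian_rv M Y"
  shows "integrable M (\<lambda>\<omega>. (Y \<omega>)\<^sup>2)"
  using assms unfolding centred_gaussian_rv_def
proof (elim conjE disjE exE)
  assume "Y \<in> borel_measurable M" "AE \<omega> in M. Y \<omega> = 0"
  then show ?thesis by (subst integrable_cong_AE[where g="\<lambda>_. 0"]) auto
qed (use normal_second_moment in auto)

text \<open>One formula covers the degenerate and the normal case, so that limits can be taken
  without knowing whether the variance tends to 0.\<close>

lemma centred_gaussian_char:
  assumes "centred_gaussian_rv M Y"
  shows "char (distr M borel Y) t = exp (- (t\<^sup>2 * expectation (\<lambda>\<omega>. (Y \<omega>)\<^sup>2)) / 2)"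
  using assms unfolding centred_gaussian_rv_def
proof (elim conjE disjE exE)
  assume [measurable]: "Y \<in> borel_measurable M" and 0: "AE \<omega> in M. Y \<omega> = 0"
  have "expectation (\<lambda>\<omega>. (Y \<omega>)\<^sup>2) = expectation (\<lambda>\<omega>. 0)"
    by (rule integral_cong_AE) (use 0 in auto)
  moreover have "(CLINT \<omega>|M. iexp (t * Y \<omega>)) = (CLINT \<omega>|M. 1)"
    by (rule integral_cong_AE) (use 0 in auto)
  ultimately show ?thesis by (simp add: char_distr prob_space)
next
  fix \<sigma> assume [measurable]: "Y \<in> borel_measurable M" and \<sigma>: "0 < \<sigma>" "distributed M lborel Y (normal_density 0 \<sigma>)"
  have "distributed M lborel (\<lambda>\<omega>. Y \<omega> / \<sigma>) std_normal_density"
    using normal_standard_normal_convert[of \<sigma> Y 0] \<sigma> by simp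
  then have "distr M borel (\<lambda>\<omega>. Y \<omega> / \<sigma>) = std_normal_distribution"
    by (auto simp: distributed_def cong: distr_cong)
  then have "char (distr M borel (\<lambda>\<omega>. Y \<omega> / \<sigma>)) (t * \<sigma>) = exp (- ((t * \<sigma>)\<^sup>2) / 2)"
    by (simp add: char_std_normal_distribution)
  then show ?thesis
    using \<sigma> normal_second_moment(2)[OF \<sigma>] by (simp add: char_distr power_mult_distrib)
qed

lemma centred_gaussianI_char:
  assumes [measurable]: "Y \<in> borel_measurable M" and sq: "integrable M (\<lambda>\<omega>. (Y \<omega>)\<^sup>2)"
    and char: "\<And>t. char (distr M borel Y) t = exp (- (t\<^sup>2 * expectation (\<lambda>\<omega>. (Y \<omega>)\<^sup>2)) / 2)"
  shows "centred_gaussian_rv M Y"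
proof (cases "expectation (\<lambda>\<omega>. (Y \<omega>)\<^sup>2) = 0")
  case True
  then have "AE \<omega> in M. Y \<omega> = 0"
    using integral_nonneg_eq_0_iff_AE[OF sq] by simp
  then show ?thesis by (simp add: centred_gaussian_rv_def)
next
  case False
  define \<sigma> where "\<sigma> = sqrt (expectation (\<lambda>\<omega>. (Y \<omega>)\<^sup>2))"
  have "0 < expectation (\<lambda>\<omega>. (Y \<omega>)\<^sup>2)" using False by (simp add: order_less_le)
  then have \<sigma>: "0 < \<sigma>" "expectation (\<lambda>\<omega>. (Y \<omega>)\<^sup>2) = \<sigma>\<^sup>2" by (auto simp: \<sigma>_def)
  have "char (distr M borel (\<lambda>\<omega>. Y \<omega> / \<sigma>)) = char std_normal_distribution"
  proof
    fix t
    have "char (distr M borel (\<lambda>\<omega>. Y \<omega> / \<sigma>)) t = char (distr M borel Y) (t / \<sigma>)"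
      by (simp add: char_distr)
    also have "\<dots> = char std_normal_distribution t"
      unfolding char char_std_normal_distribution \<sigma>(2) using \<sigma>(1) by (simp add: power_divide)
    finally show "char (distr M borel (\<lambda>\<omega>. Y \<omega> / \<sigma>)) t = char std_normal_distribution t" .
  qed
  then have "distr M borel (\<lambda>\<omega>. Y \<omega> / \<sigma>) = std_normal_distribution"
    by (intro Levy_uniqueness real_dist_normal_dist) (auto simp: real_distribution_def real_distribution_axioms_def prob_space_distr)
  then have "distributed M lborel (\<lambda>\<omega>. Y \<omega> / \<sigma>) std_normal_density"
    by (auto simp: distributed_def cong: distr_cong)
  then have "distributed M lborel Y (normal_density 0 \<sigma>)"
    using normal_standard_normal_convert[of \<sigma> Y 0] \<sigma> by simp
  then show ?thesis using \<sigma> by (auto simp: centred_gaussian_rv_def)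
qed

text \<open>Mean-square convergence makes the second moments converge, and also the characteristic
  functions, because \<open>iexp\<close> is Lipschitz. The limit therefore has the characteristic
  function of a centred Gaussian, and uniqueness identifies its law.\<close>

lemma centred_gaussian_L2_limit:
  assumes gauss: "\<And>k. centred_gaussian_rv M (F k)" and Y [measurable]: "Y \<in> borel_measurable M"
    and lim: "(\<lambda>k. \<integral>\<^sup>+ \<omega>. ennreal ((Y \<omega> - F k \<omega>)\<^sup>2) \<partial>M) \<longlonglongrightarrow> 0"
  shows "centred_gaussian_rv M Y"
proof (rule centred_gaussianI_char)
  have F [measurable]: "F k \<in> borel_measurable M" for k using gauss[of k] by (simp add: centred_gaussian_rv_def)
  note L2 = L2_limit[OF Y F centred_gaussian_square_integrable[OF gauss] lim]
  show "integrable M (\<lambda>\<omega>. (Y \<omega>)\<^sup>2)" by (rule L2(1))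
  show "Y \<in> borel_measurable M" by (rule Y)
  fix t
  let ?\<delta> = "\<lambda>k. expectation (\<lambda>\<omega>. (Y \<omega> - F k \<omega>)\<^sup>2)"
  have "(\<lambda>k. char (distr M borel (F k)) t) \<longlonglongrightarrow> char (distr M borel Y) t"
  proof (rule LIM_zero_cancel, rule Lim_null_comparison)
    show "(\<lambda>k. \<bar>t\<bar> * sqrt (?\<delta> k)) \<longlonglongrightarrow> 0"
      using L2(2) by (auto intro!: tendsto_eq_intros)
    have "cmod (char (distr M borel (F k)) t - char (distr M borel Y) t) \<le> \<bar>t\<bar> * sqrt (?\<delta> k)" for k
    proof -
      have D: "integrable M (\<lambda>\<omega>. (Y \<omega> - F k \<omega>)\<^sup>2)"
        by (rule integrable_square_add(2)) (use L2(1) centred_gaussian_square_integrable[OF gauss] in auto)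
      have D1: "integrable M (\<lambda>\<omega>. \<bar>Y \<omega> - F k \<omega>\<bar>)"
        using integrable_mult_of_squares[of "\<lambda>\<omega>. Y \<omega> - F k \<omega>" M "\<lambda>_. 1"] D by simp
      have i: "integrable M (\<lambda>\<omega>. iexp (t * Z \<omega>))" if [measurable]: "Z \<in> borel_measurable M" for Z :: "_ \<Rightarrow> real"
        by (rule integrable_const_bound[of _ 1]) auto
      have "cmod (char (distr M borel (F k)) t - char (distr M borel Y) t) =
          cmod (CLINT \<omega>|M. iexp (t * F k \<omega>) - iexp (t * Y \<omega>))"
        by (simp only: char_distr[OF F] char_distr[OF Y] Bochner_Integration.integral_diff[OF i[OF F] i[OF Y]])
      also have "\<dots> \<le> expectation (\<lambda>\<omega>. cmod (iexp (t * F k \<omega>) - iexp (t * Y \<omega>)))"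
        by (rule integral_norm_bound)
      also have "\<dots> \<le> expectation (\<lambda>\<omega>. \<bar>t\<bar> * \<bar>Y \<omega> - F k \<omega>\<bar>)"
      proof (rule integral_mono')
        show "cmod (iexp (t * F k \<omega>) - iexp (t * Y \<omega>)) \<le> \<bar>t\<bar> * \<bar>Y \<omega> - F k \<omega>\<bar>" for \<omega>
          using iexp_lipschitz[of "t * F k \<omega>" "t * Y \<omega>"] by (simp add: abs_minus_commute abs_mult flip: right_diff_distrib)
      qed (use D1 in auto)
      also have "\<dots> \<le> \<bar>t\<bar> * sqrt (?\<delta> k)"
        using integral_Cauchy_Schwarz[of "\<lambda>\<omega>. Y \<omega> - F k \<omega>" M "\<lambda>_. 1"] D
        by (auto intro!: mult_left_mono simp: prob_space)
      finally show ?thesis .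
    qed
    then show "\<forall>\<^sub>F k in sequentially. norm (char (distr M borel (F k)) t - char (distr M borel Y) t) \<le> \<bar>t\<bar> * sqrt (?\<delta> k)"
      by simp
  qed
  moreover have "(\<lambda>k. char (distr M borel (F k)) t) \<longlonglongrightarrow> complex_of_real (exp (- (t\<^sup>2 * expectation (\<lambda>\<omega>. (Y \<omega>)\<^sup>2)) / 2))"
    unfolding centred_gaussian_char[OF gauss] by (intro tendsto_intros L2(3)) auto
  ultimately show "char (distr M borel Y) t = exp (- (t\<^sup>2 * expectation (\<lambda>\<omega>. (Y \<omega>)\<^sup>2)) / 2)"
    by (rule LIMSEQ_unique)
qed

end

section \<open>Wiener integrals with respect to an abstract isonormal noise\<close>

lemma nn_integral_square_combination_tendsto:
  fixes F G :: "nat \<Rightarrow> 'x \<Rightarrow> real"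
  assumes [measurable]: "\<And>k. F k \<in> borel_measurable N" "\<And>k. G k \<in> borel_measurable N"
    and "(\<lambda>k. \<integral>\<^sup>+ x. ennreal ((F k x)\<^sup>2) \<partial>N) \<longlonglongrightarrow> 0" "(\<lambda>k. \<integral>\<^sup>+ x. ennreal ((G k x)\<^sup>2) \<partial>N) \<longlonglongrightarrow> 0"
  shows "(\<lambda>k. \<integral>\<^sup>+ x. ennreal ((\<alpha> * F k x + \<beta> * G k x)\<^sup>2) \<partial>N) \<longlonglongrightarrow> 0"
proof (rule tendsto_sandwich[where f="\<lambda>_. 0"])
  show "(\<lambda>k. ennreal (2 * \<alpha>\<^sup>2) * (\<integral>\<^sup>+ x. ennreal ((F k x)\<^sup>2) \<partial>N) + ennreal (2 * \<beta>\<^sup>2) * (\<integral>\<^sup>+ x. ennreal ((G k x)\<^sup>2) \<partial>N)) \<longlonglongrightarrow> 0"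
    using tendsto_add[OF ennreal_tendsto_cmult[OF _ assms(3), of "ennreal (2 * \<alpha>\<^sup>2)"] ennreal_tendsto_cmult[OF _ assms(4), of "ennreal (2 * \<beta>\<^sup>2)"]]
    by simp
  have "(\<integral>\<^sup>+ x. ennreal ((\<alpha> * F k x + \<beta> * G k x)\<^sup>2) \<partial>N) \<le>
     ennreal (2 * \<alpha>\<^sup>2) * (\<integral>\<^sup>+ x. ennreal ((F k x)\<^sup>2) \<partial>N) + ennreal (2 * \<beta>\<^sup>2) * (\<integral>\<^sup>+ x. ennreal ((G k x)\<^sup>2) \<partial>N)" for k
  proof -
    \<comment> \<open>This takes the place of Minkowski's inequality; integrated in
      \<open>ennreal\<close>, it asks for no integrability.\<close>
    have sq: "(a + b)\<^sup>2 \<le> 2 * a\<^sup>2 + 2 * b\<^sup>2" for a b :: real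
      using sum_squares_bound[of a b] by (simp add: power2_sum)
    have "(\<integral>\<^sup>+ x. ennreal ((\<alpha> * F k x + \<beta> * G k x)\<^sup>2) \<partial>N) \<le>
      (\<integral>\<^sup>+ x. ennreal (2 * \<alpha>\<^sup>2) * ennreal ((F k x)\<^sup>2) + ennreal (2 * \<beta>\<^sup>2) * ennreal ((G k x)\<^sup>2) \<partial>N)"
    proof (rule nn_integral_mono)
      fix x
      show "ennreal ((\<alpha> * F k x + \<beta> * G k x)\<^sup>2) \<le> ennreal (2 * \<alpha>\<^sup>2) * ennreal ((F k x)\<^sup>2) + ennreal (2 * \<beta>\<^sup>2) * ennreal ((G k x)\<^sup>2)"
        using sq[of "\<alpha> * F k x" "\<beta> * G k x"]
        by (simp add: power_mult_distrib ennreal_mult[symmetric] ennreal_plus[symmetric] ennreal_leI mult_ac del: ennreal_plus)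
    qed
    also have "\<dots> = ennreal (2 * \<alpha>\<^sup>2) * (\<integral>\<^sup>+ x. ennreal ((F k x)\<^sup>2) \<partial>N) + ennreal (2 * \<beta>\<^sup>2) * (\<integral>\<^sup>+ x. ennreal ((G k x)\<^sup>2) \<partial>N)"
      by (simp add: nn_integral_add nn_integral_cmult)
    finally show ?thesis .
  qed
  then show "\<forall>\<^sub>F k in sequentially. (\<integral>\<^sup>+ x. ennreal ((\<alpha> * F k x + \<beta> * G k x)\<^sup>2) \<partial>N) \<le>
     ennreal (2 * \<alpha>\<^sup>2) * (\<integral>\<^sup>+ x. ennreal ((F k x)\<^sup>2) \<partial>N) + ennreal (2 * \<beta>\<^sup>2) * (\<integral>\<^sup>+ x. ennreal ((G k x)\<^sup>2) \<partial>N)"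
    by simp
qed auto

lemma sum_lessThan_append:
  "(\<Sum>i<n + m. if i < n then F i else G (i - n)) = (\<Sum>i<n. F i) + (\<Sum>i<m. G i :: real)" for n m :: nat
  by (induction m) (simp_all add: add.assoc)

text \<open>The common abstraction of Brownian increments and white noise. The list \<open>a\<close>
  may repeat indices and the sets may overlap, so the concatenation of two step functions is again
  covered by the axioms. The isometry is demanded for whole sums, which spares a formula for the
  measure of the overlaps.\<close>

locale isonormal_noise = prob_space M for M :: "'w measure" +
  fixes I :: "'i set" and S :: "'i \<Rightarrow> 'a::euclidean_space set" and Z :: "'i \<Rightarrow> 'w \<Rightarrow> real"
  assumes S: "i \<in> I \<Longrightarrow> S i \<in> finite_borel_sets"
    and gaussian: "(\<And>i. i < n \<Longrightarrow> a i \<in> I) \<Longrightarrow> centred_gaussian_rv M (\<lambda>\<omega>. \<Sum>i<(n::nat). c i * Z (a i) \<omega>)"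
    and isometry: "(\<And>i. i < n \<Longrightarrow> a i \<in> I) \<Longrightarrow> expectation (\<lambda>\<omega>. (\<Sum>i<(n::nat). c i * Z (a i) \<omega>)\<^sup>2) =
      (\<integral>s. (\<Sum>i<n. c i * indicator (S (a i)) s)\<^sup>2 \<partial>lborel)"
begin

lemma step_function:
  assumes "\<And>i. i < n \<Longrightarrow> a i \<in> I"
  shows "(\<lambda>s. \<Sum>i<(n::nat). c i * indicator (S (a i)) s :: real) \<in> borel_measurable borel"
    and "integrable lborel (\<lambda>s. (\<Sum>i<n. c i * indicator (S (a i)) s :: real)\<^sup>2)"
proof -
  have S': "S (a i) \<in> sets borel" "emeasure lborel (S (a i)) < \<infinity>" if "i < n" for i
    using S[OF assms[OF that]] by (auto simp: finite_borel_sets_def)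
  show 1: "(\<lambda>s. \<Sum>i<(n::nat). c i * indicator (S (a i)) s :: real) \<in> borel_measurable borel"
    using S' by (intro borel_measurable_sum borel_measurable_times) auto
  have "(\<lambda>s. (\<Sum>i<n. c i * indicator (S (a i)) s :: real)\<^sup>2) =
    (\<lambda>s. \<Sum>i<n. \<Sum>j<n. (c i * c j) * indicator (S (a i) \<inter> S (a j)) s)"
    unfolding power2_eq_square sum_product
    by (intro ext sum.cong) (simp_all add: indicator_inter_arith mult_ac)
  moreover have "integrable lborel (\<lambda>s. \<Sum>i<n. \<Sum>j<n. (c i * c j) * indicator (S (a i) \<inter> S (a j)) s :: real)"
  proof (intro Bochner_Integration.integrable_sum integrable_mult_right)
    fix i j assume "i \<in> {..<n}" "j \<in> {..<n}"
    then have "emeasure lborel (S (a i) \<inter> S (a j)) < \<infinity>" "S (a i) \<inter> S (a j) \<in> sets lborel"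
      using S'[of i] S'[of j] by (auto intro: le_less_trans[OF emeasure_mono])
    then show "integrable lborel (indicat_real (S (a i) \<inter> S (a j)))" by simp
  qed
  ultimately show "integrable lborel (\<lambda>s. (\<Sum>i<n. c i * indicator (S (a i)) s :: real)\<^sup>2)" by simp
qed

abbreviation "W \<equiv> wiener_integral M I S Z"

text \<open>The isometry and Gaussianity of step functions survive the limit. They hold for any
  variable \<open>Y\<close> related to \<open>f\<close>, so no question of uniqueness of the
  integral arises.\<close>

lemma wiener_integral:
  assumes "W f Y"
  shows "f \<in> borel_measurable borel" "Y \<in> borel_measurable M"
    and "integrable lborel (\<lambda>s. (f s)\<^sup>2)" "integrable M (\<lambda>\<omega>. (Y \<omega>)\<^sup>2)"
    and "expectation (\<lambda>\<omega>. (Y \<omega>)\<^sup>2) = (\<integral>s. (f s)\<^sup>2 \<partial>lborel)"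
    and "centred_gaussian_rv M Y"
proof -
  show f: "f \<in> borel_measurable borel" and Y: "Y \<in> borel_measurable M"
    using assms by (simp_all add: wiener_integral_def)
  obtain n :: "nat \<Rightarrow> nat" and c and a :: "nat \<Rightarrow> nat \<Rightarrow> 'i" where a: "\<And>k i. i < n k \<Longrightarrow> a k i \<in> I"
    and lim1: "(\<lambda>k. \<integral>\<^sup>+ s. ennreal ((f s - (\<Sum>i<n k. c k i * indicator (S (a k i)) s))\<^sup>2) \<partial>lborel) \<longlonglongrightarrow> 0"
    and lim2: "(\<lambda>k. \<integral>\<^sup>+ \<omega>. ennreal ((Y \<omega> - (\<Sum>i<n k. c k i * Z (a k i) \<omega>))\<^sup>2) \<partial>M) \<longlonglongrightarrow> 0"
    using assms unfolding wiener_integral_def by auto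
  have g: "centred_gaussian_rv M (\<lambda>\<omega>. \<Sum>i<n k. c k i * Z (a k i) \<omega>)" for k
    by (rule gaussian) (rule a)
  have gm: "(\<lambda>\<omega>. \<Sum>i<n k. c k i * Z (a k i) \<omega>) \<in> borel_measurable M" for k
    using g[of k] by (simp add: centred_gaussian_rv_def)
  have sm: "(\<lambda>s. \<Sum>i<n k. c k i * indicator (S (a k i)) s) \<in> borel_measurable lborel" for k
    using step_function(1)[OF a, of k "\<lambda>i. i"] step_function(1)[of "n k" "a k" "c k"] a by simp
  have si: "integrable lborel (\<lambda>s. (\<Sum>i<n k. c k i * indicator (S (a k i)) s :: real)\<^sup>2)" for k
    by (rule step_function(2)) (rule a)
  note L1 = L2_limit[OF _ sm si lim1] and L2 = L2_limit[OF Y gm centred_gaussian_square_integrable[OF g] lim2]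
  show "integrable lborel (\<lambda>s. (f s)\<^sup>2)" "integrable M (\<lambda>\<omega>. (Y \<omega>)\<^sup>2)"
    using L1(1) L2(1) f by simp_all
  show "centred_gaussian_rv M Y" by (rule centred_gaussian_L2_limit[OF g Y lim2])
  \<comment> \<open>By the isometry the second moments of the sums equal the integrals of the
    squared step functions, so both limits belong to one sequence.\<close>
  have "(\<lambda>k. expectation (\<lambda>\<omega>. (\<Sum>i<n k. c k i * Z (a k i) \<omega>)\<^sup>2)) \<longlonglongrightarrow> (\<integral>s. (f s)\<^sup>2 \<partial>lborel)"
    using L1(3) f isometry[OF a] by simp
  with L2(3) show "expectation (\<lambda>\<omega>. (Y \<omega>)\<^sup>2) = (\<integral>s. (f s)\<^sup>2 \<partial>lborel)"
    by (rule LIMSEQ_unique)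
qed

text \<open>The approximating sums of \<open>f\<close> and \<open>g\<close> are concatenated, with
  coefficients scaled by \<open>\<alpha>\<close> and \<open>\<beta>\<close>.\<close>

lemma wiener_integral_combination:
  assumes "W f Y" "W g Y'"
  shows "W (\<lambda>s. \<alpha> * f s + \<beta> * g s) (\<lambda>\<omega>. \<alpha> * Y \<omega> + \<beta> * Y' \<omega>)"
proof -
  note [measurable] = wiener_integral(1,2)[OF assms(1)] wiener_integral(1,2)[OF assms(2)]
  obtain n :: "nat \<Rightarrow> nat" and c and a :: "nat \<Rightarrow> nat \<Rightarrow> 'i" where a: "\<And>k i. i < n k \<Longrightarrow> a k i \<in> I"
    and lim1: "(\<lambda>k. \<integral>\<^sup>+ s. ennreal ((f s - (\<Sum>i<n k. c k i * indicator (S (a k i)) s))\<^sup>2) \<partial>lborel) \<longlonglongrightarrow> 0"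
    and lim2: "(\<lambda>k. \<integral>\<^sup>+ \<omega>. ennreal ((Y \<omega> - (\<Sum>i<n k. c k i * Z (a k i) \<omega>))\<^sup>2) \<partial>M) \<longlonglongrightarrow> 0"
    using assms(1) unfolding wiener_integral_def by auto
  obtain n' :: "nat \<Rightarrow> nat" and c' and a' :: "nat \<Rightarrow> nat \<Rightarrow> 'i" where a': "\<And>k i. i < n' k \<Longrightarrow> a' k i \<in> I"
    and lim1': "(\<lambda>k. \<integral>\<^sup>+ s. ennreal ((g s - (\<Sum>i<n' k. c' k i * indicator (S (a' k i)) s))\<^sup>2) \<partial>lborel) \<longlonglongrightarrow> 0"
    and lim2': "(\<lambda>k. \<integral>\<^sup>+ \<omega>. ennreal ((Y' \<omega> - (\<Sum>i<n' k. c' k i * Z (a' k i) \<omega>))\<^sup>2) \<partial>M) \<longlonglongrightarrow> 0"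
    using assms(2) unfolding wiener_integral_def by auto
  have [measurable]: "(\<lambda>\<omega>. \<Sum>i<n k. c k i * Z (a k i) \<omega>) \<in> borel_measurable M"
    "(\<lambda>\<omega>. \<Sum>i<n' k. c' k i * Z (a' k i) \<omega>) \<in> borel_measurable M" for k
    using gaussian[of "n k" "a k" "c k"] gaussian[of "n' k" "a' k" "c' k"] a a' by (simp_all add: centred_gaussian_rv_def)
  have [measurable]: "(\<lambda>s. \<Sum>i<n k. c k i * indicator (S (a k i)) s) \<in> borel_measurable borel"
    "(\<lambda>s. \<Sum>i<n' k. c' k i * indicator (S (a' k i)) s) \<in> borel_measurable borel" for k
    using step_function(1)[of "n k" "a k" "c k"] step_function(1)[of "n' k" "a' k" "c' k"] a a' by simp_all
  define n2 where "n2 k = n k + n' k" for k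
  define c2 where "c2 k i = (if i < n k then \<alpha> * c k i else \<beta> * c' k (i - n k))" for k i
  define a2 where "a2 k i = (if i < n k then a k i else a' k (i - n k))" for k i
  \<comment> \<open>The function \<open>X\<close> is arbitrary, so the same identity applies to the
    indicators of the sets and to the random masses.\<close>
  have sum2: "(\<Sum>i<n2 k. c2 k i * X (a2 k i)) = \<alpha> * (\<Sum>i<n k. c k i * X (a k i)) + \<beta> * (\<Sum>i<n' k. c' k i * X (a' k i))"
    for k and X :: "'i \<Rightarrow> real"
  proof -
    have "(\<Sum>i<n2 k. c2 k i * X (a2 k i)) =
      (\<Sum>i<n k + n' k. if i < n k then \<alpha> * c k i * X (a k i) else (\<lambda>i. \<beta> * c' k i * X (a' k i)) (i - n k))"
      by (intro sum.cong) (auto simp: n2_def c2_def a2_def)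
    also have "\<dots> = (\<Sum>i<n k. \<alpha> * c k i * X (a k i)) + (\<Sum>i<n' k. \<beta> * c' k i * X (a' k i))"
      by (rule sum_lessThan_append)
    finally show ?thesis by (simp add: sum_distrib_left mult.assoc)
  qed
  have s1: "(\<Sum>i<n2 k. c2 k i * indicator (S (a2 k i)) s) =
      \<alpha> * (\<Sum>i<n k. c k i * indicator (S (a k i)) s) + \<beta> * (\<Sum>i<n' k. c' k i * indicator (S (a' k i)) s)" for k s
    by (rule sum2)
  have s2: "(\<Sum>i<n2 k. c2 k i * Z (a2 k i) \<omega>) =
      \<alpha> * (\<Sum>i<n k. c k i * Z (a k i) \<omega>) + \<beta> * (\<Sum>i<n' k. c' k i * Z (a' k i) \<omega>)" for k \<omega>
    by (rule sum2)
  have ar: "\<alpha> * x + \<beta> * y - (\<alpha> * x' + \<beta> * y') = \<alpha> * (x - x') + \<beta> * (y - y')" for x y x' y'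
    by (simp add: algebra_simps)
  have "(\<lambda>k. \<integral>\<^sup>+ s. ennreal ((\<alpha> * (f s - (\<Sum>i<n k. c k i * indicator (S (a k i)) s)) + \<beta> * (g s - (\<Sum>i<n' k. c' k i * indicator (S (a' k i)) s)))\<^sup>2) \<partial>lborel) \<longlonglongrightarrow> 0"
    by (rule nn_integral_square_combination_tendsto[OF _ _ lim1 lim1']) measurable
  then have l1: "(\<lambda>k. \<integral>\<^sup>+ s. ennreal ((\<alpha> * f s + \<beta> * g s - (\<Sum>i<n2 k. c2 k i * indicator (S (a2 k i)) s))\<^sup>2) \<partial>lborel) \<longlonglongrightarrow> 0"
    unfolding s1 ar .
  have "(\<lambda>k. \<integral>\<^sup>+ \<omega>. ennreal ((\<alpha> * (Y \<omega> - (\<Sum>i<n k. c k i * Z (a k i) \<omega>)) + \<beta> * (Y' \<omega> - (\<Sum>i<n' k. c' k i * Z (a' k i) \<omega>)))\<^sup>2) \<partial>M) \<longlonglongrightarrow> 0"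
    by (rule nn_integral_square_combination_tendsto[OF _ _ lim2 lim2']) measurable
  then have l2: "(\<lambda>k. \<integral>\<^sup>+ \<omega>. ennreal ((\<alpha> * Y \<omega> + \<beta> * Y' \<omega> - (\<Sum>i<n2 k. c2 k i * Z (a2 k i) \<omega>))\<^sup>2) \<partial>M) \<longlonglongrightarrow> 0"
    unfolding s2 ar .
  have "\<forall>k. \<forall>i<n2 k. a2 k i \<in> I" using a a' by (auto simp: n2_def a2_def)
  then show ?thesis unfolding wiener_integral_def using l1 l2 by (auto intro!: exI[of _ n2] exI[of _ c2] exI[of _ a2])
qed

lemma wiener_integral_zero: "W (\<lambda>_. 0) (\<lambda>_. 0)"
  unfolding wiener_integral_def by (auto intro!: exI[of _ "\<lambda>_. 0"])

lemma wiener_integral_sum: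
  assumes "finite J" "\<And>j. j \<in> J \<Longrightarrow> W (f j) (Y j)"
  shows "W (\<lambda>s. \<Sum>j\<in>J. c j * f j s) (\<lambda>\<omega>. \<Sum>j\<in>J. c j * Y j \<omega>)"
  using assms
proof (induction J)
  case (insert j J)
  then have "W (\<lambda>s. c j * f j s + 1 * (\<Sum>j\<in>J. c j * f j s)) (\<lambda>\<omega>. c j * Y j \<omega> + 1 * (\<Sum>j\<in>J. c j * Y j \<omega>))"
    by (intro wiener_integral_combination) auto
  then show ?case using insert.hyps by simp
qed (simp add: wiener_integral_zero)

text \<open>Polarisation: the isometry for \<open>f + g\<close> is compared with those for
  \<open>f\<close> and \<open>g\<close>.\<close>

lemma wiener_integral_covariance:
  assumes "W f Y" "W g Y'"
  shows "integrable M (\<lambda>\<omega>. Y \<omega> * Y' \<omega>)" "integrable lborel (\<lambda>s. f s * g s)"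
    and "expectation (\<lambda>\<omega>. Y \<omega> * Y' \<omega>) = (\<integral>s. f s * g s \<partial>lborel)"
proof -
  note 1 = wiener_integral[OF assms(1)] and 2 = wiener_integral[OF assms(2)]
  show i: "integrable M (\<lambda>\<omega>. Y \<omega> * Y' \<omega>)" and j: "integrable lborel (\<lambda>s. f s * g s)"
    using 1 2 by (auto intro!: integrable_mult_of_squares)
  have W: "W (\<lambda>s. f s + g s) (\<lambda>\<omega>. Y \<omega> + Y' \<omega>)"
    using wiener_integral_combination[OF assms, of 1 1] by simp
  have "expectation (\<lambda>\<omega>. (Y \<omega> + Y' \<omega>)\<^sup>2) = (\<integral>s. (f s + g s)\<^sup>2 \<partial>lborel)"
    by (rule wiener_integral(5)[OF W])
  moreover have "expectation (\<lambda>\<omega>. (Y \<omega> + Y' \<omega>)\<^sup>2) = expectation (\<lambda>\<omega>. (Y \<omega>)\<^sup>2) + expectation (\<lambda>\<omega>. (Y' \<omega>)\<^sup>2) + 2 * expectation (\<lambda>\<omega>. Y \<omega> * Y' \<omega>)"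
    using 1(4) 2(4) i by (simp add: power2_sum mult.assoc)
  moreover have "(\<integral>s. (f s + g s)\<^sup>2 \<partial>lborel) = (\<integral>s. (f s)\<^sup>2 \<partial>lborel) + (\<integral>s. (g s)\<^sup>2 \<partial>lborel) + 2 * (\<integral>s. f s * g s \<partial>lborel)"
    using 1(3) 2(3) j by (simp add: power2_sum mult.assoc)
  ultimately show "expectation (\<lambda>\<omega>. Y \<omega> * Y' \<omega>) = (\<integral>s. f s * g s \<partial>lborel)"
    using 1(5) 2(5) by simp
qed

end

section \<open>Brownian motion and white noise\<close>

lemma integral_double_sum:
  fixes h :: "nat \<Rightarrow> nat \<Rightarrow> 'a \<Rightarrow> real"
  assumes "\<And>i j. i < n \<Longrightarrow> j < n \<Longrightarrow> integrable N (h i j)"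
  shows "(\<integral>x. (\<Sum>i<n. \<Sum>j<n. k i j * h i j x) \<partial>N) = (\<Sum>i<n. \<Sum>j<n. k i j * (\<integral>x. h i j x \<partial>N))"
proof -
  have "(\<integral>x. (\<Sum>i<n. \<Sum>j<n. k i j * h i j x) \<partial>N) = (\<Sum>i<n. \<integral>x. (\<Sum>j<n. k i j * h i j x) \<partial>N)"
    by (intro Bochner_Integration.integral_sum Bochner_Integration.integrable_sum integrable_mult_right assms) auto
  also have "\<dots> = (\<Sum>i<n. \<Sum>j<n. \<integral>x. k i j * h i j x \<partial>N)"
    by (intro sum.cong refl Bochner_Integration.integral_sum integrable_mult_right assms) auto
  finally show ?thesis by simp
qed

lemma (in prob_space) isonormal_white_noise:
  assumes "gaussian_white_noise M W"
  shows "isonormal_noise M finite_borel_sets (\<lambda>A. A) W"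
proof
  have fam: "centred_gaussian_rv M (\<lambda>\<omega>. \<Sum>A\<in>J. c A * W A \<omega>)" if "finite J" "J \<subseteq> finite_borel_sets" for J c
    using assms that by (auto simp: gaussian_white_noise_def centred_gaussian_family_def)
  have cov: "expectation (\<lambda>\<omega>. W A \<omega> * W B \<omega>) = measure lborel (A \<inter> B)"
    if "A \<in> finite_borel_sets" "B \<in> finite_borel_sets" for A B
    using assms that by (auto simp: gaussian_white_noise_def)
  have single: "centred_gaussian_rv M (W A)" if "A \<in> finite_borel_sets" for A
    using fam[of "{A}" "\<lambda>_. 1"] that by simp
  have prod: "integrable M (\<lambda>\<omega>. W A \<omega> * W B \<omega>)" if "A \<in> finite_borel_sets" "B \<in> finite_borel_sets" for A B
    using single[OF that(1)] single[OF that(2)] centred_gaussian_square_integrable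
    by (intro integrable_mult_of_squares) (auto simp: centred_gaussian_rv_def)
  fix n :: nat and a :: "nat \<Rightarrow> 'b set" and c :: "nat \<Rightarrow> real"
  assume a: "\<And>i. i < n \<Longrightarrow> a i \<in> finite_borel_sets"
  \<comment> \<open>A Gaussian family is defined by sums over finite sets of indices, whereas the
    list \<open>a\<close> may repeat a set; equal sets are collected and their coefficients
    added.\<close>
  have "(\<lambda>\<omega>. \<Sum>i<n. c i * W (a i) \<omega>) = (\<lambda>\<omega>. \<Sum>A\<in>a ` {..<n}. (\<Sum>i | i \<in> {..<n} \<and> a i = A. c i) * W A \<omega>)"
  proof
    fix \<omega>
    show "(\<Sum>i<n. c i * W (a i) \<omega>) = (\<Sum>A\<in>a ` {..<n}. (\<Sum>i | i \<in> {..<n} \<and> a i = A. c i) * W A \<omega>)"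
      by (subst sum.image_gen[of "{..<n}" _ a]) (auto simp: sum_distrib_right intro!: sum.cong)
  qed
  moreover have "centred_gaussian_rv M (\<lambda>\<omega>. \<Sum>A\<in>a ` {..<n}. (\<Sum>i | i \<in> {..<n} \<and> a i = A. c i) * W A \<omega>)"
    using a by (intro fam) auto
  ultimately show "centred_gaussian_rv M (\<lambda>\<omega>. \<Sum>i<n. c i * W (a i) \<omega>)" by simp
  have "expectation (\<lambda>\<omega>. (\<Sum>i<n. c i * W (a i) \<omega>)\<^sup>2) = expectation (\<lambda>\<omega>. \<Sum>i<n. \<Sum>j<n. (c i * c j) * (W (a i) \<omega> * W (a j) \<omega>))"
    by (simp add: power2_eq_square sum_product mult_ac)
  also have "\<dots> = (\<Sum>i<n. \<Sum>j<n. (c i * c j) * measure lborel (a i \<inter> a j))"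
    by (subst integral_double_sum) (use a prod cov in auto)
  also have "\<dots> = (\<integral>s. (\<Sum>i<n. \<Sum>j<n. (c i * c j) * indicator (a i \<inter> a j) s) \<partial>lborel)"
  proof -
    have "integrable lborel (indicat_real (a i \<inter> a j))" if "i < n" "j < n" for i j
    proof -
      have "emeasure lborel (a i \<inter> a j) < \<infinity>" "a i \<inter> a j \<in> sets lborel"
        using a[of i] a[of j] that by (auto simp: finite_borel_sets_def intro: le_less_trans[OF emeasure_mono])
      then show ?thesis by simp
    qed
    then show ?thesis by (subst integral_double_sum) auto
  qed
  also have "(\<lambda>s. \<Sum>i<n. \<Sum>j<n. (c i * c j) * indicat_real (a i \<inter> a j) s) = (\<lambda>s. (\<Sum>i<n. c i * indicator (a i) s)\<^sup>2)"
    unfolding power2_eq_square sum_product by (intro ext sum.cong) (simp_all add: indicator_inter_arith mult_ac)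
  finally show "expectation (\<lambda>\<omega>. (\<Sum>i<n. c i * W (a i) \<omega>)\<^sup>2) = (\<integral>s. (\<Sum>i<n. c i * indicator (a i) s)\<^sup>2 \<partial>lborel)" .
qed

text \<open>\<open>two_sided_BM\<close> speaks of increments along strictly increasing infinite
  sequences, so a finite set of endpoints is sorted and then continued by \<open>B + j\<close>
  beyond its maximum.\<close>

lemma finite_set_in_strict_mono_sequence:
  fixes T :: "real set"
  assumes "finite T"
  obtains \<tau> :: "nat \<Rightarrow> real" and m :: nat where "strict_mono \<tau>" "T \<subseteq> \<tau> ` {..m}"
proof -
  define xs where "xs = sorted_list_of_set T"
  have xs: "set xs = T" "sorted xs" "distinct xs" using assms by (auto simp: xs_def)
  define B where "B = Max (insert 0 T) + 1"
  have B: "x < B" if "x \<in> T" for x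
  proof -
    have "x \<le> Max (insert 0 T)" using assms that by (intro Max_ge) auto
    then show ?thesis unfolding B_def by linarith
  qed
  define \<tau> where "\<tau> j = (if j < length xs then xs ! j else B + real j)" for j
  have "strict_mono \<tau>"
  proof (rule strict_mono_Suc_iff[THEN iffD2], rule allI)
    fix j
    have "xs ! j < xs ! Suc j" if "Suc j < length xs"
      using sorted_wrt_nth_less[OF strict_sorted_iff[THEN iffD2, OF conjI[OF xs(2,3)]], of j "Suc j"] that by simp
    moreover have "xs ! j < B" if "j < length xs" using B[of "xs ! j"] xs(1) that by auto
    ultimately show "\<tau> j < \<tau> (Suc j)" by (auto simp: \<tau>_def intro: less_le_trans)
  qed
  moreover have "T \<subseteq> \<tau> ` {..length xs}"
  proof
    fix x assume "x \<in> T"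
    then obtain i where "i < length xs" "xs ! i = x" using xs(1) by (metis in_set_conv_nth)
    then show "x \<in> \<tau> ` {..length xs}" by (intro image_eqI[of _ _ i]) (auto simp: \<tau>_def)
  qed
  ultimately show ?thesis using that by blast
qed

text \<open>Overlapping intervals do not give independent increments. All endpoints are put into one
  partition \<open>\<tau>\<close>, whose cells are disjoint, and every sum is rewritten over these
  cells.\<close>

lemma (in prob_space) isonormal_Brownian_motion:
  assumes "two_sided_BM M W"
  shows "isonormal_noise M {(s, t). s \<le> t} (\<lambda>(s, t). {s<..t}) (\<lambda>(s, t) \<omega>. W t \<omega> - W s \<omega>)"
proof -
  have Wm [measurable]: "W t \<in> borel_measurable M" for t using assms by (simp add: two_sided_BM_def)
  have main: "centred_gaussian_rv M (\<lambda>\<omega>. \<Sum>i<n. c i * (case a i of (s, t) \<Rightarrow> \<lambda>\<omega>. W t \<omega> - W s \<omega>) \<omega>) \<and>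
      expectation (\<lambda>\<omega>. (\<Sum>i<n. c i * (case a i of (s, t) \<Rightarrow> \<lambda>\<omega>. W t \<omega> - W s \<omega>) \<omega>)\<^sup>2) =
      (\<integral>s. (\<Sum>i<n. c i * indicator (case a i of (s, t) \<Rightarrow> {s<..t}) s)\<^sup>2 \<partial>lborel)"
    if a: "\<And>i. i < n \<Longrightarrow> a i \<in> {(s, t). s \<le> t}" for n :: nat and a :: "nat \<Rightarrow> real \<times> real" and c :: "nat \<Rightarrow> real"
  proof -
    obtain \<tau> m where \<tau>: "strict_mono \<tau>" and T: "(\<lambda>i. fst (a i)) ` {..<n} \<union> (\<lambda>i. snd (a i)) ` {..<n} \<subseteq> \<tau> ` {..m::nat}"
      using finite_set_in_strict_mono_sequence[of "(\<lambda>i. fst (a i)) ` {..<n} \<union> (\<lambda>i. snd (a i)) ` {..<n}"]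
      by (metis finite_Un finite_imageI finite_lessThan)
    have ex: "\<exists>p. \<tau> p = fst (a i) \<and> p \<le> m" "\<exists>q. \<tau> q = snd (a i) \<and> q \<le> m" if "i < n" for i
    proof -
      have "fst (a i) \<in> \<tau> ` {..m}" "snd (a i) \<in> \<tau> ` {..m}" using T that by auto
      then show "\<exists>p. \<tau> p = fst (a i) \<and> p \<le> m" "\<exists>q. \<tau> q = snd (a i) \<and> q \<le> m" by auto
    qed
    then obtain p q where p: "\<And>i. i < n \<Longrightarrow> \<tau> (p i) = fst (a i)" "\<And>i. i < n \<Longrightarrow> p i \<le> m"
      and q: "\<And>i. i < n \<Longrightarrow> \<tau> (q i) = snd (a i)" "\<And>i. i < n \<Longrightarrow> q i \<le> m"
      by metis
    have pq: "p i \<le> q i" if "i < n" for i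
    proof -
      have "\<tau> (p i) \<le> \<tau> (q i)" using a[OF that] p(1)[OF that] q(1)[OF that] by (auto simp: case_prod_beta')
      then show ?thesis using strict_mono_less_eq[OF \<tau>, of "p i" "q i"] by blast
    qed
    \<comment> \<open>The coefficient of a cell collects the coefficients of all given intervals
      that contain it.\<close>
    define d where "d j = (\<Sum>i<n. c i * of_bool (p i \<le> j \<and> j < q i))" for j
    \<comment> \<open>A telescoping identity for any function \<open>w\<close> of the endpoints.
      With a Brownian path it rewrites the random sum; with the indicator of \<open>{..t}\<close> at
      a fixed point, as a function of \<open>t\<close>, it rewrites the step function.\<close>
    have rew: "(\<Sum>i<n. c i * (w (snd (a i)) - w (fst (a i)))) = (\<Sum>j<m. d j * (w (\<tau> (Suc j)) - w (\<tau> j)))"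
      for w :: "real \<Rightarrow> real"
    proof -
      have "c i * (w (snd (a i)) - w (fst (a i))) = (\<Sum>j<m. c i * of_bool (p i \<le> j \<and> j < q i) * (w (\<tau> (Suc j)) - w (\<tau> j)))"
        if "i < n" for i
      proof -
        have "w (snd (a i)) - w (fst (a i)) = (\<Sum>j = p i..<q i. w (\<tau> (Suc j)) - w (\<tau> j))"
          using sum_Suc_diff'[OF pq[OF that], of "\<lambda>j. w (\<tau> j)"] p(1)[OF that] q(1)[OF that] by simp
        also have "\<dots> = (\<Sum>j<m. of_bool (p i \<le> j \<and> j < q i) * (w (\<tau> (Suc j)) - w (\<tau> j)))"
          using q(2)[OF that] by (intro sum.mono_neutral_cong_left) auto
        finally show ?thesis by (simp only: sum_distrib_left mult.assoc)
      qed
      then have "(\<Sum>i<n. c i * (w (snd (a i)) - w (fst (a i)))) = (\<Sum>i<n. \<Sum>j<m. c i * of_bool (p i \<le> j \<and> j < q i) * (w (\<tau> (Suc j)) - w (\<tau> j)))"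
        by simp
      also have "\<dots> = (\<Sum>j<m. d j * (w (\<tau> (Suc j)) - w (\<tau> j)))"
        by (subst sum.swap) (simp only: d_def sum_distrib_right)
      finally show ?thesis .
    qed
    let ?\<Delta> = "\<lambda>j \<omega>. W (\<tau> (Suc j)) \<omega> - W (\<tau> j) \<omega>"
    let ?X = "\<lambda>\<omega>. \<Sum>j<m. d j * ?\<Delta> j \<omega>"
    have X: "(\<Sum>i<n. c i * (case a i of (s, t) \<Rightarrow> \<lambda>\<omega>. W t \<omega> - W s \<omega>) \<omega>) = ?X \<omega>" for \<omega>
      using rew[of "\<lambda>t. W t \<omega>"] by (simp add: case_prod_beta')
    have incr: "\<tau> j < \<tau> (Suc j)" for j using \<tau> by (simp add: strict_mono_Suc_iff)
    have indic: "indicator {s<..t} x = (indicator {..t} x - indicator {..s} x :: real)" if "s \<le> t" for s t x :: real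
      using that by (auto simp: indicator_def)
    have Y: "(\<Sum>i<n. c i * indicator (case a i of (s, t) \<Rightarrow> {s<..t}) x) = (\<Sum>j<m. d j * indicator {\<tau> j<..\<tau> (Suc j)} x)" for x
    proof -
      have "(\<Sum>i<n. c i * indicator (case a i of (s, t) \<Rightarrow> {s<..t}) x) = (\<Sum>i<n. c i * (indicator {..snd (a i)} x - indicator {..fst (a i)} x))"
        using a by (intro sum.cong) (auto simp: case_prod_beta' indic)
      also have "\<dots> = (\<Sum>j<m. d j * (indicator {..\<tau> (Suc j)} x - indicator {..\<tau> j} x))"
        by (rule rew)
      also have "\<dots> = (\<Sum>j<m. d j * indicator {\<tau> j<..\<tau> (Suc j)} x)"
        using incr by (intro sum.cong) (auto simp: indic less_imp_le)
      finally show ?thesis .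
    qed
    \<comment> \<open>Cells with coefficient 0 are dropped, since a normal density needs a positive
      standard deviation.\<close>
    define L where "L = {j. j < m \<and> d j \<noteq> 0}"
    define V where "V = (\<Sum>j<m. (d j)\<^sup>2 * (\<tau> (Suc j) - \<tau> j))"
    have finL: "finite L" by (simp add: L_def)
    have XL: "?X = (\<lambda>\<omega>. \<Sum>j\<in>L. 0 + d j * ?\<Delta> j \<omega>)"
      by (intro ext sum.mono_neutral_cong_right) (auto simp: L_def)
    have VL: "V = (\<Sum>j\<in>L. (\<bar>d j\<bar> * sqrt (\<tau> (Suc j) - \<tau> j))\<^sup>2)"
      unfolding V_def using incr
      by (intro sum.mono_neutral_cong_right) (auto simp: L_def power_mult_distrib less_imp_le)
    have X_gauss: "centred_gaussian_rv M ?X \<and> expectation (\<lambda>\<omega>. (?X \<omega>)\<^sup>2) = V"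
    proof (cases "L = {}")
      case True
      then have "V = 0" using VL by simp
      moreover have X0: "?X \<omega> = 0" for \<omega> using True XL[THEN fun_cong, of \<omega>] by simp
      ultimately show ?thesis unfolding X0 by (simp add: centred_gaussian_rv_def)
    next
      case False
      have ind: "indep_vars (\<lambda>_. borel) ?\<Delta> {..<m}"
        using assms \<tau> by (simp add: two_sided_BM_def)
      have "indep_vars (\<lambda>_. borel) (\<lambda>j \<omega>. 0 + d j * ?\<Delta> j \<omega>) L"
        by (rule indep_vars_compose2[OF indep_vars_subset[OF ind], of L "\<lambda>j x. 0 + d j * x" "\<lambda>_. borel"]) (auto simp: L_def)
      moreover have "distributed M lborel (\<lambda>\<omega>. 0 + d j * ?\<Delta> j \<omega>) (normal_density 0 (\<bar>d j\<bar> * sqrt (\<tau> (Suc j) - \<tau> j)))"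
        if "j \<in> L" for j
        using normal_density_affine[of "?\<Delta> j" 0 "sqrt (\<tau> (Suc j) - \<tau> j)" "d j" 0] assms incr[of j] that
        by (simp add: two_sided_BM_def L_def)
      ultimately have D: "distributed M lborel ?X (normal_density 0 (sqrt V))"
        unfolding XL VL using sum_indep_normal[OF finL False, of "\<lambda>j \<omega>. 0 + d j * ?\<Delta> j \<omega>" "\<lambda>j. \<bar>d j\<bar> * sqrt (\<tau> (Suc j) - \<tau> j)" "\<lambda>_. 0"] incr
        by (simp add: L_def)
      have "V > 0" unfolding VL using finL False incr
        by (intro sum_pos) (auto simp: L_def less_imp_neq[OF incr, symmetric])
      then show ?thesis using normal_second_moment[OF _ D] D by (auto simp: centred_gaussian_rv_def)
    qed
    \<comment> \<open>The cells are pairwise disjoint, so the mixed terms of the square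
      vanish.\<close>
    have sq: "(\<Sum>j<m. d j * indicator {\<tau> j<..\<tau> (Suc j)} x)\<^sup>2 = (\<Sum>j<m. (d j)\<^sup>2 * indicat_real {\<tau> j<..\<tau> (Suc j)} x)" for x
    proof -
      have disj: "{\<tau> j<..\<tau> (Suc j)} \<inter> {\<tau> k<..\<tau> (Suc k)} = {}" if "j < k" for j k
      proof -
        have "\<tau> (Suc j) \<le> \<tau> k" using that strict_mono_less_eq[OF \<tau>] by simp
        then show ?thesis by auto
      qed
      have "d j * indicat_real {\<tau> j<..\<tau> (Suc j)} x * (d k * indicat_real {\<tau> k<..\<tau> (Suc k)} x) =
          (if k = j then (d j)\<^sup>2 * indicat_real {\<tau> j<..\<tau> (Suc j)} x else 0)" for j k
        using disj[of j k] disj[of k j]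
        by (cases j k rule: linorder_cases) (auto simp: indicator_def power2_eq_square)
      then show ?thesis unfolding power2_eq_square[of "sum _ _"] sum_product by (simp add: power2_eq_square)
    qed
    have "(\<integral>s. (\<Sum>i<n. c i * indicator (case a i of (s, t) \<Rightarrow> {s<..t}) s)\<^sup>2 \<partial>lborel) =
        (\<integral>s. (\<Sum>j<m. (d j)\<^sup>2 * indicat_real {\<tau> j<..\<tau> (Suc j)} s) \<partial>lborel)"
      unfolding Y sq ..
    also have "\<dots> = (\<Sum>j<m. \<integral>s. (d j)\<^sup>2 * indicat_real {\<tau> j<..\<tau> (Suc j)} s \<partial>lborel)"
      by (intro Bochner_Integration.integral_sum integrable_mult_right) (simp add: less_imp_le[OF incr])
    also have "\<dots> = V" unfolding V_def by (intro sum.cong) (simp_all add: less_imp_le[OF incr])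
    finally show ?thesis unfolding X using X_gauss by (simp only:)
  qed
  show ?thesis
  proof
    show "(case i of (s, t) \<Rightarrow> {s<..t}) \<in> finite_borel_sets"
      if "i \<in> {(s, t). s \<le> t}" for i :: "real \<times> real"
      using that by (cases i) (auto simp: finite_borel_sets_def)
  next
    fix n :: nat and a :: "nat \<Rightarrow> real \<times> real" and c :: "nat \<Rightarrow> real"
    assume a: "\<And>i. i < n \<Longrightarrow> a i \<in> {(s, t). s \<le> t}"
    show "centred_gaussian_rv M (\<lambda>\<omega>. \<Sum>i<n. c i * (case a i of (s, t) \<Rightarrow> \<lambda>\<omega>. W t \<omega> - W s \<omega>) \<omega>)"
      by (rule main[THEN conjunct1]) (rule a)
    show "expectation (\<lambda>\<omega>. (\<Sum>i<n. c i * (case a i of (s, t) \<Rightarrow> \<lambda>\<omega>. W t \<omega> - W s \<omega>) \<omega>)\<^sup>2) =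
      (\<integral>s. (\<Sum>i<n. c i * indicator (case a i of (s, t) \<Rightarrow> {s<..t}) s)\<^sup>2 \<partial>lborel)"
      by (rule main[THEN conjunct2]) (rule a)
  qed
qed

section \<open>Asymptotics of the normalizing constants\<close>

lemma tendsto_sin_pi_div_at_right: "((\<lambda>H::real. sin (pi * H) / H) \<longlongrightarrow> pi) (at_right 0)"
proof -
  have "((\<lambda>H. sin (pi * H)) has_real_derivative pi) (at 0)"
    by (auto intro!: derivative_eq_intros)
  then have "((\<lambda>H. sin (pi * H) / H) \<longlongrightarrow> pi) (at 0)"
    by (simp add: has_field_derivative_iff)
  then show ?thesis by (rule tendsto_within_subset) simp
qed

lemma pos_not_nonpos_Int: "0 < (x::real) \<Longrightarrow> x \<notin> \<int>\<^sub>\<le>\<^sub>0"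
  by (auto elim!: nonpos_Ints_cases)

lemma tendsto_Gamma_affine_at_right:
  assumes "0 < (b::real)"
  shows "((\<lambda>H. Gamma (a * H + b)) \<longlongrightarrow> Gamma b) (at_right 0)"
proof (rule tendsto_Gamma)
  show "((\<lambda>H. a * H + b) \<longlongrightarrow> b) (at_right 0)" by (auto intro!: tendsto_eq_intros)
  show "b \<notin> \<int>\<^sub>\<le>\<^sub>0" using assms by (rule pos_not_nonpos_Int)
qed

lemma Gamma_plus1_pos: "0 < (x::real) \<Longrightarrow> Gamma (x + 1) = x * Gamma x"
  by (rule Gamma_plus1) (rule pos_not_nonpos_Int)

lemma mvn_const_pos: "0 < H \<Longrightarrow> H < 1/2 \<Longrightarrow> 0 < mvn_const H"
  by (auto simp: mvn_const_def intro!: divide_pos_pos mult_pos_pos sin_gt_zero Gamma_real_pos)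

text \<open>The pole of \<open>Gamma H\<close> cancels the zero of the sine: their product is
  \<open>Gamma (H + 1) * (sin (pi * H) / H)\<close>, which tends to \<open>pi\<close>, the square of
  \<open>Gamma (1/2)\<close>.\<close>

lemma mvn_const_limit: "((\<lambda>H. Gamma H powr (1/2) * mvn_const H) \<longlongrightarrow> 1) (at_right 0)"
proof -
  note G = tendsto_Gamma_affine_at_right[of 1 1] tendsto_Gamma_affine_at_right[of 1 2] tendsto_Gamma_affine_at_right[of "1/2" 1]
  have "((\<lambda>H. sqrt (Gamma (1 * H + 1) * Gamma (2 * H + 1) * (sin (pi * H) / H)) / Gamma (1 * H + 1/2))
      \<longlongrightarrow> sqrt (Gamma 1 * Gamma 1 * pi) / Gamma (1/2)) (at_right 0)"
    by (intro tendsto_divide tendsto_mult tendsto_real_sqrt tendsto_sin_pi_div_at_right G) (simp_all add: Gamma_one_half_real)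
  also have "sqrt (Gamma 1 * Gamma 1 * pi) / Gamma (1/2) = (1::real)"
    by (simp add: Gamma_one_half_real)
  finally show ?thesis
  proof (rule Lim_transform_eventually)
    show "\<forall>\<^sub>F H in at_right 0. sqrt (Gamma (1 * H + 1) * Gamma (2 * H + 1) * (sin (pi * H) / H)) / Gamma (1 * H + 1/2)
        = Gamma H powr (1/2) * mvn_const H"
      using eventually_at_right_less[of "0::real"]
    proof eventually_elim
      case (elim H)
      have "Gamma (1 * H + 1) * Gamma (2 * H + 1) * (sin (pi * H) / H) = Gamma H * (Gamma (2 * H + 1) * sin (pi * H))"
        using elim by (simp add: Gamma_plus1_pos)
      then show ?case using elim Gamma_real_pos[of H]
        by (simp add: mvn_const_def powr_half_sqrt real_sqrt_mult)
    qed
  qed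
qed

lemma wb_const_pos:
  assumes "1 \<le> d" "0 < H" "H < 1/2"
  shows "0 < wb_const d H"
proof -
  have "0 < Gamma (d/4 - H/2)" "0 < Gamma (d/4 + H/2)" "0 < Gamma (H + d/2)" "0 < Gamma (2 * H)" "0 < Gamma (H + 1/2)"
    using assms by (auto intro!: Gamma_real_pos)
  moreover have "0 < sin (pi * H)" using assms by (intro sin_gt_zero) auto
  ultimately show ?thesis unfolding wb_const_def real_sqrt_gt_0_iff
    using assms(2) by (intro divide_pos_pos mult_pos_pos zero_less_power) (assumption | simp)+
qed

text \<open>The number under the root is the area of the unit sphere, that is
  \<open>\<kappa> * d\<close> when \<open>\<kappa>\<close> is the volume of the unit ball. The pole
  of \<open>Gamma (2 * H)\<close> is removed by the factor \<open>H\<close>, that of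
  \<open>Gamma H\<close> by the sine.\<close>

lemma wb_const_limit:
  assumes "1 \<le> d"
  shows "((\<lambda>H. Gamma H powr (1/2) * wb_const d H) \<longlongrightarrow> 1 / sqrt (unit_ball_vol d * d)) (at_right 0)"
proof -
  let ?E = "\<lambda>H. (Gamma ((-1/2) * H + d/4))\<^sup>2 * Gamma (1 * H + d/2) * Gamma (1 * H + 1) * (Gamma (2 * H + 1) / 2) * (sin (pi * H) / H) /
      (2 powr (2 * H) * pi powr ((d + 1) / 2) * (Gamma ((1/2) * H + d/4))\<^sup>2 * Gamma (1 * H + 1/2))"
  let ?L = "(Gamma (d/4))\<^sup>2 * Gamma (d/2) * Gamma 1 * (Gamma 1 / 2) * pi / (1 * pi powr ((d + 1) / 2) * (Gamma (d/4))\<^sup>2 * Gamma (1/2))"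
  note G = tendsto_Gamma_affine_at_right[of 1 1] tendsto_Gamma_affine_at_right[of 1 2] tendsto_Gamma_affine_at_right[of "1/2" 1]
    tendsto_Gamma_affine_at_right[of "d/4" "-1/2"] tendsto_Gamma_affine_at_right[of "d/4" "1/2"] tendsto_Gamma_affine_at_right[of "d/2" 1]
  have pos: "Gamma (d/4) \<noteq> 0" "Gamma (d/2) \<noteq> 0"
    using assms Gamma_real_pos[of "d/4"] Gamma_real_pos[of "d/2"] by linarith+
  have two: "((\<lambda>H::real. 2 powr (2 * H)) \<longlongrightarrow> 1) (at_right 0)"
  proof -
    have "((\<lambda>H::real. 2 powr (2 * H)) \<longlongrightarrow> 2 powr (2 * 0)) (at_right 0)"
      by (intro tendsto_powr tendsto_mult tendsto_const tendsto_ident_at) simp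
    then show ?thesis by simp
  qed
  have "((\<lambda>H. sqrt (?E H)) \<longlongrightarrow> sqrt ?L) (at_right 0)"
    by (intro tendsto_real_sqrt tendsto_divide tendsto_mult tendsto_power tendsto_const tendsto_sin_pi_div_at_right two G)
       (use assms in \<open>simp_all add: Gamma_one_half_real pos\<close>)
  moreover have "sqrt ?L = 1 / sqrt (unit_ball_vol d * d)"
  proof -
    have "unit_ball_vol d * d = pi powr (d/2) * 2 / Gamma (d/2)"
      using assms pos Gamma_plus1_pos[of "d/2"] by (simp only: unit_ball_vol_def) simp
    moreover have "pi powr ((d + 1) / 2) = pi powr (d/2) * sqrt pi"
      by (simp add: add_divide_distrib powr_add powr_half_sqrt)
    ultimately have "?L = 1 / (unit_ball_vol d * d)"
      using assms by (simp only:) (simp add: Gamma_one_half_real pos)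
    then show ?thesis by (simp add: real_sqrt_divide)
  qed
  ultimately have "((\<lambda>H. sqrt (?E H)) \<longlongrightarrow> 1 / sqrt (unit_ball_vol d * d)) (at_right 0)" by (simp only:)
  then show ?thesis
  proof (rule Lim_transform_eventually)
    show "\<forall>\<^sub>F H in at_right 0. sqrt (?E H) = Gamma H powr (1/2) * wb_const d H"
      using eventually_at_right_less[of "0::real"]
    proof eventually_elim
      case (elim H)
      have 1: "Gamma (1 * H + 1) = H * Gamma H" using elim Gamma_plus1_pos[of H] by simp
      have 2: "Gamma (2 * H + 1) / 2 = H * Gamma (2 * H)" using elim Gamma_plus1_pos[of "2 * H"] by simp
      have 3: "(-1/2) * H + d/4 = d/4 - H/2" "(1/2) * H + d/4 = d/4 + H/2" "1 * H + d/2 = H + d/2" "1 * H + 1/2 = H + 1/2"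
        by simp_all
      have "?E H = Gamma H * ((Gamma (d/4 - H/2))\<^sup>2 * Gamma (H + d/2) * H * Gamma (2 * H) * sin (pi * H) /
             (2 powr (2 * H) * pi powr ((d + 1) / 2) * (Gamma (d/4 + H/2))\<^sup>2 * Gamma (H + 1/2)))"
        unfolding 1 2 3 using elim by simp
      then show ?case using elim Gamma_real_pos[of H]
        by (simp only: wb_const_def powr_half_sqrt real_sqrt_mult[symmetric] less_imp_le)
    qed
  qed
qed

section \<open>Averages of second order processes\<close>

context prob_space begin

text \<open>By Tonelli the integral of the square over \<open>\<mu>\<close> has finite expectation,
  hence is finite almost surely; on a probability space square integrable functions are
  integrable.\<close>

lemma AE_integrable_of_second_moments:
  assumes "prob_space \<mu>" and D [measurable]: "(\<lambda>(\<omega>, u). D \<omega> u) \<in> borel_measurable (M \<Otimes>\<^sub>M \<mu>)"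
    and p: "\<And>u. u \<in> space \<mu> \<Longrightarrow> (\<integral>\<^sup>+ \<omega>. ennreal ((D \<omega> u :: real)\<^sup>2) \<partial>M) \<le> p u" "(\<integral>\<^sup>+ u. p u \<partial>\<mu>) < \<infinity>"
  shows "AE \<omega> in M. integrable \<mu> (D \<omega>)"
proof -
  interpret \<mu>: prob_space \<mu> by fact
  interpret P: pair_sigma_finite M \<mu> ..
  have "(\<integral>\<^sup>+ \<omega>. \<integral>\<^sup>+ u. ennreal ((D \<omega> u)\<^sup>2) \<partial>\<mu> \<partial>M) = (\<integral>\<^sup>+ u. \<integral>\<^sup>+ \<omega>. ennreal ((D \<omega> u)\<^sup>2) \<partial>M \<partial>\<mu>)"
    by (rule P.Fubini'[symmetric]) measurable
  also have "\<dots> \<le> (\<integral>\<^sup>+ u. p u \<partial>\<mu>)" by (intro nn_integral_mono p)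
  also have "\<dots> < \<infinity>" by fact
  finally have "AE \<omega> in M. (\<integral>\<^sup>+ u. ennreal ((D \<omega> u)\<^sup>2) \<partial>\<mu>) \<noteq> \<infinity>"
    by (intro nn_integral_PInf_AE) auto
  then show ?thesis using AE_space
  proof eventually_elim
    case (elim \<omega>)
    show ?case
    proof -
      have True: "\<omega> \<in> space M" by (rule elim)
      have m [measurable]: "D \<omega> \<in> borel_measurable \<mu>"
        using measurable_compose[OF measurable_Pair1'[OF True] D] by simp
      have "integrable \<mu> (\<lambda>u. (D \<omega> u)\<^sup>2)"
        by (rule integrableI_nonneg) (use elim in \<open>auto simp: less_top\<close>)
      then show ?thesis using integrable_mult_of_squares[of "D \<omega>" \<mu> "\<lambda>_. 1"] by simp
    qed
  qed
qed

text \<open>Fubini on the triple product. The product of the two increments is dominated by the sum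
  of their squares, so its expected absolute value is at most \<open>p u + q v\<close>, a separated
  bound that integrates over \<open>\<mu>\<close> and \<open>\<nu>\<close> one at a time.\<close>

lemma expectation_product_of_integrals:
  fixes D :: "_ \<Rightarrow> 'b \<Rightarrow> real" and D' :: "_ \<Rightarrow> 'c \<Rightarrow> real"
  assumes "prob_space \<mu>" "prob_space \<nu>"
    and D [measurable]: "(\<lambda>(\<omega>, u). D \<omega> u) \<in> borel_measurable (M \<Otimes>\<^sub>M \<mu>)"
    and D' [measurable]: "(\<lambda>(\<omega>, v). D' \<omega> v) \<in> borel_measurable (M \<Otimes>\<^sub>M \<nu>)"
    and p [measurable]: "p \<in> borel_measurable \<mu>" and p': "\<And>u. u \<in> space \<mu> \<Longrightarrow> (\<integral>\<^sup>+ \<omega>. ennreal ((D \<omega> u)\<^sup>2) \<partial>M) \<le> p u"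
      "(\<integral>\<^sup>+ u. p u \<partial>\<mu>) < \<infinity>"
    and q [measurable]: "q \<in> borel_measurable \<nu>" and q': "\<And>v. v \<in> space \<nu> \<Longrightarrow> (\<integral>\<^sup>+ \<omega>. ennreal ((D' \<omega> v)\<^sup>2) \<partial>M) \<le> q v"
      "(\<integral>\<^sup>+ v. q v \<partial>\<nu>) < \<infinity>"
  shows "integrable (\<mu> \<Otimes>\<^sub>M \<nu>) (\<lambda>(u, v). expectation (\<lambda>\<omega>. D \<omega> u * D' \<omega> v))"
    and "expectation (\<lambda>\<omega>. (\<integral>u. D \<omega> u \<partial>\<mu>) * (\<integral>v. D' \<omega> v \<partial>\<nu>)) =
      (\<integral>(u, v). expectation (\<lambda>\<omega>. D \<omega> u * D' \<omega> v) \<partial>(\<mu> \<Otimes>\<^sub>M \<nu>))"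
proof -
  interpret \<mu>: prob_space \<mu> by fact
  interpret \<nu>: prob_space \<nu> by fact
  interpret P: pair_prob_space \<mu> \<nu> ..
  interpret T: pair_sigma_finite M "\<mu> \<Otimes>\<^sub>M \<nu>" ..
  let ?G = "\<lambda>\<omega> (u, v). D \<omega> u * D' \<omega> v"
  have G [measurable]: "(\<lambda>(\<omega>, w). ?G \<omega> w) \<in> borel_measurable (M \<Otimes>\<^sub>M (\<mu> \<Otimes>\<^sub>M \<nu>))"
    by measurable
  have "(\<integral>\<^sup>+ \<omega>. \<integral>\<^sup>+ w. ennreal \<bar>?G \<omega> w\<bar> \<partial>(\<mu> \<Otimes>\<^sub>M \<nu>) \<partial>M) = (\<integral>\<^sup>+ w. \<integral>\<^sup>+ \<omega>. ennreal \<bar>?G \<omega> w\<bar> \<partial>M \<partial>(\<mu> \<Otimes>\<^sub>M \<nu>))"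
    by (rule T.Fubini'[symmetric]) measurable
  also have "\<dots> \<le> (\<integral>\<^sup>+ w. p (fst w) + q (snd w) \<partial>(\<mu> \<Otimes>\<^sub>M \<nu>))"
  proof (rule nn_integral_mono)
    fix w assume "w \<in> space (\<mu> \<Otimes>\<^sub>M \<nu>)"
    then obtain u v where w: "w = (u, v)" "u \<in> space \<mu>" "v \<in> space \<nu>" by (auto simp: space_pair_measure)
    have [measurable]: "(\<lambda>\<omega>. D \<omega> u) \<in> borel_measurable M" "(\<lambda>\<omega>. D' \<omega> v) \<in> borel_measurable M"
      using measurable_compose[OF measurable_Pair2'[OF w(2)] D] measurable_compose[OF measurable_Pair2'[OF w(3)] D'] by simp_all
    have ab: "\<bar>a * b\<bar> \<le> a\<^sup>2 + b\<^sup>2" for a b :: real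
      using sum_squares_bound[of a b] sum_squares_bound[of a "-b"] by (auto simp: abs_le_iff)
    have ab': "ennreal \<bar>a * b\<bar> \<le> ennreal (a\<^sup>2) + ennreal (b\<^sup>2)" for a b :: real
      by (subst ennreal_plus[symmetric]) (simp_all add: ab ennreal_leI del: ennreal_plus)
    have "(\<integral>\<^sup>+ \<omega>. ennreal \<bar>?G \<omega> w\<bar> \<partial>M) \<le> (\<integral>\<^sup>+ \<omega>. ennreal ((D \<omega> u)\<^sup>2) + ennreal ((D' \<omega> v)\<^sup>2) \<partial>M)"
      unfolding w(1) by (intro nn_integral_mono) (simp only: prod.case ab')
    also have "\<dots> = (\<integral>\<^sup>+ \<omega>. ennreal ((D \<omega> u)\<^sup>2) \<partial>M) + (\<integral>\<^sup>+ \<omega>. ennreal ((D' \<omega> v)\<^sup>2) \<partial>M)"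
      by (rule nn_integral_add) measurable
    also have "\<dots> \<le> p u + q v" by (intro add_mono p'(1) q'(1) w)
    finally show "(\<integral>\<^sup>+ \<omega>. ennreal \<bar>?G \<omega> w\<bar> \<partial>M) \<le> p (fst w) + q (snd w)" by (simp add: w(1))
  qed
  also have "\<dots> = (\<integral>\<^sup>+ u. p u \<partial>\<mu>) + (\<integral>\<^sup>+ v. q v \<partial>\<nu>)"
  proof -
    have "(\<integral>\<^sup>+ w. p (fst w) \<partial>(\<mu> \<Otimes>\<^sub>M \<nu>)) = (\<integral>\<^sup>+ u. p u \<partial>\<mu>)"
      by (subst \<nu>.nn_integral_fst[symmetric]) (simp_all add: \<nu>.emeasure_space_1)
    moreover have "(\<integral>\<^sup>+ w. q (snd w) \<partial>(\<mu> \<Otimes>\<^sub>M \<nu>)) = (\<integral>\<^sup>+ v. q v \<partial>\<nu>)"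
      by (subst \<nu>.nn_integral_fst[symmetric]) (simp_all add: \<mu>.emeasure_space_1)
    moreover have "(\<integral>\<^sup>+ w. p (fst w) + q (snd w) \<partial>(\<mu> \<Otimes>\<^sub>M \<nu>)) =
        (\<integral>\<^sup>+ w. p (fst w) \<partial>(\<mu> \<Otimes>\<^sub>M \<nu>)) + (\<integral>\<^sup>+ w. q (snd w) \<partial>(\<mu> \<Otimes>\<^sub>M \<nu>))"
      by (rule nn_integral_add) measurable
    ultimately show ?thesis by (simp only:)
  qed
  also have "\<dots> < \<infinity>" using p'(2) q'(2) by simp
  finally have fin: "(\<integral>\<^sup>+ \<omega>. \<integral>\<^sup>+ w. ennreal \<bar>?G \<omega> w\<bar> \<partial>(\<mu> \<Otimes>\<^sub>M \<nu>) \<partial>M) < \<infinity>" .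
  have int: "integrable (M \<Otimes>\<^sub>M (\<mu> \<Otimes>\<^sub>M \<nu>)) (\<lambda>(\<omega>, w). ?G \<omega> w)"
    unfolding integrable_iff_bounded
  proof (intro conjI G)
    have "(\<integral>\<^sup>+ x. ennreal (norm (case x of (\<omega>, w) \<Rightarrow> ?G \<omega> w)) \<partial>(M \<Otimes>\<^sub>M (\<mu> \<Otimes>\<^sub>M \<nu>))) =
        (\<integral>\<^sup>+ \<omega>. \<integral>\<^sup>+ w. ennreal \<bar>?G \<omega> w\<bar> \<partial>(\<mu> \<Otimes>\<^sub>M \<nu>) \<partial>M)"
      by (subst P.nn_integral_fst[symmetric]) simp_all
    then show "(\<integral>\<^sup>+ x. ennreal (norm (case x of (\<omega>, w) \<Rightarrow> ?G \<omega> w)) \<partial>(M \<Otimes>\<^sub>M (\<mu> \<Otimes>\<^sub>M \<nu>))) < \<infinity>" using fin by simp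
  qed
  from T.integrable_snd[OF int] show "integrable (\<mu> \<Otimes>\<^sub>M \<nu>) (\<lambda>(u, v). expectation (\<lambda>\<omega>. D \<omega> u * D' \<omega> v))"
    by (simp add: case_prod_beta')
  have "expectation (\<lambda>\<omega>. (\<integral>u. D \<omega> u \<partial>\<mu>) * (\<integral>v. D' \<omega> v \<partial>\<nu>)) = expectation (\<lambda>\<omega>. \<integral>w. ?G \<omega> w \<partial>(\<mu> \<Otimes>\<^sub>M \<nu>))"
  proof (rule integral_cong_AE)
    show "AE \<omega> in M. (\<integral>u. D \<omega> u \<partial>\<mu>) * (\<integral>v. D' \<omega> v \<partial>\<nu>) = (\<integral>w. ?G \<omega> w \<partial>(\<mu> \<Otimes>\<^sub>M \<nu>))"
      using T.AE_integrable_fst'[OF int]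
    proof eventually_elim
      case (elim \<omega>)
      then have "integrable (\<mu> \<Otimes>\<^sub>M \<nu>) (?G \<omega>)" by simp
      from P.integral_fst'[OF this] show ?case by simp
    qed
    show "(\<lambda>\<omega>. (\<integral>u. D \<omega> u \<partial>\<mu>) * (\<integral>v. D' \<omega> v \<partial>\<nu>)) \<in> borel_measurable M"
      by (intro borel_measurable_times \<mu>.borel_measurable_lebesgue_integral \<nu>.borel_measurable_lebesgue_integral D D')
    show "(\<lambda>\<omega>. \<integral>w. ?G \<omega> w \<partial>(\<mu> \<Otimes>\<^sub>M \<nu>)) \<in> borel_measurable M"
      by (rule P.borel_measurable_lebesgue_integral[OF G])
  qed
  also have "\<dots> = (\<integral>w. expectation (\<lambda>\<omega>. ?G \<omega> w) \<partial>(\<mu> \<Otimes>\<^sub>M \<nu>))"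
    by (rule T.Fubini_integral[OF int, symmetric])
  finally show "expectation (\<lambda>\<omega>. (\<integral>u. D \<omega> u \<partial>\<mu>) * (\<integral>v. D' \<omega> v \<partial>\<nu>)) =
      (\<integral>(u, v). expectation (\<lambda>\<omega>. D \<omega> u * D' \<omega> v) \<partial>(\<mu> \<Otimes>\<^sub>M \<nu>))"
    by (simp add: case_prod_beta')
qed

text \<open>If the square is not integrable, the right-hand side is infinite, so measurability is
  the only condition.\<close>

lemma Jensen_square: "(f :: _ \<Rightarrow> real) \<in> borel_measurable M \<Longrightarrow> ennreal ((expectation f)\<^sup>2) \<le> (\<integral>\<^sup>+ x. ennreal ((f x)\<^sup>2) \<partial>M)"
proof (cases "integrable M (\<lambda>x. (f x)\<^sup>2)")
  case True
  assume [measurable]: "f \<in> borel_measurable M"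
  have "\<bar>expectation f\<bar> \<le> sqrt (expectation (\<lambda>x. (f x)\<^sup>2))"
    by (rule order_trans[OF integral_abs_bound])
       (use integral_Cauchy_Schwarz[of f M "\<lambda>_. 1"] True in \<open>simp add: prob_space\<close>)
  then have "\<bar>expectation f\<bar>\<^sup>2 \<le> (sqrt (expectation (\<lambda>x. (f x)\<^sup>2)))\<^sup>2"
    by (intro power_mono) auto
  then have "(expectation f)\<^sup>2 \<le> expectation (\<lambda>x. (f x)\<^sup>2)" by simp
  then show ?thesis using True by (simp add: nn_integral_eq_integral ennreal_leI)
next
  case False
  assume [measurable]: "f \<in> borel_measurable M"
  have "(\<integral>\<^sup>+ x. ennreal ((f x)\<^sup>2) \<partial>M) = \<infinity>"
  proof (rule ccontr)
    assume "(\<integral>\<^sup>+ x. ennreal ((f x)\<^sup>2) \<partial>M) \<noteq> \<infinity>"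
    then have "integrable M (\<lambda>x. (f x)\<^sup>2)"
      by (intro integrableI_nonneg) (simp_all add: less_top[symmetric])
    then show False using False by simp
  qed
  then show ?thesis by simp
qed

end

section \<open>Radial integrals\<close>

text \<open>A substitute for polar coordinates: the image under the norm of Lebesgue measure on
  \<open>K\<close> gives \<open>{..<r}\<close> the mass \<kappa> r^d for positive r, and therefore
  has density \<kappa> d r^(d-1) on the positive half-line.\<close>

lemma radial_nn_integral:
  fixes K :: "'a::euclidean_space set"
  assumes K [measurable]: "K \<in> sets borel" and "\<kappa> \<ge> 0"
    and vol: "\<And>r. 0 \<le> r \<Longrightarrow> emeasure lborel (K \<inter> ball 0 r) = ennreal (\<kappa> * r ^ DIM('a))"
    and [measurable]: "f \<in> borel_measurable borel"
  shows "(\<integral>\<^sup>+ s. f (norm s) * indicator K s \<partial>lborel) =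
    (\<integral>\<^sup>+ r. f r * (ennreal (\<kappa> * real DIM('a) * r ^ (DIM('a) - 1)) * indicator {0<..} r) \<partial>lborel)"
proof -
  let ?d = "DIM('a)"
  define N1 where "N1 = distr (density lborel (indicator K)) borel (norm :: 'a \<Rightarrow> real)"
  define N2 where "N2 = density lborel (\<lambda>r. ennreal (\<kappa> * real ?d * r ^ (?d - 1)) * indicator {0<..} r)"
  have e1: "emeasure N1 {..<r} = ennreal (\<kappa> * (max r 0) ^ ?d)" for r
  proof -
    have eq: "K \<inter> norm -` {..<r} = K \<inter> ball 0 (max r 0)"
      by (auto simp: max_def not_less; smt (verit) norm_ge_zero)
    have [measurable]: "norm -` {..<r} \<in> sets (borel :: 'a measure)"
      by (auto intro!: borel_open open_vimage continuous_intros)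
    have "emeasure N1 {..<r} = (\<integral>\<^sup>+ s. indicator (K \<inter> norm -` {..<r}) s \<partial>lborel)"
      unfolding N1_def
      by (subst emeasure_distr)
         (auto simp: emeasure_density indicator_inter_arith simp del: nn_integral_indicator intro!: nn_integral_cong)
    also have "\<dots> = emeasure lborel (K \<inter> ball 0 (max r 0))"
      unfolding eq by simp
    finally have "emeasure N1 {..<r} = emeasure lborel (K \<inter> ball 0 (max r 0))" .
    then show ?thesis using vol[of "max r 0"] by simp
  qed
  have e2: "emeasure N2 {..<r} = ennreal (\<kappa> * (max r 0) ^ ?d)" for r
  proof (cases "0 < r")
    case False
    have "emeasure N2 {..<r} = (\<integral>\<^sup>+ t. (ennreal (\<kappa> * real ?d * t ^ (?d - 1)) * indicator {0<..} t) * indicator {..<r} t \<partial>lborel)"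
      unfolding N2_def by (subst emeasure_density) auto
    also have "\<dots> = (\<integral>\<^sup>+ t. 0 \<partial>(lborel :: real measure))"
      using False by (intro nn_integral_cong) (auto simp: indicator_def)
    finally have "emeasure N2 {..<r} = 0" by simp
    then show ?thesis using False by (simp add: max_def zero_power)
  next
    case True
    have "emeasure N2 {..<r} = (\<integral>\<^sup>+ t. ennreal (\<kappa> * real ?d * t ^ (?d - 1)) * indicator {0..r} t \<partial>lborel)"
      unfolding N2_def
      by (subst emeasure_density, simp, simp, rule nn_integral_cong_AE)
         (use AE_lborel_singleton[of 0] AE_lborel_singleton[of r] in \<open>eventually_elim, auto simp: indicator_def\<close>)
    also have "\<dots> = ennreal (\<kappa> * r ^ ?d - \<kappa> * 0 ^ ?d)"
      by (rule nn_integral_FTC_Icc)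
         (use True \<open>\<kappa> \<ge> 0\<close> in \<open>auto intro!: derivative_eq_intros\<close>)
    finally show ?thesis using True by (simp add: max_def zero_power)
  qed
  have "N1 = N2"
  \<comment> \<open>The sets \<open>{..<r}\<close> are stable under intersection, generate the Borel
    sets and have finite measure, so the distribution function determines the measure.\<close>
  proof (rule measure_eqI_generator_eq[where E="range lessThan" and \<Omega>=UNIV and A="\<lambda>n. {..<real n}"])
    show "Int_stable (range (lessThan :: real \<Rightarrow> _))"
    proof -
      have "{..<a} \<inter> {..<b} = {..<min a b}" for a b :: real by auto
      then show ?thesis by (auto simp: Int_stable_def)
    qed
    show "emeasure N1 X = emeasure N2 X" if "X \<in> range lessThan" for X
      using that e1 e2 by auto
    show "sets N1 = sigma_sets UNIV (range lessThan)" "sets N2 = sigma_sets UNIV (range lessThan)"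
      by (auto simp: N1_def N2_def borel_Iio)
    show "(\<Union>i. {..<real i}) = UNIV" by (auto intro: reals_Archimedean2)
  qed (auto simp: e1)
  have "(\<integral>\<^sup>+ s. f (norm s) * indicator K s \<partial>lborel) = (\<integral>\<^sup>+ r. f r \<partial>N1)"
    unfolding N1_def by (simp add: nn_integral_distr nn_integral_density mult.commute)
  also have "\<dots> = (\<integral>\<^sup>+ r. f r * (ennreal (\<kappa> * real ?d * r ^ (?d - 1)) * indicator {0<..} r) \<partial>lborel)"
    unfolding \<open>N1 = N2\<close> N2_def by (simp add: nn_integral_density mult.commute)
  finally show ?thesis .
qed

lemma powr_minus_mult_power:
  assumes "0 < (r::real)" "n > 0"
  shows "r powr (q - real n) * r ^ (n - 1) = r powr (q - 1)"
  using assms by (simp add: powr_realpow[symmetric] powr_add[symmetric] of_nat_diff)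

text \<open>In radial form the integrand is \<kappa> d r^(q-1). The factor 1/q of the result is
  where the divergence of the covariance at \<open>H + h = 0\<close> comes from.\<close>

lemma nn_integral_cone_powr_near:
  fixes K :: "'a::euclidean_space set"
  assumes K [measurable]: "K \<in> sets borel" and "\<kappa> \<ge> 0"
    and vol: "\<And>r. 0 \<le> r \<Longrightarrow> emeasure lborel (K \<inter> ball 0 r) = ennreal (\<kappa> * r ^ DIM('a))"
    and "q > 0" "R > 0"
  shows "(\<integral>\<^sup>+ s. ennreal (norm s powr (q - real DIM('a)) * indicator (K \<inter> ball 0 R) s) \<partial>lborel) =
    ennreal (\<kappa> * real DIM('a) * R powr q / q)"
proof -
  let ?d = "DIM('a)"
  have "(\<integral>\<^sup>+ s. ennreal (norm s powr (q - ?d) * indicator (K \<inter> ball 0 R) s) \<partial>lborel) =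
    (\<integral>\<^sup>+ s. (ennreal (norm s powr (q - ?d)) * indicator {..<R} (norm s)) * indicator K s \<partial>lborel)"
    by (intro nn_integral_cong) (auto simp: indicator_def)
  also have "\<dots> = (\<integral>\<^sup>+ r. (ennreal (r powr (q - ?d)) * indicator {..<R} r) *
      (ennreal (\<kappa> * real ?d * r ^ (?d - 1)) * indicator {0<..} r) \<partial>lborel)"
    by (rule radial_nn_integral) (use assms in auto)
  also have "\<dots> = (\<integral>\<^sup>+ r. ennreal (\<kappa> * real ?d) * (ennreal (r powr (q - 1)) * indicator {0..R} r) \<partial>lborel)"
  proof (rule nn_integral_cong_AE)
    show "AE r in lborel. ennreal (r powr (q - ?d)) * indicator {..<R} r *
      (ennreal (\<kappa> * real ?d * r ^ (?d - 1)) * indicator {0<..} r) =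
      ennreal (\<kappa> * real ?d) * (ennreal (r powr (q - 1)) * indicator {0..R} r)"
      using AE_lborel_singleton[of 0] AE_lborel_singleton[of R]
    proof eventually_elim
      case (elim r)
      show ?case
      proof (cases "0 < r \<and> r < R")
        case True
        then have "r powr (q - ?d) * (\<kappa> * real ?d * r ^ (?d - 1)) = \<kappa> * real ?d * r powr (q - 1)"
          by (subst powr_minus_mult_power[of r ?d q, symmetric]) auto
        then show ?thesis using True \<open>\<kappa> \<ge> 0\<close> by (simp add: ennreal_mult[symmetric])
      qed (use elim in \<open>auto simp: indicator_def\<close>)
    qed
  qed
  also have "\<dots> = ennreal (\<kappa> * real ?d) * ennreal (R powr q / q)"
  proof -
    have "(\<integral>\<^sup>+ r. ennreal (r powr (q - 1)) * indicator {0..R} r \<partial>lborel) = ennreal (R powr q / q)"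
      using nn_integral_has_integral_lebesgue'[OF _ has_integral_powr_from_0[of "q - 1" R]] assms by simp
    then show ?thesis by (simp add: nn_integral_cmult)
  qed
  also have "\<dots> = ennreal (\<kappa> * real ?d * R powr q / q)"
    using assms by (simp add: ennreal_mult[symmetric])
  finally show ?thesis .
qed

lemma nn_integral_norm_powr_far:
  assumes "q > 0"
  shows "(\<integral>\<^sup>+ s. ennreal (norm (s::'a::euclidean_space) powr (- q - real DIM('a)) * indicator (- ball 0 1) s) \<partial>lborel)
     < \<infinity>"
proof -
  let ?d = "DIM('a)"
  define \<kappa> where "\<kappa> = unit_ball_vol (real ?d)"
  have \<kappa>: "\<kappa> \<ge> 0" by (simp add: \<kappa>_def)
  have "(\<integral>\<^sup>+ s. ennreal (norm (s::'a) powr (- q - ?d) * indicator (- ball 0 1) s) \<partial>lborel) =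
    (\<integral>\<^sup>+ s. (ennreal (norm (s::'a) powr (- q - ?d)) * indicator {1..} (norm s)) * indicator UNIV s \<partial>lborel)"
    by (intro nn_integral_cong) (auto simp: indicator_def)
  also have "\<dots> = (\<integral>\<^sup>+ r. (ennreal (r powr (- q - ?d)) * indicator {1..} r) *
      (ennreal (\<kappa> * real ?d * r ^ (?d - 1)) * indicator {0<..} r) \<partial>lborel)"
    by (rule radial_nn_integral) (use assms \<kappa> in \<open>auto simp: \<kappa>_def emeasure_ball\<close>)
  also have "\<dots> = (\<integral>\<^sup>+ r. ennreal (\<kappa> * real ?d) * (ennreal (r powr (- q - 1)) * indicator {1..} r) \<partial>lborel)"
  proof (rule nn_integral_cong)
    fix r :: real
    show "ennreal (r powr (- q - ?d)) * indicator {1..} r *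
      (ennreal (\<kappa> * real ?d * r ^ (?d - 1)) * indicator {0<..} r) =
      ennreal (\<kappa> * real ?d) * (ennreal (r powr (- q - 1)) * indicator {1..} r)"
    proof (cases "1 \<le> r")
      case True
      then have "r powr (- q - ?d) * (\<kappa> * real ?d * r ^ (?d - 1)) = \<kappa> * real ?d * r powr (- q - 1)"
        by (subst powr_minus_mult_power[of r ?d "-q", symmetric]) auto
      then show ?thesis using True \<kappa> by (simp add: ennreal_mult[symmetric])
    qed auto
  qed
  also have "\<dots> = ennreal (\<kappa> * real ?d) * ennreal (1 / q)"
  proof -
    have "(\<integral>\<^sup>+ r. ennreal (r powr (- q - 1)) * indicator {1..} r \<partial>lborel) = ennreal (1 / q)"
      using nn_integral_has_integral_lebesgue'[OF _ has_integral_powr_to_inf[of "- q - 1" 1]] assms by simp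
    then show ?thesis by (simp add: nn_integral_cmult)
  qed
  also have "\<dots> < \<infinity>" by (simp add: ennreal_mult_less_top)
  finally show ?thesis .
qed

lemma lborel_integral_affine:
  fixes f :: "'a::euclidean_space \<Rightarrow> real"
  assumes [measurable]: "f \<in> borel_measurable borel" and "c \<noteq> 0"
  shows "integrable lborel (\<lambda>x. f (t + c *\<^sub>R x)) \<longleftrightarrow> integrable lborel f"
    and "(\<integral>x. f x \<partial>lborel) = \<bar>c\<bar> ^ DIM('a) * (\<integral>x. f (t + c *\<^sub>R x) \<partial>lborel)"
proof -
  have *: "lborel = density (distr lborel borel (\<lambda>x::'a. t + c *\<^sub>R x)) (\<lambda>_. ennreal (\<bar>c\<bar> ^ DIM('a)))"
    using lborel_affine[OF \<open>c \<noteq> 0\<close>, of t] by (simp add: ennreal_power)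
  have "integrable lborel f \<longleftrightarrow> integrable lborel (\<lambda>x. \<bar>c\<bar> ^ DIM('a) * f (t + c *\<^sub>R x))"
    by (subst *) (simp add: integrable_density integrable_distr_eq)
  also have "\<dots> \<longleftrightarrow> integrable lborel (\<lambda>x. f (t + c *\<^sub>R x))"
    using \<open>c \<noteq> 0\<close> by simp
  finally show "integrable lborel (\<lambda>x. f (t + c *\<^sub>R x)) \<longleftrightarrow> integrable lborel f" ..
  show "(\<integral>x. f x \<partial>lborel) = \<bar>c\<bar> ^ DIM('a) * (\<integral>x. f (t + c *\<^sub>R x) \<partial>lborel)"
    by (subst *) (simp add: integral_density integral_distr)
qed

lemma lborel_translate:
  fixes f :: "'a::euclidean_space \<Rightarrow> real"
  assumes "f \<in> borel_measurable borel"
  shows "integrable lborel (\<lambda>x. f (t + x)) \<longleftrightarrow> integrable lborel f"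
    and "(\<integral>x. f (t + x) \<partial>lborel) = (\<integral>x. f x \<partial>lborel)"
  using lborel_integral_affine[OF assms, of 1 t] by simp_all

lemma lborel_reflect:
  fixes f :: "'a::euclidean_space \<Rightarrow> real"
  assumes "f \<in> borel_measurable borel"
  shows "integrable lborel (\<lambda>x. f (- x)) \<longleftrightarrow> integrable lborel f"
    and "(\<integral>x. f (- x) \<partial>lborel) = (\<integral>x. f x \<partial>lborel)"
  using lborel_integral_affine[OF assms, of "-1" 0] by simp_all

lemma integrable_norm_powr_ball:
  assumes "- real DIM('a) < e" "0 < R"
  shows "integrable lborel (\<lambda>s::'a::euclidean_space. norm s powr e * indicator (ball 0 R) s)"
proof (rule integrableI_nonneg)
  show "(\<integral>\<^sup>+ s. ennreal (norm (s::'a) powr e * indicator (ball 0 R) s) \<partial>lborel) < \<infinity>"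
    using nn_integral_cone_powr_near[of "UNIV::'a set" "unit_ball_vol (real DIM('a))" "e + real DIM('a)" R] assms
    by (simp add: emeasure_ball)
qed (measurable, auto)

lemma integrable_norm_powr_compl_ball:
  assumes "e < - real DIM('a)"
  shows "integrable lborel (\<lambda>s::'a::euclidean_space. norm s powr e * indicator (- ball 0 1) s)"
proof (rule integrableI_nonneg)
  show "(\<integral>\<^sup>+ s. ennreal (norm (s::'a) powr e * indicator (- ball 0 1) s) \<partial>lborel) < \<infinity>"
    using nn_integral_norm_powr_far[of "- e - real DIM('a)", where 'a='a] assms by simp
qed (measurable, auto)

section \<open>Kernels of fractional Brownian fields\<close>

lemma powr_diff_le:
  fixes a :: real
  assumes "0 < m" "m \<le> x" "m \<le> y" "a < 0"
  shows "\<bar>x powr a - y powr a\<bar> \<le> - a * m powr (a - 1) * \<bar>x - y\<bar>"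
proof -
  have main: "\<bar>x powr a - y powr a\<bar> \<le> - a * m powr (a - 1) * \<bar>x - y\<bar>"
    if "m \<le> x" "x < y" for x y
  proof -
    have "\<exists>z>x. z < y \<and> y powr a - x powr a = (y - x) * (a * z powr (a - 1))"
      using that \<open>0 < m\<close> by (intro MVT2) (auto intro!: derivative_eq_intros)
    then obtain z where z: "x < z" "y powr a - x powr a = (y - x) * (a * z powr (a - 1))" by blast
    have "z powr (a - 1) \<le> m powr (a - 1)"
      using z that \<open>0 < m\<close> \<open>a < 0\<close> by (intro powr_mono2') auto
    then have "(y - x) * ((- a) * z powr (a - 1)) \<le> (y - x) * ((- a) * m powr (a - 1))"
      using that \<open>a < 0\<close> by (intro mult_left_mono) auto
    moreover have "\<bar>x powr a - y powr a\<bar> = (y - x) * ((- a) * z powr (a - 1))"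
      using z that \<open>a < 0\<close> by (simp add: abs_minus_commute[of "x powr a"] abs_mult)
    ultimately show ?thesis using that by (simp add: mult_ac)
  qed
  show ?thesis
    using main[of x y] main[of y x] assms by (cases x y rule: linorder_cases) (auto simp: abs_minus_commute)
qed

text \<open>Since \<open>A + B \<ge> 1\<close>, one of the two numbers is at least 1/2 and its power
  is at most \<open>2 powr E\<close>; the other is compared with the most singular exponent
  \<open>- E\<close>. In the application \<open>E\<close> is half the dimension, and
  \<open>2 powr (2 * E)\<close> is the factor in \<open>dom\<close>.\<close>

lemma powr_product_near:
  fixes A B a b E :: real
  assumes "0 \<le> A" "0 \<le> B" "1 \<le> A + B" "- E < a" "a < 0" "- E < b" "b < 0"
  shows "A powr a * B powr b \<le> 2 powr (2 * E) * (1 + B powr (- E) + A powr (- E))"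
proof -
  have half: "x powr c \<le> 2 powr E" if "1/2 \<le> x" "- E < c" "c < 0" for x c :: real
  proof -
    have "x powr c \<le> (1/2) powr c" using that by (intro powr_mono2') auto
    also have "\<dots> = 2 powr (- c)" by (simp add: powr_divide powr_minus field_simps)
    also have "\<dots> \<le> 2 powr E" using that by (intro powr_mono) auto
    finally show ?thesis .
  qed
  have gen: "x powr c \<le> 1 + x powr (- E)" if "0 \<le> x" "- E < c" "c < 0" for x c :: real
  proof -
    consider (zero) "x = 0" | (2) "0 < x" "x \<le> 1" | (3) "1 < x" using \<open>0 \<le> x\<close> by fastforce
    then show ?thesis
    proof cases
      case 2
      then have "x powr c \<le> x powr (- E)" using that by (intro powr_mono') auto
      then show ?thesis by simp
    next
      case 3
      then have "x powr c \<le> x powr 0" using that by (intro powr_mono) auto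
      then show ?thesis using 3 by (auto intro: order_trans[of _ 1])
    qed simp
  qed
  have "2 powr E \<le> 2 powr (2 * E)" using assms by (intro powr_mono) auto
  then have E2: "2 powr E * (1 + B powr (- E) + A powr (- E)) \<le> 2 powr (2 * E) * (1 + B powr (- E) + A powr (- E))"
    by (intro mult_right_mono) auto
  have "A powr a * B powr b \<le> 2 powr E * (1 + B powr (- E) + A powr (- E))"
  proof (cases "B < 1/2")
    case True
    have "A powr a * B powr b \<le> 2 powr E * (1 + B powr (- E))"
      using True assms by (intro mult_mono half gen) auto
    also have "\<dots> \<le> 2 powr E * (1 + B powr (- E) + A powr (- E))" by (intro mult_left_mono) auto
    finally show ?thesis .
  next
    case False
    have "A powr a * B powr b \<le> (1 + A powr (- E)) * 2 powr E"
      using False assms by (intro mult_mono half gen) auto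
    also have "\<dots> \<le> 2 powr E * (1 + B powr (- E) + A powr (- E))"
      by (simp add: algebra_simps)
    finally show ?thesis .
  qed
  with E2 show ?thesis by linarith
qed

text \<open>Far out \<open>A\<close> and \<open>B\<close> are both at least \<open>B / 2\<close>,
  and the mean value theorem gains one power of \<open>B\<close>. The resulting exponent is below
  minus the dimension \<open>2 * E\<close> exactly when \<open>q < 1\<close>, which is where the
  bound on \<open>H + h\<close> matters.\<close>

lemma powr_product_far:
  fixes A B a b E q :: real
  assumes "2 \<le> B" "\<bar>A - B\<bar> \<le> 1" "- E < a" "a < 0" "a + b + 2 * E \<le> q"
  shows "\<bar>A powr a - B powr a\<bar> * B powr b \<le> E * 2 powr (1 + E) * B powr (q - 1 - 2 * E)"
proof -
  have "\<bar>A powr a - B powr a\<bar> \<le> - a * (B/2) powr (a - 1) * \<bar>A - B\<bar>"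
    using assms by (intro powr_diff_le) (auto simp: abs_if split: if_splits)
  also have "\<dots> \<le> - a * (B/2) powr (a - 1) * 1"
    using assms by (intro mult_left_mono mult_nonneg_nonneg) auto
  also have "(B/2) powr (a - 1) = 2 powr (1 - a) * B powr (a - 1)"
    using assms by (simp add: powr_divide powr_diff powr_minus field_simps)
  also have "- a * (2 powr (1 - a) * B powr (a - 1)) * 1 \<le> E * (2 powr (1 + E) * B powr (a - 1))"
    unfolding mult_1_right using assms by (intro mult_mono powr_mono) auto
  finally have "\<bar>A powr a - B powr a\<bar> * B powr b \<le> E * (2 powr (1 + E) * B powr (a - 1)) * B powr b"
    by (intro mult_right_mono) auto
  also have "\<dots> = E * 2 powr (1 + E) * B powr (a + b - 1)"
    using assms by (simp add: powr_add powr_diff)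
  also have "\<dots> \<le> E * 2 powr (1 + E) * B powr (q - 1 - 2 * E)"
    using assms by (intro mult_left_mono powr_mono) auto
  finally show ?thesis .
qed

text \<open>\<open>stable\<close> rules out boundary effects at infinity: far from the origin
  \<open>z + s\<close> and \<open>s\<close> lie in \<open>K\<close> together, so the increment of
  the kernel is a true difference of powers. It holds for the whole space and, on the line, for a
  half-line. The number \<open>\<kappa> * DIM('a)\<close> measures the directions contained in
  \<open>K\<close>.\<close>

locale cone_kernel =
  fixes K :: "'a::euclidean_space set" and \<kappa> :: real
  assumes K_borel [measurable]: "K \<in> sets borel"
    and cone: "\<And>s r. s \<in> K \<Longrightarrow> 0 < r \<Longrightarrow> r *\<^sub>R s \<in> K"
    and stable: "\<And>s z. 2 \<le> norm s \<Longrightarrow> norm z = 1 \<Longrightarrow> z + s \<in> K \<longleftrightarrow> s \<in> K"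
    and \<kappa>_pos: "0 < \<kappa>"
    and vol: "\<And>r. 0 \<le> r \<Longrightarrow> emeasure lborel (K \<inter> ball 0 r) = ennreal (\<kappa> * r ^ DIM('a))"
begin

definition v :: "real \<Rightarrow> 'a \<Rightarrow> real" where
  "v H s = norm s powr (H - real DIM('a) / 2) * indicator K s"

text \<open>For positive parameters the product \<open>v H (z + s) * v h s\<close> alone is not
  integrable at infinity. The subtracted term does not depend on \<open>z\<close>, makes the
  integral converge, and drops out of the second differences that form the covariance of
  increments.\<close>

definition phi_integrand :: "real \<Rightarrow> real \<Rightarrow> 'a \<Rightarrow> 'a \<Rightarrow> real" where
  "phi_integrand H h z s = (v H (z + s) - v H s) * v h s"

definition \<phi> :: "real \<Rightarrow> real \<Rightarrow> 'a \<Rightarrow> real" where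
  "\<phi> H h z = (\<integral>s. phi_integrand H h z s \<partial>lborel)"

text \<open>A majorant that depends on \<open>H\<close> and \<open>h\<close> only through an upper
  bound \<open>q\<close> of their sum. The first bracket is \<open>powr_product_near\<close> on
  \<open>norm s < 2\<close>, where \<open>norm (z + s) < 3\<close>; its 2 also accounts for the
  bounded power on \<open>1 \<le> norm s < 2\<close>. The last summand is
  \<open>powr_product_far\<close>.\<close>

definition dom :: "real \<Rightarrow> 'a \<Rightarrow> 'a \<Rightarrow> real" where
  "dom q z s = 2 powr real DIM('a) *
      (2 * indicator (ball 0 2) s + norm s powr (- real DIM('a) / 2) * indicator (ball 0 2) s
        + norm (z + s) powr (- real DIM('a) / 2) * indicator (ball 0 3) (z + s))
    + real DIM('a) / 2 * 2 powr (1 + real DIM('a) / 2) *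
      (norm s powr (q - 1 - real DIM('a)) * indicator (- ball 0 1) s)"

lemma v_measurable [measurable]: "v H \<in> borel_measurable borel"
  unfolding v_def[abs_def] by measurable

lemma phi_integrand_measurable [measurable]: "phi_integrand H h z \<in> borel_measurable borel"
  unfolding phi_integrand_def[abs_def] by measurable

lemma v_scale:
  assumes "0 < r"
  shows "v H (r *\<^sub>R s) = r powr (H - real DIM('a) / 2) * v H s"
proof -
  have "r *\<^sub>R s \<in> K \<longleftrightarrow> s \<in> K"
    using cone[of s r] cone[of "r *\<^sub>R s" "1 / r"] assms by auto
  then show ?thesis using assms by (simp add: v_def powr_mult indicator_def)
qed

text \<open>The point \<open>z\<close> occurs only through a translate, so the integral is the same
  for all \<open>z\<close>; this makes the later bounds uniform on the sphere.\<close>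

lemma integrable_dom: "q < 1 \<Longrightarrow> integrable lborel (dom q z)"
  and integral_dom: "q < 1 \<Longrightarrow> (\<integral>s. dom q z s \<partial>lborel) = (\<integral>s. dom q 0 s \<partial>lborel)"
proof -
  assume "q < 1"
  let ?f = "\<lambda>s::'a. norm s powr (- real DIM('a) / 2) * indicator (ball 0 3) s"
  have m0: "?f \<in> borel_measurable borel" by (measurable, auto)
  have t0: "integrable lborel ?f" by (rule integrable_norm_powr_ball) auto
  have t3: "integrable lborel (\<lambda>s. ?f (z + s))" for z
    using t0 by (subst lborel_translate) auto
  have t2: "integrable lborel (\<lambda>s::'a. norm s powr (- real DIM('a) / 2) * indicator (ball 0 2) s)"
    by (rule integrable_norm_powr_ball) auto
  have t1: "integrable lborel (\<lambda>s::'a. 2 * indicator (ball 0 2) s :: real)"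
    by (auto simp: emeasure_ball)
  have t4: "integrable lborel (\<lambda>s::'a. norm s powr (q - 1 - real DIM('a)) * indicator (- ball 0 1) s)"
    using \<open>q < 1\<close> by (intro integrable_norm_powr_compl_ball) auto
  have t123: "integrable lborel (\<lambda>s. 2 * indicator (ball 0 2) s + norm s powr (- real DIM('a) / 2) * indicator (ball 0 2) s
        + ?f (z + s))" for z
    by (intro Bochner_Integration.integrable_add t1 t2 t3)
  show "integrable lborel (dom q z)"
    unfolding dom_def
    by (intro Bochner_Integration.integrable_add integrable_mult_right t1 t2 t3 t4)
  have eq: "(\<integral>s. dom q z s \<partial>lborel) = 2 powr real DIM('a) *
      ((\<integral>(s::'a). 2 * indicator (ball 0 2) s \<partial>lborel) +
       (\<integral>(s::'a). norm s powr (- real DIM('a) / 2) * indicator (ball 0 2) s \<partial>lborel) + (\<integral>s. ?f (z + s) \<partial>lborel)) +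
      real DIM('a) / 2 * 2 powr (1 + real DIM('a) / 2) *
       (\<integral>(s::'a). norm s powr (q - 1 - real DIM('a)) * indicator (- ball 0 1) s \<partial>lborel)" for z
    unfolding dom_def
    by (subst Bochner_Integration.integral_add; (intro integrable_mult_right t123 t4)?)
       (simp only: integral_mult_right_zero Bochner_Integration.integral_add[OF Bochner_Integration.integrable_add[OF t1 t2] t3] Bochner_Integration.integral_add[OF t1 t2])
  show "(\<integral>s. dom q z s \<partial>lborel) = (\<integral>s. dom q 0 s \<partial>lborel)"
    unfolding eq[of z] eq[of 0] lborel_translate(2)[OF m0] ..
qed

text \<open>Near the origin the singular part of the integrand is \<open>- v H s * v h s\<close>.
  Adding it back on the unit ball leaves \<open>v H (z + s) * v h s\<close>, whose two singularities
  lie at distance 1 from each other, so only one factor is large at a time and the bound is uniform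
  down to \<open>H = h = 0\<close>.\<close>

lemma phi_integrand_dom:
  assumes "norm z = 1" "0 < H" "0 < h" "H < 1/2" "h < 1/2" "H + h \<le> q"
  shows "\<bar>phi_integrand H h z s + norm s powr (H + h - real DIM('a)) * indicator (K \<inter> ball 0 1) s\<bar> \<le> dom q z s"
proof -
  let ?E = "real DIM('a) / 2"
  have "real DIM('a) \<ge> 1" using DIM_positive[where 'a='a] by linarith
  then have E: "H < ?E" "h < ?E" "H + h < real DIM('a)" "0 < real DIM('a)" using assms by linarith+
  have powE: "norm s powr (H + h - real DIM('a)) = norm s powr (H - ?E) * norm s powr (h - ?E)"
    by (simp flip: powr_add)
  have tri: "norm z \<le> norm (z + s) + norm s" "\<bar>norm (z + s) - norm s\<bar> \<le> norm z"
    using norm_triangle_ineq4[of "z + s" s] norm_triangle_ineq3[of "z + s" s] by simp_all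
  show ?thesis
  proof (cases "norm s < 2")
    case True
    have "norm (z + s) < 3" using norm_triangle_ineq[of z s] True assms by simp
    then have dom: "dom q z s \<ge> 2 powr (2 * ?E) * (1 + norm s powr (- ?E) + norm (z + s) powr (- ?E)) + 2 powr (2 * ?E)"
      using True by (simp add: dom_def algebra_simps)
    have X: "norm (z + s) powr (H - ?E) * norm s powr (h - ?E) \<le>
        2 powr (2 * ?E) * (1 + norm s powr (- ?E) + norm (z + s) powr (- ?E))"
      using tri assms E by (intro powr_product_near) auto
    have Y: "norm s powr (H + h - real DIM('a)) \<le> 2 powr (2 * ?E)" if "1 \<le> norm s"
    proof -
      have "norm s powr (H + h - real DIM('a)) \<le> norm s powr 0"
        using that assms E by (intro powr_mono) auto
      also have "\<dots> \<le> 2 powr (2 * ?E)" using that E by (auto intro: ge_one_powr_ge_zero)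
      finally show ?thesis .
    qed
    define P Q U W where "P = norm (z + s) powr (H - ?E) * norm s powr (h - ?E)"
      and "Q = norm s powr (H + h - real DIM('a))"
      and "U = 2 powr (2 * ?E) * (1 + norm s powr (- ?E) + norm (z + s) powr (- ?E))"
      and "W = 2 powr (2 * ?E)"
    \<comment> \<open>After the cancellation on the unit ball the subtracted product survives only
      on \<open>1 \<le> norm s < 2\<close>, where it is bounded by \<open>W\<close>.\<close>
    have "phi_integrand H h z s + Q * indicator (K \<inter> ball 0 1) s =
      P * (indicator K (z + s) * indicator K s) - Q * indicator (K - ball 0 1) s"
      by (auto simp: phi_integrand_def v_def powE indicator_def algebra_simps P_def Q_def)
    moreover have "0 \<le> P" "0 \<le> Q" "0 \<le> W" "P \<le> U" "1 \<le> norm s \<Longrightarrow> Q \<le> W" "U + W \<le> dom q z s"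
      using dom X Y by (simp_all add: P_def Q_def U_def W_def)
    ultimately show ?thesis unfolding Q_def[symmetric]
      by (cases "norm s < 1"; cases "z + s \<in> K"; cases "s \<in> K") (auto simp: not_less)
  next
    case False
    then have "norm s \<ge> 2" by simp
    have "dom q z s \<ge> ?E * 2 powr (1 + ?E) * norm s powr (q - 1 - 2 * ?E)"
      using False by (simp add: dom_def)
    moreover have "\<bar>norm (z + s) powr (H - ?E) - norm s powr (H - ?E)\<bar> * norm s powr (h - ?E)
        \<le> ?E * 2 powr (1 + ?E) * norm s powr (q - 1 - 2 * ?E)"
      using tri assms E False by (intro powr_product_far) auto
    moreover have "\<bar>phi_integrand H h z s\<bar> \<le> \<bar>norm (z + s) powr (H - ?E) - norm s powr (H - ?E)\<bar> * norm s powr (h - ?E)"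
      using stable[OF \<open>norm s \<ge> 2\<close> \<open>norm z = 1\<close>]
      by (auto simp: phi_integrand_def v_def abs_mult indicator_def)
    ultimately show ?thesis using False by simp
  qed
qed

lemma K_ball_measurable [measurable]: "K \<inter> ball 0 1 \<in> sets borel"
  by simp

lemma integrable_cone_powr_near:
  assumes "0 < q"
  shows "integrable lborel (\<lambda>s. norm s powr (q - real DIM('a)) * indicator (K \<inter> ball 0 1) s)"
    and "(\<integral>s. norm s powr (q - real DIM('a)) * indicator (K \<inter> ball 0 1) s \<partial>lborel) = \<kappa> * real DIM('a) / q"
proof -
  have *: "(\<integral>\<^sup>+ s. ennreal (norm s powr (q - real DIM('a)) * indicator (K \<inter> ball 0 1) s) \<partial>lborel) =
    ennreal (\<kappa> * real DIM('a) / q)"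
    using nn_integral_cone_powr_near[OF K_borel _ vol assms, of 1] \<kappa>_pos by simp
  show "integrable lborel (\<lambda>s. norm s powr (q - real DIM('a)) * indicator (K \<inter> ball 0 1) s)"
    by (rule integrableI_nonneg) (use * in auto)
  show "(\<integral>s. norm s powr (q - real DIM('a)) * indicator (K \<inter> ball 0 1) s \<partial>lborel) = \<kappa> * real DIM('a) / q"
    by (rule integral_eq_nn_integral[THEN trans]) (use * \<kappa>_pos assms in auto)
qed

text \<open>The explicit singular part integrates to \<open>\<kappa> * DIM('a) / (H + h)\<close>,
  and the rest is controlled by the majorant; so the singularity at the origin alone produces the
  growth of \<open>\<phi>\<close>.\<close>

lemma phi_sphere:
  assumes "norm z = 1" "0 < H" "0 < h" "H < 1/2" "h < 1/2" "H + h \<le> q" "q < 1"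
  shows "integrable lborel (phi_integrand H h z)"
    and "\<bar>\<phi> H h z + \<kappa> * real DIM('a) / (H + h)\<bar> \<le> (\<integral>s. dom q 0 s \<partial>lborel)"
proof -
  let ?G = "\<lambda>s. norm s powr (H + h - real DIM('a)) * indicator (K \<inter> ball 0 1) s"
  have G: "integrable lborel ?G" "(\<integral>s. ?G s \<partial>lborel) = \<kappa> * real DIM('a) / (H + h)"
    using integrable_cone_powr_near[of "H + h"] assms by auto
  have FG: "integrable lborel (\<lambda>s. phi_integrand H h z s + ?G s)"
    by (rule Bochner_Integration.integrable_bound[OF integrable_dom[OF \<open>q < 1\<close>, of z]])
       (use phi_integrand_dom[OF assms(1-6)] in \<open>auto intro!: AE_I2 order_trans[OF _ abs_ge_self]\<close>)
  from Bochner_Integration.integrable_diff[OF FG G(1)] show F: "integrable lborel (phi_integrand H h z)"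
    by simp
  have "\<phi> H h z + \<kappa> * real DIM('a) / (H + h) = (\<integral>s. phi_integrand H h z s + ?G s \<partial>lborel)"
    unfolding \<phi>_def by (subst Bochner_Integration.integral_add[OF F G(1)]) (simp add: G(2))
  also have "\<bar>\<dots>\<bar> \<le> (\<integral>s. dom q z s \<partial>lborel)"
    by (rule integral_abs_bound_integral[OF FG integrable_dom[OF \<open>q < 1\<close>]])
       (use phi_integrand_dom[OF assms(1-6)] in auto)
  finally show "\<bar>\<phi> H h z + \<kappa> * real DIM('a) / (H + h)\<bar> \<le> (\<integral>s. dom q 0 s \<partial>lborel)"
    using integral_dom[OF \<open>q < 1\<close>, of z] by simp
qed

lemma phi_scale:
  assumes "0 < r"
  shows "integrable lborel (phi_integrand H h (r *\<^sub>R z)) \<longleftrightarrow> integrable lborel (phi_integrand H h z)"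
    and "\<phi> H h (r *\<^sub>R z) = r powr (H + h) * \<phi> H h z"
proof -
  have "phi_integrand H h (r *\<^sub>R z) (r *\<^sub>R s) =
      r powr (H - real DIM('a) / 2) * r powr (h - real DIM('a) / 2) * phi_integrand H h z s" for s
    unfolding phi_integrand_def scaleR_add_right[symmetric] v_scale[OF assms] by (simp add: algebra_simps)
  also have "r powr (H - real DIM('a) / 2) * r powr (h - real DIM('a) / 2) = r powr (H + h - real DIM('a))"
    by (simp flip: powr_add)
  finally have eq: "phi_integrand H h (r *\<^sub>R z) (r *\<^sub>R s) = r powr (H + h - real DIM('a)) * phi_integrand H h z s" for s .
  show "integrable lborel (phi_integrand H h (r *\<^sub>R z)) \<longleftrightarrow> integrable lborel (phi_integrand H h z)"
    using lborel_integral_affine(1)[of "phi_integrand H h (r *\<^sub>R z)" r 0] assms by (simp add: eq)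
  have "\<phi> H h (r *\<^sub>R z) = r ^ DIM('a) * (r powr (H + h - real DIM('a)) * \<phi> H h z)"
    unfolding \<phi>_def using lborel_integral_affine(2)[of "phi_integrand H h (r *\<^sub>R z)" r 0] assms by (simp add: eq)
  also have "\<dots> = r powr (H + h) * \<phi> H h z"
    using assms by (simp add: powr_diff powr_realpow)
  finally show "\<phi> H h (r *\<^sub>R z) = r powr (H + h) * \<phi> H h z" .
qed

lemma phi_zero [simp]: "phi_integrand H h 0 s = 0" "\<phi> H h 0 = 0"
  by (simp_all add: phi_integrand_def \<phi>_def)

lemma phi_integrable:
  assumes "0 < H" "0 < h" "H < 1/2" "h < 1/2"
  shows "integrable lborel (phi_integrand H h z)"
proof (cases "z = 0")
  case False
  have "integrable lborel (phi_integrand H h (z /\<^sub>R norm z))"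
    by (rule phi_sphere(1)[where q="H + h"]) (use assms False in auto)
  then show ?thesis using phi_scale(1)[of "norm z" H h "z /\<^sub>R norm z"] False by simp
qed (simp add: phi_integrand_def[abs_def])

lemma phi_homogeneous: "z \<noteq> 0 \<Longrightarrow> \<phi> H h z = norm z powr (H + h) * \<phi> H h (z /\<^sub>R norm z)"
  using phi_scale(2)[of "norm z" H h "z /\<^sub>R norm z"] by simp

section \<open>Inner products of the kernels and their positivity\<close>

definition fbm_kernel :: "real \<Rightarrow> 'a \<Rightarrow> 'a \<Rightarrow> real" where
  "fbm_kernel H x s = v H (x - s) - v H (- s)"

lemma fbm_kernel_measurable [measurable]: "fbm_kernel H x \<in> borel_measurable borel"
  unfolding fbm_kernel_def[abs_def] by measurable

lemma fbm_kernel_product: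
  assumes "0 < H" "0 < h" "H < 1/2" "h < 1/2"
  shows "integrable lborel (\<lambda>s. fbm_kernel H x s * fbm_kernel h y s)"
    and "(\<integral>s. fbm_kernel H x s * fbm_kernel h y s \<partial>lborel) = \<phi> H h (x - y) - \<phi> H h x - \<phi> H h (- y)"
proof -
  let ?I = "phi_integrand H h"
  have int: "integrable lborel (?I z)" for z using phi_integrable[OF assms] .
  have int': "integrable lborel (\<lambda>s. ?I z (y + s))" "(\<integral>s. ?I z (y + s) \<partial>lborel) = \<phi> H h z" for z
    using int[of z] lborel_translate[of "?I z" y] by (simp_all add: \<phi>_def)
  \<comment> \<open>The product of increments must be split into integrable pieces. The first two
    pieces, shifted by \<open>y\<close>, share the term \<open>v H (y + s) * v h (y + s)\<close>,
    which is not integrable by itself and cancels between them.\<close>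
  have eq: "(\<lambda>s. fbm_kernel H x (- s) * fbm_kernel h y (- s)) = (\<lambda>s. ?I (x - y) (y + s) - ?I (- y) (y + s) - ?I x s)"
    by (auto simp: fun_eq_iff phi_integrand_def fbm_kernel_def algebra_simps)
  have m: "(\<lambda>s. fbm_kernel H x s * fbm_kernel h y s) \<in> borel_measurable borel" by simp
  have "integrable lborel (\<lambda>s. fbm_kernel H x (- s) * fbm_kernel h y (- s))"
    unfolding eq by (intro Bochner_Integration.integrable_diff int int')
  then show "integrable lborel (\<lambda>s. fbm_kernel H x s * fbm_kernel h y s)"
    using lborel_reflect(1)[OF m] by simp
  have "(\<integral>s. fbm_kernel H x s * fbm_kernel h y s \<partial>lborel) = (\<integral>s. fbm_kernel H x (- s) * fbm_kernel h y (- s) \<partial>lborel)"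
    using lborel_reflect(2)[OF m] by simp
  also have "\<dots> = \<phi> H h (x - y) - \<phi> H h x - \<phi> H h (- y)"
    unfolding eq
    by (subst Bochner_Integration.integral_diff Bochner_Integration.integral_diff[OF int'(1) int'(1)];
        (intro Bochner_Integration.integrable_diff int int')?)+
       (simp add: int'(2) \<phi>_def)
  finally show "(\<integral>s. fbm_kernel H x s * fbm_kernel h y s \<partial>lborel) = \<phi> H h (x - y) - \<phi> H h x - \<phi> H h (- y)" .
qed

lemma v_nonneg [simp]: "0 \<le> v H s"
  by (simp add: v_def)

text \<open>All exponents are negative, so the sign of an increment of \<open>v H\<close> does not depend on \<open>H\<close>.\<close>

lemma v_increment_product_nonneg:
  assumes "H < 1/2" "h < 1/2"
  shows "0 \<le> (v H x - v H y) * (v h x - v h y)"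
proof -
  have "real DIM('a) \<ge> 1" using DIM_positive[where 'a='a] by linarith
  then have neg: "H - real DIM('a) / 2 < 0" "h - real DIM('a) / 2 < 0" using assms by linarith+
  have mono: "v G y \<le> v G x" if "x \<in> K" "y \<in> K" "norm x \<le> norm y" "x \<noteq> 0" "G - real DIM('a) / 2 < 0" for G x y
    using that by (auto simp: v_def intro!: powr_mono2')
  show ?thesis
  proof (cases "x \<in> K \<and> y \<in> K \<and> x \<noteq> 0 \<and> y \<noteq> 0")
    case True
    then show ?thesis
      using mono[of x y, OF _ _ _ _ neg(1)] mono[of x y, OF _ _ _ _ neg(2)]
        mono[of y x, OF _ _ _ _ neg(1)] mono[of y x, OF _ _ _ _ neg(2)]
      by (cases "norm x \<le> norm y") (auto intro: mult_nonneg_nonneg mult_nonpos_nonpos)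
  next
    case False
    \<comment> \<open>Outside \<open>K\<close> and, because \<open>0 powr a = 0\<close>, also at the
      origin the function vanishes for both parameters, which leaves a product of two nonnegative
      numbers.\<close>
    then consider "v H x = 0" "v h x = 0" | "v H y = 0" "v h y = 0"
      by (auto simp: v_def)
    then show ?thesis by cases auto
  qed
qed

text \<open>On the part of \<open>K\<close> inside the ball of radius 1/2 a shift by the unit vector
  \<open>e\<close> increases the norm, so away from the origin both increments are strictly negative
  there. This set has positive volume.\<close>

lemma fbm_kernel_product_pos:
  assumes "0 < H" "0 < h" "H < 1/2" "h < 1/2" "norm e = 1"
  shows "0 < (\<integral>s. fbm_kernel H e s * fbm_kernel h e s \<partial>lborel)"
proof -
  let ?P = "\<lambda>s. fbm_kernel H e s * fbm_kernel h e s"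
  let ?Q = "\<lambda>s. (v H (e + s) - v H s) * (v h (e + s) - v h s)"
  have m: "?P \<in> borel_measurable borel" by simp
  have Q: "integrable lborel ?Q" "(\<integral>s. ?Q s \<partial>lborel) = (\<integral>s. ?P s \<partial>lborel)"
    using lborel_reflect[OF m] fbm_kernel_product(1)[OF assms(1-4), of e e] by (simp_all add: fbm_kernel_def)
  have nonneg: "0 \<le> ?Q s" for s by (rule v_increment_product_nonneg) (use assms in auto)
  define S where "S = K \<inter> ball 0 (1/2)"
  have "(\<integral>s. ?Q s \<partial>lborel) \<noteq> 0"
  proof
    assume "(\<integral>s. ?Q s \<partial>lborel) = 0"
    then have "AE s in lborel. ?Q s = 0"
      using integral_nonneg_eq_0_iff_AE[OF Q(1)] nonneg by auto
    then have "AE s in lborel. s \<notin> S"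
      using AE_lborel_singleton[of 0]
    proof eventually_elim
      case (elim s)
      show ?case
      proof
        assume "s \<in> S"
        then have s: "s \<in> K \<inter> ball 0 (1/2)" by (simp add: S_def)
        have "real DIM('a) \<ge> 1" using DIM_positive[where 'a='a] by linarith
        then have neg: "H - real DIM('a) / 2 < 0" "h - real DIM('a) / 2 < 0" using assms by linarith+
        have "norm s < norm (e + s)"
          using s norm_triangle_ineq4[of "e + s" s] assms by simp
        then have "v G (e + s) < v G s" if "G - real DIM('a) / 2 < 0" for G
          using that s elim powr_less_mono2_neg[OF that, of "norm s" "norm (e + s)"]
          by (auto simp: v_def indicator_def)
        from mult_neg_neg[of "v H (e + s) - v H s" "v h (e + s) - v h s"] this[OF neg(1)] this[OF neg(2)]
        have "0 < (v H (e + s) - v H s) * (v h (e + s) - v h s)" by simp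
        then show False using elim by linarith
      qed
    qed
    then have "emeasure lborel S = 0"
      using emeasure_eq_0_AE[of "\<lambda>s. s \<in> S" lborel] by simp
    moreover have "0 < \<kappa> * (1/2) ^ DIM('a)" using \<kappa>_pos by simp
    ultimately show False using vol[of "1/2"] by (simp only: S_def) (simp add: ennreal_eq_0_iff)
  qed
  moreover have "(\<integral>s. ?Q s \<partial>lborel) \<ge> 0" using nonneg by (intro Bochner_Integration.integral_nonneg) auto
  ultimately show ?thesis using Q(2) by linarith
qed

end

section \<open>Reflection invariance and the radial case\<close>

lemma lborel_distr_linear_involution:
  fixes T :: "'a::euclidean_space \<Rightarrow> 'a"
  assumes "linear T" and iso: "\<And>x. norm (T x) = norm x" and inv: "\<And>x. T (T x) = x"
  shows "distr lborel borel T = lborel"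
proof (rule measure_eqI)
  fix A assume "A \<in> sets (distr lborel borel T)"
  then have A [measurable]: "A \<in> sets borel" by simp
  interpret linear T by fact
  have T [measurable]: "T \<in> borel_measurable borel"
    by (rule borel_measurable_continuous_onI) (rule linear_continuous_on[OF linear_conv_bounded_linear[THEN iffD1, OF \<open>linear T\<close>]])
  define B where "B = ball (0::'a) 1"
  have B [measurable]: "B \<in> sets borel" by (simp add: B_def)
  have TB: "T x \<in> B \<longleftrightarrow> x \<in> B" for x by (simp add: B_def iso)
  have TB': "indicator B (T x) = (indicator B x :: ennreal)" for x by (simp add: TB indicator_def)
  have tr: "(\<integral>\<^sup>+ y. f (t + y) \<partial>lborel) = (\<integral>\<^sup>+ y. f y \<partial>lborel)" if [measurable]: "f \<in> borel_measurable borel"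
    for f :: "'a \<Rightarrow> ennreal" and t
    by (subst (2) lborel_distr_plus[of t, symmetric]) (simp add: nn_integral_distr)
  have re: "(\<integral>\<^sup>+ y. f (t - y) \<partial>lborel) = (\<integral>\<^sup>+ y. f y \<partial>lborel)" if [measurable]: "f \<in> borel_measurable borel"
    for f :: "'a \<Rightarrow> ennreal" and t
  proof -
    have "lborel = distr lborel borel ((-) t)" using lborel_affine[of "-1" t] by (simp add: density_1)
    moreover have "(\<integral>\<^sup>+ y. f y \<partial>distr lborel borel ((-) t)) = (\<integral>\<^sup>+ y. f (t - y) \<partial>lborel)"
      by (simp add: nn_integral_distr)
    ultimately show ?thesis by simp
  qed
  \<comment> \<open>The uniqueness argument for translation invariant measures, without
    determinants: the double integral of \<open>indicator A (T x) * indicator B (T x + y)\<close> is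
    evaluated in two orders, using that translations and the reflection of the origin preserve
    \<open>lborel\<close> and that \<open>T\<close> preserves the unit ball \<open>B\<close>. Its
    finite positive volume is cancelled at the end.\<close>
  have "emeasure lborel B * emeasure (distr lborel borel T) A =
      emeasure lborel B * (\<integral>\<^sup>+ x. indicator A (T x) \<partial>lborel)"
    by (simp flip: nn_integral_indicator add: nn_integral_distr)
  also have "\<dots> = (\<integral>\<^sup>+ x. indicator A (T x) * emeasure lborel B \<partial>lborel)"
    by (subst mult.commute, subst nn_integral_multc) simp_all
  also have "\<dots> = (\<integral>\<^sup>+ x. \<integral>\<^sup>+ y. indicator A (T x) * indicator B (T x + y) \<partial>lborel \<partial>lborel)"
  proof (rule nn_integral_cong)
    fix x
    show "indicator A (T x) * emeasure lborel B = (\<integral>\<^sup>+ y. indicator A (T x) * indicator B (T x + y) \<partial>lborel)"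
      using tr[of "indicator B" "T x"] by (simp add: nn_integral_cmult)
  qed
  also have "\<dots> = (\<integral>\<^sup>+ y. \<integral>\<^sup>+ x. indicator A (T x) * indicator B (T x + y) \<partial>lborel \<partial>lborel)"
    by (rule lborel_pair.Fubini') measurable
  also have "\<dots> = (\<integral>\<^sup>+ y. \<integral>\<^sup>+ x. indicator A (T x - y) * indicator B (T x) \<partial>lborel \<partial>lborel)"
  proof (rule nn_integral_cong)
    fix y
    have "T (- T y + x) = T x - y" for x by (simp add: diff inv)
    then show "(\<integral>\<^sup>+ x. indicator A (T x) * indicator B (T x + y) \<partial>lborel) =
        (\<integral>\<^sup>+ x. indicator A (T x - y) * indicator B (T x) \<partial>lborel)"
      using tr[of "\<lambda>x. indicator A (T x) * indicator B (T x + y)" "- T y"] by (simp add: diff inv)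
  qed
  also have "\<dots> = (\<integral>\<^sup>+ x. \<integral>\<^sup>+ y. indicator A (T x - y) * indicator B (T x) \<partial>lborel \<partial>lborel)"
    by (rule lborel_pair.Fubini') measurable
  also have "\<dots> = (\<integral>\<^sup>+ x. emeasure lborel A * indicator B x \<partial>lborel)"
    by (simp add: nn_integral_multc TB' re)
  also have "\<dots> = emeasure lborel B * emeasure lborel A"
    by (subst nn_integral_cmult_indicator) (simp_all add: mult.commute)
  finally have "emeasure lborel B * emeasure (distr lborel borel T) A = emeasure lborel B * emeasure lborel A" .
  moreover have "emeasure lborel B \<noteq> 0" "emeasure lborel B \<noteq> \<infinity>"
    by (simp_all add: B_def emeasure_ball less_imp_neq[OF unit_ball_vol_pos, symmetric])
  ultimately show "emeasure (distr lborel borel T) A = emeasure lborel A"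
    by (simp add: ennreal_mult_cancel_left)
qed simp

text \<open>The Householder reflection in the hyperplane orthogonal to \<open>z - w\<close>.
  Equality of the norms gives \<open>2 * (z \<bullet> n) = n \<bullet> n\<close>, so exactly one
  copy of \<open>n\<close> is subtracted from \<open>z\<close>.\<close>

lemma reflection_swapping:
  fixes z w :: "'a::euclidean_space"
  assumes "norm z = norm w"
  obtains T :: "'a \<Rightarrow> 'a" where "linear T" "\<And>x. norm (T x) = norm x" "\<And>x. T (T x) = x" "T z = w"
proof (cases "z = w")
  case True
  then show ?thesis using that[of "\<lambda>x. x"] by (simp add: linear_id[unfolded id_def])
next
  case False
  define n where "n = z - w"
  have nn: "n \<bullet> n \<noteq> 0" using False by (simp add: n_def)
  define k where "k = 2 / (n \<bullet> n)"
  have k: "k * (n \<bullet> n) = 2" using nn by (simp add: k_def)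
  define T where "T x = x - (k * (x \<bullet> n)) *\<^sub>R n" for x
  have zw: "z \<bullet> z = w \<bullet> w" using assms by (simp add: norm_eq)
  have "k * (z \<bullet> n) = 1"
  proof -
    have "2 * (z \<bullet> n) = n \<bullet> n" unfolding n_def using zw by (simp add: inner_simps inner_commute)
    then show ?thesis using nn by (simp add: k_def)
  qed
  then have "T z = w" by (simp add: T_def) (simp add: n_def)
  moreover have "linear T"
    by (rule linearI) (simp_all add: T_def inner_add_left distrib_left scaleR_left_distrib scaleR_right_diff_distrib mult.left_commute)
  moreover have Tn: "T x \<bullet> n = - (x \<bullet> n)" for x
  proof -
    have "T x \<bullet> n = x \<bullet> n - (k * (n \<bullet> n)) * (x \<bullet> n)" by (simp add: T_def inner_diff_left)
    then show ?thesis using k by simp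
  qed
  moreover have "T (T x) = x" for x
    unfolding T_def[of "T x"] Tn by (simp add: T_def)
  moreover have "norm (T x) = norm x" for x
  proof -
    have "T x \<bullet> T x = T x \<bullet> x - (k * (x \<bullet> n)) * (T x \<bullet> n)"
      by (subst (2) T_def) (simp add: inner_diff_right)
    also have "\<dots> = x \<bullet> x"
      unfolding Tn by (simp add: T_def inner_diff_left inner_diff_right inner_commute)
    finally show ?thesis by (simp add: norm_eq)
  qed
  ultimately show ?thesis using that by blast
qed

context cone_kernel begin

text \<open>Substitution of a reflection that takes \<open>z\<close> to \<open>w\<close>; with
  \<open>K = UNIV\<close> the functions \<open>v H\<close> depend on the norm only.\<close>

lemma phi_radial:
  assumes "K = UNIV" "norm z = norm w"
  shows "\<phi> H h z = \<phi> H h w"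
proof -
  obtain T :: "'a \<Rightarrow> 'a" where T: "linear T" "\<And>x. norm (T x) = norm x" "\<And>x. T (T x) = x" "T z = w"
    using reflection_swapping[OF assms(2)] by metis
  interpret linear T by (rule T)
  have m [measurable]: "T \<in> borel_measurable borel"
    by (rule borel_measurable_continuous_onI) (rule linear_continuous_on[OF linear_conv_bounded_linear[THEN iffD1, OF \<open>linear T\<close>]])
  have "s \<in> K" for s using \<open>K = UNIV\<close> by simp
  then have "phi_integrand H h w (T s) = phi_integrand H h z s" for s
    using T(2)[of "z + s"] by (simp add: phi_integrand_def v_def add T)
  moreover have "\<phi> H h w = (\<integral>s. phi_integrand H h w (T s) \<partial>lborel)"
    unfolding \<phi>_def by (subst (1) lborel_distr_linear_involution[OF T(1-3), symmetric]) (simp add: integral_distr)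
  ultimately show ?thesis by (simp add: \<phi>_def)
qed

end

section \<open>The leading coefficient of \<open>\<phi>\<close>\<close>

context cone_kernel begin

definition e0 :: 'a where "e0 = (SOME b. b \<in> Basis)"

lemma norm_e0 [simp]: "norm e0 = 1"
  unfolding e0_def using someI_ex[of "\<lambda>b. b \<in> (Basis :: 'a set)"] nonempty_Basis by (intro norm_Basis) blast

text \<open>Half the inner product of \<open>fbm_kernel H e0\<close> and
  \<open>fbm_kernel h e0\<close>. The symmetrisation over \<open>e0\<close> and \<open>- e0\<close>
  makes \<open>c\<close> positive for all parameters in (0, 1/2).\<close>

definition c :: "real \<Rightarrow> real \<Rightarrow> real" where
  "c H h = - (\<phi> H h e0 + \<phi> H h (- e0)) / 2"

lemma c_pos: "0 < H \<Longrightarrow> 0 < h \<Longrightarrow> H < 1/2 \<Longrightarrow> h < 1/2 \<Longrightarrow> 0 < c H h"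
  using fbm_kernel_product_pos[of H h e0] fbm_kernel_product(2)[of H h e0 e0]
  by (simp add: c_def field_simps)

text \<open>Both values of \<open>\<phi>\<close> in \<open>c\<close> deviate from the singular part
  by a bounded amount; multiplication by \<open>H + h\<close> turns this into an error that vanishes
  with \<open>H + h\<close>.\<close>

lemma c_bound:
  assumes "0 < H" "0 < h" "H < 1/2" "h < 1/2" "H + h \<le> q" "q < 1"
  shows "\<bar>(H + h) * c H h - \<kappa> * real DIM('a)\<bar> \<le> (H + h) * (\<integral>s. dom q 0 s \<partial>lborel)"
proof -
  have "\<bar>c H h - \<kappa> * real DIM('a) / (H + h)\<bar> \<le> (\<integral>s. dom q 0 s \<partial>lborel)"
  proof -
    have mid: "\<bar>- (A + B) / 2 - S\<bar> \<le> L" if "\<bar>A + S\<bar> \<le> L" "\<bar>B + S\<bar> \<le> L" for A B S L :: real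
      using that unfolding abs_le_iff by (auto simp: field_simps)
    show ?thesis
      unfolding c_def by (rule mid) (use assms in \<open>auto intro!: phi_sphere(2)\<close>)
  qed
  then have "(H + h) * \<bar>c H h - \<kappa> * real DIM('a) / (H + h)\<bar> \<le> (H + h) * (\<integral>s. dom q 0 s \<partial>lborel)"
    using assms by (intro mult_left_mono) auto
  moreover have "(H + h) * \<bar>c H h - \<kappa> * real DIM('a) / (H + h)\<bar> = \<bar>(H + h) * (c H h - \<kappa> * real DIM('a) / (H + h))\<bar>"
    using assms by (simp add: abs_mult)
  moreover have "(H + h) * (c H h - \<kappa> * real DIM('a) / (H + h)) = (H + h) * c H h - \<kappa> * real DIM('a)"
    using assms by (simp add: field_simps)
  ultimately show ?thesis by simp
qed

end

lemma tendsto_fst_snd_at_0: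
  "((\<lambda>(H::real, h::real). H) \<longlongrightarrow> 0) (at (0, 0) within S)" "((\<lambda>(H::real, h::real). h) \<longlongrightarrow> 0) (at (0, 0) within S)"
  "((\<lambda>(H::real, h::real). H + h) \<longlongrightarrow> 0) (at (0, 0) within S)"
proof -
  show 1: "((\<lambda>(H::real, h::real). H) \<longlongrightarrow> 0) (at (0, 0) within S)"
    using tendsto_fst[OF tendsto_ident_at[of "(0::real, 0::real)" S]] by (simp add: case_prod_beta')
  show 2: "((\<lambda>(H::real, h::real). h) \<longlongrightarrow> 0) (at (0, 0) within S)"
    using tendsto_snd[OF tendsto_ident_at[of "(0::real, 0::real)" S]] by (simp add: case_prod_beta')
  show "((\<lambda>(H::real, h::real). H + h) \<longlongrightarrow> 0) (at (0, 0) within S)"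
    using tendsto_add[OF 1 2] by (simp add: case_prod_beta')
qed

lemma eventually_at_0_within_square:
  "eventually (\<lambda>(H, h). 0 < H \<and> H < H0 \<and> 0 < h \<and> h < H0) (at (0::real, 0::real) within {0<..<H0} \<times> {0<..<H0})"
  by (auto simp: eventually_at_filter intro!: always_eventually)

context cone_kernel begin

lemma c_asymp:
  assumes "0 < H0" "H0 < 1/2"
  shows "((\<lambda>(H, h). (H + h) * c H h) \<longlongrightarrow> \<kappa> * real DIM('a)) (at (0, 0) within {0<..<H0} \<times> {0<..<H0})"
proof -
  have "((\<lambda>(H, h). (H + h) * c H h - \<kappa> * real DIM('a)) \<longlongrightarrow> 0) (at (0, 0) within {0<..<H0} \<times> {0<..<H0})"
  proof (rule Lim_null_comparison)
    show "((\<lambda>x. (case x of (H, h) \<Rightarrow> H + h) * (\<integral>s. dom (2 * H0) 0 s \<partial>lborel)) \<longlongrightarrow> 0) (at (0, 0) within {0<..<H0} \<times> {0<..<H0})"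
      by (rule tendsto_mult_left_zero[OF tendsto_fst_snd_at_0(3)])
    show "\<forall>\<^sub>F x in at (0, 0) within {0<..<H0} \<times> {0<..<H0}. norm (case x of (H, h) \<Rightarrow> (H + h) * c H h - \<kappa> * real DIM('a))
        \<le> (case x of (H, h) \<Rightarrow> H + h) * (\<integral>s. dom (2 * H0) 0 s \<partial>lborel)"
      using eventually_at_0_within_square[of H0]
      by eventually_elim (use assms in \<open>auto intro!: c_bound\<close>)
  qed
  from tendsto_add[OF this tendsto_const[of "\<kappa> * real DIM('a)"]] show ?thesis
    by (simp add: case_prod_beta')
qed

end

text \<open>For the half-line, \<open>\<phi> H h\<close> is not even if \<open>H \<noteq> h\<close>, so the covariance of the family (a) is not exactly of the
  form \<open>|x| powr p + |y| powr p - |x - y| powr p\<close>; the following is what remains true.\<close>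

locale asymptotically_radial_kernel = cone_kernel K \<kappa> for K :: "'a::euclidean_space set" and \<kappa> +
  assumes asymptotically_radial: "\<And>H0. 0 < H0 \<Longrightarrow> H0 < 1/2 \<Longrightarrow>
    \<exists>\<Delta>. ((\<lambda>(H, h). \<Delta> H h) \<longlongrightarrow> 0) (at (0, 0) within {0<..<H0} \<times> {0<..<H0}) \<and>
      (\<forall>H\<in>{0<..<H0}. \<forall>h\<in>{0<..<H0}. \<forall>z. norm z = 1 \<longrightarrow> \<bar>\<phi> H h z + c H h\<bar> \<le> \<Delta> H h)"

lemma asymptotically_radial_kernel_UNIV:
  "asymptotically_radial_kernel (UNIV :: 'a::euclidean_space set) (unit_ball_vol (real DIM('a)))"
proof -
  interpret cone_kernel "UNIV :: 'a set" "unit_ball_vol (real DIM('a))"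
    by unfold_locales (auto simp: emeasure_ball)
  have zero: "\<phi> H h z + c H h = 0" if "norm z = 1" for H h z
    using phi_radial[OF refl, of z e0 H h] phi_radial[OF refl, of "- e0" e0 H h] that by (simp add: c_def)
  show ?thesis
    by unfold_locales (intro exI[of _ "\<lambda>_ _. 0"], simp add: case_prod_beta' zero)
qed

section \<open>The half-line kernel and its asymmetry\<close>

interpretation half_line: cone_kernel "{0<..} :: real set" 1
proof
  fix s z :: real assume "2 \<le> norm s" "norm z = 1"
  then show "(z + s \<in> {0<..}) = (s \<in> {0<..})" by auto
next
  fix r :: real assume "0 \<le> r"
  have eq: "{0<..} \<inter> ball (0::real) r = {0<..<r}" by (auto simp: ball_def dist_norm)
  show "emeasure lborel ({0<..} \<inter> ball (0::real) r) = ennreal (1 * r ^ DIM(real))"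
    unfolding eq using \<open>0 \<le> r\<close> by simp
qed auto

lemma half_line_v: "half_line.v H s = (max s 0) powr (H - 1/2)"
  by (auto simp: half_line.v_def indicator_def)

text \<open>The function \<open>f\<close> need not be integrable, since it may decay only like 1/s.
  Cutting off at \<open>n\<close> and shifting one of the two integrals leaves the integral of
  \<open>f\<close> over a single unit interval, which tends to 0.\<close>

lemma integral_shift_difference_zero:
  fixes f :: "real \<Rightarrow> real"
  assumes [measurable]: "f \<in> borel_measurable borel"
    and nonneg: "\<And>s. 0 \<le> f s" and neg: "\<And>s. s \<le> 0 \<Longrightarrow> f s = 0"
    and loc: "\<And>n. integrable lborel (\<lambda>s. f s * indicator {..real n} s)"
    and decay: "\<And>s. 1 \<le> s \<Longrightarrow> f s \<le> 1 / s"
    and int: "integrable lborel (\<lambda>s. f s - f (s - 1))"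
  shows "(\<integral>s. f s - f (s - 1) \<partial>lborel) = 0"
proof -
  let ?I = "\<lambda>n. \<integral>s. (f s - f (s - 1)) * indicator {..real n} s \<partial>lborel"
  have "?I \<longlonglongrightarrow> (\<integral>s. f s - f (s - 1) \<partial>lborel)"
  proof (rule integral_dominated_convergence[where w="\<lambda>s. \<bar>f s - f (s - 1)\<bar>"])
    show "AE s in lborel. (\<lambda>n. (f s - f (s - 1)) * indicator {..real n} s) \<longlonglongrightarrow> f s - f (s - 1)"
    proof (rule AE_I2)
      fix s :: real
      obtain N where N: "s \<le> real N" using real_arch_simple by blast
      have "eventually (\<lambda>n. (f s - f (s - 1)) * indicator {..real n} s = f s - f (s - 1)) sequentially"
        using eventually_ge_at_top[of N] by eventually_elim (use N in \<open>auto simp: indicator_def\<close>)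
      then show "(\<lambda>n. (f s - f (s - 1)) * indicator {..real n} s) \<longlonglongrightarrow> f s - f (s - 1)"
        by (rule tendsto_eventually)
    qed
  qed (use int in \<open>auto simp: indicator_def\<close>)
  moreover have "?I \<longlonglongrightarrow> 0"
  proof (rule tendsto_sandwich)
    have eq: "?I (Suc n) = (\<integral>s. f s * indicator {real n<..real (Suc n)} s \<partial>lborel)" for n
    proof -
      have m: "(\<lambda>s. f s * indicator {..real n} s) \<in> borel_measurable borel" by measurable
      have sh: "integrable lborel (\<lambda>s. f (s - 1) * indicator {..real (Suc n)} s)"
        "(\<integral>s. f (s - 1) * indicator {..real (Suc n)} s \<partial>lborel) = (\<integral>s. f s * indicator {..real n} s \<partial>lborel)"
      proof -
        have "(\<lambda>s. f (s - 1) * indicator {..real (Suc n)} s) = (\<lambda>s. f (- 1 + s) * indicator {..real n} (- 1 + s))"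
          by (auto simp: fun_eq_iff indicator_def)
        then show "integrable lborel (\<lambda>s. f (s - 1) * indicator {..real (Suc n)} s)"
          "(\<integral>s. f (s - 1) * indicator {..real (Suc n)} s \<partial>lborel) = (\<integral>s. f s * indicator {..real n} s \<partial>lborel)"
          using lborel_translate[OF m, of "-1"] loc[of n] by simp_all
      qed
      have "?I (Suc n) = (\<integral>s. f s * indicator {..real (Suc n)} s \<partial>lborel) - (\<integral>s. f s * indicator {..real n} s \<partial>lborel)"
        using Bochner_Integration.integral_diff[OF loc[of "Suc n"] sh(1)] sh(2) by (simp add: left_diff_distrib)
      also have "\<dots> = (\<integral>s. f s * indicator {..real (Suc n)} s - f s * indicator {..real n} s \<partial>lborel)"
        using Bochner_Integration.integral_diff[OF loc[of "Suc n"] loc[of n]] by simp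
      also have "\<dots> = (\<integral>s. f s * indicator {real n<..real (Suc n)} s \<partial>lborel)"
        by (intro Bochner_Integration.integral_cong) (auto simp: indicator_def)
      finally show ?thesis .
    qed
    show "\<forall>\<^sub>F n in sequentially. 0 \<le> ?I n"
    proof (rule eventually_sequentiallyI[of 1])
      fix n :: nat assume "1 \<le> n"
      then obtain m where "n = Suc m" by (cases n) auto
      then show "0 \<le> ?I n" using nonneg by (simp only: eq) (auto intro!: Bochner_Integration.integral_nonneg)
    qed
    show "\<forall>\<^sub>F n in sequentially. ?I n \<le> 1 / real (n - 1)"
    proof (rule eventually_sequentiallyI[of 2])
      fix n :: nat assume "2 \<le> n"
      then obtain m where m: "n = Suc m" "1 \<le> m" by (cases n) auto
      have "?I (Suc m) \<le> (\<integral>s. (1 / real m) * indicator {real m<..real (Suc m)} s \<partial>lborel)"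
        unfolding eq
      proof (rule integral_mono')
        show "f s * indicator {real m<..real (Suc m)} s \<le> (1 / real m) * indicator {real m<..real (Suc m)} s" for s
        proof (cases "real m < s \<and> s \<le> real (Suc m)")
          case True
          then have "f s \<le> 1 / s" using decay[of s] m by auto
          also have "\<dots> \<le> 1 / real m" using True m by (intro divide_left_mono) auto
          finally show ?thesis using True by simp
        qed auto
      qed (auto)
      then show "?I n \<le> 1 / real (n - 1)" using m by simp
    qed
    show "(\<lambda>n. 1 / real (n - 1)) \<longlonglongrightarrow> 0" by (rule LIMSEQ_offset[of _ 1]) (simp add: lim_1_over_n)
  qed simp
  ultimately show ?thesis by (rule LIMSEQ_unique)
qed

text \<open>The majorants of \<open>phi_integrand_dom\<close> do not depend on the sequence of
  parameters, so the limit may be taken under the integral even though each of the two values of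
  \<open>\<phi>\<close> diverges. At \<open>H = h = 0\<close> the difference of the integrands is
  f(s) - f(s - 1), where \<open>f\<close> is the product of \<open>half_line.v 0\<close> at
  \<open>1 + s\<close> and at \<open>s\<close>.\<close>

lemma half_line_asymmetry_limit:
  assumes "0 < H0" "H0 < 1/2"
  shows "((\<lambda>(H, h). half_line.\<phi> H h 1 - half_line.\<phi> H h (- 1)) \<longlongrightarrow> 0) (at (0, 0) within {0<..<H0} \<times> {0<..<H0})"
  unfolding tendsto_at_iff_sequentially
proof (intro allI impI)
  fix X :: "nat \<Rightarrow> real \<times> real"
  assume X: "\<forall>i. X i \<in> {0<..<H0} \<times> {0<..<H0} - {(0, 0)}" and lim: "X \<longlonglongrightarrow> (0, 0)"
  let ?w = "\<lambda>s. half_line.dom (2 * H0) 1 s + half_line.dom (2 * H0) (- 1) s"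
  let ?g = "\<lambda>H h s. half_line.phi_integrand H h 1 s - half_line.phi_integrand H h (- 1) s"
  have bd: "fst (X n) > 0" "fst (X n) < H0" "snd (X n) > 0" "snd (X n) < H0" for n
    using X by (auto simp: mem_Times_iff)
  have w: "integrable lborel ?w"
    using assms by (intro Bochner_Integration.integrable_add half_line.integrable_dom) auto
  have v: "(\<lambda>n. half_line.v (Y n) s) \<longlonglongrightarrow> half_line.v 0 s" if "Y \<longlonglongrightarrow> 0" for Y s
  proof (cases "s = 0")
    case False
    then show ?thesis unfolding half_line.v_def
      by (intro tendsto_mult tendsto_powr tendsto_diff tendsto_const that) auto
  qed (simp add: half_line.v_def)
  have ptw: "AE s in lborel. (\<lambda>n. ?g (fst (X n)) (snd (X n)) s) \<longlonglongrightarrow> ?g 0 0 s"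
    unfolding half_line.phi_integrand_def
    using tendsto_fst[OF lim] tendsto_snd[OF lim]
    by (intro AE_I2 tendsto_diff tendsto_mult v) simp_all
  have bound: "AE s in lborel. norm (?g (fst (X n)) (snd (X n)) s) \<le> ?w s" for n
  proof (rule AE_I2)
    fix s
    show "norm (?g (fst (X n)) (snd (X n)) s) \<le> ?w s"
    proof -
      \<comment> \<open>\<open>G\<close> stands for the singular part at the origin; it is the same
        for the points 1 and -1 and disappears from the difference.\<close>
      have tri: "norm (A - B) \<le> D + E" if "\<bar>A + G\<bar> \<le> D" "\<bar>B + G\<bar> \<le> E" for A B D E G :: real
        using that by (simp add: abs_le_iff)
      show ?thesis
        by (rule tri; rule half_line.phi_integrand_dom) (use bd[of n] assms in auto)
    qed
  qed
  have conv: "(\<lambda>n. \<integral>s. ?g (fst (X n)) (snd (X n)) s \<partial>lborel) \<longlonglongrightarrow> (\<integral>s. ?g 0 0 s \<partial>lborel)"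
    and int0: "integrable lborel (?g 0 0)"
  proof -
    show "(\<lambda>n. \<integral>s. ?g (fst (X n)) (snd (X n)) s \<partial>lborel) \<longlonglongrightarrow> (\<integral>s. ?g 0 0 s \<partial>lborel)"
      by (rule integral_dominated_convergence[where w="?w"]) (use w ptw bound in simp_all)
    show "integrable lborel (?g 0 0)"
      by (rule integrable_dominated_convergence[where w="?w" and s="\<lambda>n. ?g (fst (X n)) (snd (X n))"]) (use w ptw bound in simp_all)
  qed
  define f where "f s = half_line.v 0 (1 + s) * half_line.v 0 s" for s
  have g0: "?g 0 0 s = f s - f (s - 1)" for s
    by (simp add: half_line.phi_integrand_def f_def algebra_simps)
  have fm [measurable]: "f \<in> borel_measurable borel" unfolding f_def[abs_def] by measurable
  \<comment> \<open>Near 0 only the factor at \<open>s\<close> is singular, which gives local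
    integrability; the decay like 1/s at infinity is shown separately below.\<close>
  have f_le: "f s \<le> norm s powr (- 1/2)" for s
  proof (cases "0 < s")
    case True
    have "(1 + s) powr (- (1/2)) \<le> 1 powr (- (1/2))" using True by (intro powr_mono2') auto
    then have "(1 + s) powr (- (1/2)) * s powr (- (1/2)) \<le> 1 * s powr (- (1/2))"
      by (intro mult_right_mono) auto
    then show ?thesis using True by (simp add: f_def half_line.v_def)
  qed (simp add: f_def half_line.v_def)
  have "(\<integral>s. f s - f (s - 1) \<partial>lborel) = 0"
  proof (rule integral_shift_difference_zero)
    show "0 \<le> f s" for s by (simp add: f_def)
    show "f s = 0" if "s \<le> 0" for s using that by (simp add: f_def half_line.v_def)
    show "integrable lborel (\<lambda>s. f s - f (s - 1))" using int0 by (simp add: g0)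
    show "integrable lborel (\<lambda>s. f s * indicator {..real n} s)" for n
    proof (rule Bochner_Integration.integrable_bound)
      show "integrable lborel (\<lambda>s::real. norm s powr (- 1/2) * indicator (ball 0 (real n + 1)) s)"
        by (rule integrable_norm_powr_ball) auto
      show "AE s in lborel. norm (f s * indicator {..real n} s) \<le> norm (norm s powr (- 1/2) * indicator (ball 0 (real n + 1)) s)"
        using f_le by (intro AE_I2) (auto simp: indicator_def f_def half_line.v_def)
    qed measurable
    show "f s \<le> 1 / s" if "1 \<le> s" for s
    proof -
      have "f s = (1 + s) powr (- (1/2)) * s powr (- (1/2))"
        using that by (simp add: f_def half_line.v_def)
      also have "\<dots> \<le> s powr (- (1/2)) * s powr (- (1/2))"
        using that by (intro mult_right_mono powr_mono2') auto
      also have "\<dots> = 1 / s" using that by (simp flip: powr_add add: powr_minus_divide)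
      finally show ?thesis .
    qed
  qed measurable
  then have lim0: "(\<integral>s. ?g 0 0 s \<partial>lborel) = 0" by (simp add: g0)
  have "(\<integral>s. ?g (fst (X n)) (snd (X n)) s \<partial>lborel) = half_line.\<phi> (fst (X n)) (snd (X n)) 1 - half_line.\<phi> (fst (X n)) (snd (X n)) (- 1)" for n
    unfolding half_line.\<phi>_def using bd[of n] assms
    by (intro Bochner_Integration.integral_diff half_line.phi_integrable) auto
  with conv lim0 show "((\<lambda>(H, h). half_line.\<phi> H h 1 - half_line.\<phi> H h (- 1)) \<circ> X) \<longlonglongrightarrow> 0"
    by (simp add: o_def case_prod_beta')
qed

interpretation half_line: asymptotically_radial_kernel "{0<..} :: real set" 1
proof
  fix H0 :: real assume H0: "0 < H0" "H0 < 1/2"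
  let ?\<Delta> = "\<lambda>H h. \<bar>half_line.\<phi> H h 1 - half_line.\<phi> H h (- 1)\<bar>"
  have e: "half_line.e0 = 1" by (simp add: half_line.e0_def)
  have "((\<lambda>(H, h). ?\<Delta> H h) \<longlongrightarrow> 0) (at (0, 0) within {0<..<H0} \<times> {0<..<H0})"
    using tendsto_rabs_zero[OF half_line_asymmetry_limit[OF H0]] by (simp add: case_prod_beta')
  moreover have "\<bar>half_line.\<phi> H h z + half_line.c H h\<bar> \<le> ?\<Delta> H h" if "norm z = 1" for H h z
  proof -
    have "z = 1 \<or> z = - 1" using that by (simp add: abs_if split: if_splits)
    moreover have "\<bar>A + - (A + B) / 2\<bar> \<le> \<bar>A - B\<bar>" "\<bar>B + - (A + B) / 2\<bar> \<le> \<bar>A - B\<bar>" for A B :: real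
      by (auto simp: abs_if field_simps)
    ultimately show ?thesis unfolding half_line.c_def e by blast
  qed
  ultimately show "\<exists>\<Delta>. ((\<lambda>(H, h). \<Delta> H h) \<longlongrightarrow> 0) (at (0, 0) within {0<..<H0} \<times> {0<..<H0}) \<and>
      (\<forall>H\<in>{0<..<H0}. \<forall>h\<in>{0<..<H0}. \<forall>z. norm z = 1 \<longrightarrow> \<bar>half_line.\<phi> H h z + half_line.c H h\<bar> \<le> \<Delta> H h)"
    by blast
qed

section \<open>Fractional Brownian fields\<close>

text \<open>The families differ in the noise, the set \<open>K\<close> and the constant
  \<open>k\<close>. The value in \<open>k_limit\<close> matches \<open>c_asymp\<close>: the
  covariance contains two factors \<open>k\<close> and one factor \<open>c\<close>, and two limits
  \<open>1 / sqrt (\<kappa> * DIM('a))\<close> compensate the limit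
  \<open>\<kappa> * DIM('a)\<close> of \<open>(H + h) * c H h\<close>.\<close>

locale fbm_family = isonormal_noise M I S Z + asymptotically_radial_kernel K \<kappa>
  for M :: "'w measure" and I :: "'i set" and S :: "'i \<Rightarrow> 'a::euclidean_space set" and Z :: "'i \<Rightarrow> 'w \<Rightarrow> real"
    and K :: "'a set" and \<kappa> +
  fixes H0 :: real and k :: "real \<Rightarrow> real" and B :: "real \<Rightarrow> 'a \<Rightarrow> 'w \<Rightarrow> real"
  assumes H0: "0 < H0" "H0 < 1/2"
    and representation: "H \<in> {0<..<H0} \<Longrightarrow>
      \<exists>Y. wiener_integral M I S Z (fbm_kernel H x) Y \<and> (\<forall>\<omega>\<in>space M. B H x \<omega> = k H * Y \<omega>)"
    and continuous_paths: "H \<in> {0<..<H0} \<Longrightarrow> \<omega> \<in> space M \<Longrightarrow> continuous_on UNIV (\<lambda>x. B H x \<omega>)"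
    and k_pos: "H \<in> {0<..<H0} \<Longrightarrow> 0 < k H"
    and k_limit: "((\<lambda>H. Gamma H powr (1/2) * k H) \<longlongrightarrow> 1 / sqrt (\<kappa> * real DIM('a))) (at_right 0)"
begin

lemma wiener_B:
  assumes "H \<in> {0<..<H0}"
  shows "W (\<lambda>s. k H * fbm_kernel H x s) (B H x)"
proof -
  obtain Y where Y: "W (fbm_kernel H x) Y" "\<And>\<omega>. \<omega> \<in> space M \<Longrightarrow> B H x \<omega> = k H * Y \<omega>"
    using representation[OF assms] by blast
  have kY: "W (\<lambda>s. k H * fbm_kernel H x s) (\<lambda>\<omega>. k H * Y \<omega>)"
    using wiener_integral_combination[OF Y(1) Y(1), of "k H" 0] by simp
  have meas: "B H x \<in> borel_measurable M \<longleftrightarrow> (\<lambda>\<omega>. k H * Y \<omega>) \<in> borel_measurable M"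
    by (rule measurable_cong) (rule Y(2))
  have int: "(\<integral>\<^sup>+ \<omega>. ennreal ((B H x \<omega> - F \<omega>)\<^sup>2) \<partial>M) = (\<integral>\<^sup>+ \<omega>. ennreal ((k H * Y \<omega> - F \<omega>)\<^sup>2) \<partial>M)" for F
    by (rule nn_integral_cong) (simp add: Y(2))
  show ?thesis using kY unfolding wiener_integral_def meas int .
qed

lemma B_measurable [measurable]: "H \<in> {0<..<H0} \<Longrightarrow> B H x \<in> borel_measurable M"
  by (rule wiener_integral(2)[OF wiener_B])

text \<open>The terms of \<open>fbm_kernel_product\<close> that depend on one point only cancel in
  the second difference.\<close>

lemma increment_covariance:
  assumes H: "H \<in> {0<..<H0}" and h: "h \<in> {0<..<H0}"
  shows "expectation (\<lambda>\<omega>. (B H x \<omega> - B H u \<omega>) * (B h y \<omega> - B h w \<omega>)) =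
      k H * k h * (\<phi> H h (x - y) - \<phi> H h (x - w) - \<phi> H h (u - y) + \<phi> H h (u - w))"
proof -
  let ?f = fbm_kernel
  have inc: "W (\<lambda>s. 1 * (k H * ?f H x s) + (- 1) * (k H * ?f H u s)) (\<lambda>\<omega>. 1 * B H x \<omega> + (- 1) * B H u \<omega>)"
    if "H \<in> {0<..<H0}" for H x u
    by (intro wiener_integral_combination wiener_B that)
  note P = fbm_kernel_product[of H h]
  have int: "integrable lborel (\<lambda>s. ?f H x s * ?f h y s)" for x y
    using P(1) H h H0 by auto
  have "expectation (\<lambda>\<omega>. (B H x \<omega> - B H u \<omega>) * (B h y \<omega> - B h w \<omega>)) =
      (\<integral>s. (k H * ?f H x s - k H * ?f H u s) * (k h * ?f h y s - k h * ?f h w s) \<partial>lborel)"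
    using wiener_integral_covariance(3)[OF inc[OF H, of x u] inc[OF h, of y w]] by simp
  also have "\<dots> = (\<integral>s. k H * k h * (?f H x s * ?f h y s - ?f H x s * ?f h w s - (?f H u s * ?f h y s - ?f H u s * ?f h w s)) \<partial>lborel)"
    by (intro Bochner_Integration.integral_cong) (simp_all add: algebra_simps)
  also have "\<dots> = k H * k h * ((\<integral>s. ?f H x s * ?f h y s \<partial>lborel) - (\<integral>s. ?f H x s * ?f h w s \<partial>lborel)
      - ((\<integral>s. ?f H u s * ?f h y s \<partial>lborel) - (\<integral>s. ?f H u s * ?f h w s \<partial>lborel)))"
    by (simp add: int)
  also have "\<dots> = k H * k h * (\<phi> H h (x - y) - \<phi> H h (x - w) - \<phi> H h (u - y) + \<phi> H h (u - w))"
    using H h H0 by (simp add: P(2) algebra_simps)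
  finally show ?thesis .
qed

text \<open>A bound for \<open>\<phi>\<close> on the unit sphere: the size of the singular part plus
  the remainder of \<open>phi_sphere\<close>. It blows up as \<open>H + h\<close> tends to 0 and is
  used at fixed parameters, to have finite second moments.\<close>

definition \<Phi> :: "real \<Rightarrow> real \<Rightarrow> real" where
  "\<Phi> H h = \<kappa> * real DIM('a) / (H + h) + (\<integral>s. dom (2 * H0) 0 s \<partial>lborel)"

lemma phi_bound:
  assumes "H \<in> {0<..<H0}" "h \<in> {0<..<H0}"
  shows "\<bar>\<phi> H h z\<bar> \<le> \<Phi> H h * norm z powr (H + h)"
proof (cases "z = 0")
  case False
  let ?z = "z /\<^sub>R norm z"
  have "\<bar>\<phi> H h ?z + \<kappa> * real DIM('a) / (H + h)\<bar> \<le> (\<integral>s. dom (2 * H0) 0 s \<partial>lborel)"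
    by (rule phi_sphere(2)) (use assms H0 False in auto)
  moreover have "0 \<le> \<kappa> * real DIM('a) / (H + h)" using assms \<kappa>_pos by auto
  ultimately have "\<bar>\<phi> H h ?z\<bar> \<le> \<Phi> H h" unfolding \<Phi>_def by linarith
  then show ?thesis
    using phi_homogeneous[OF False, of H h] by (simp add: abs_mult mult.commute[of "\<Phi> H h"] mult_left_mono)
qed simp

lemma \<Phi>_nonneg: "H \<in> {0<..<H0} \<Longrightarrow> h \<in> {0<..<H0} \<Longrightarrow> 0 \<le> \<Phi> H h"
  using phi_bound[of H h e0] by (auto intro: order_trans[of _ "\<bar>\<phi> H h e0\<bar>"])

lemma increment_second_moment:
  assumes H: "H \<in> {0<..<H0}"
  shows "(\<integral>\<^sup>+ \<omega>. ennreal ((B H x \<omega> - B H u \<omega>)\<^sup>2) \<partial>M) \<le> ennreal (2 * (k H)\<^sup>2 * \<Phi> H H * norm (x - u) powr (2 * H))"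
proof -
  have "integrable M (\<lambda>\<omega>. (B H x \<omega> - B H u \<omega>)\<^sup>2)"
    by (rule integrable_square_add(2)) (use wiener_integral(2,4)[OF wiener_B[OF H]] in auto)
  then have "(\<integral>\<^sup>+ \<omega>. ennreal ((B H x \<omega> - B H u \<omega>)\<^sup>2) \<partial>M) = ennreal (expectation (\<lambda>\<omega>. (B H x \<omega> - B H u \<omega>)\<^sup>2))"
    by (rule nn_integral_eq_integral) simp
  also have "expectation (\<lambda>\<omega>. (B H x \<omega> - B H u \<omega>)\<^sup>2) = (k H)\<^sup>2 * (- \<phi> H H (x - u) - \<phi> H H (u - x))"
    using increment_covariance[OF H H, of x u x u] by (simp add: power2_eq_square)
  also have "\<dots> \<le> (k H)\<^sup>2 * (2 * (\<Phi> H H * norm (x - u) powr (2 * H)))"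
    using phi_bound[OF H H, of "x - u"] phi_bound[OF H H, of "u - x"]
    by (intro mult_left_mono) (simp_all add: norm_minus_commute[of u x] abs_le_iff)
  finally show ?thesis by (simp add: mult_ac ennreal_leI)
qed

text \<open>Simple functions that converge pointwise to the identity. They yield joint measurability
  of \<open>B\<close> and replace averages of \<open>B\<close> by finite sums, which are Wiener
  integrals; the norm bound supplies the majorant for dominated convergence.\<close>

definition rounding :: "nat \<Rightarrow> 'a \<Rightarrow> 'a" where
  "rounding = (SOME F. (\<forall>i. simple_function borel (F i)) \<and> (\<forall>x. (\<lambda>i. F i x) \<longlonglongrightarrow> x) \<and> (\<forall>i x. norm (F i x) \<le> 2 * norm x))"

lemma rounding:
  "simple_function borel (rounding n)" "(\<lambda>n. rounding n x) \<longlonglongrightarrow> x" "norm (rounding n x) \<le> 2 * norm x"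
proof -
  have "\<exists>F. (\<forall>i. simple_function borel (F i)) \<and> (\<forall>x::'a. (\<lambda>i. F i x) \<longlonglongrightarrow> x) \<and> (\<forall>i x. norm (F i x) \<le> 2 * norm x)"
    using borel_measurable_implies_sequence_metric[of "\<lambda>x::'a. x" borel 0] by simp
  from someI_ex[OF this] show "simple_function borel (rounding n)" "(\<lambda>n. rounding n x) \<longlonglongrightarrow> x" "norm (rounding n x) \<le> 2 * norm x"
    unfolding rounding_def[symmetric] by auto
qed

lemma rounding_range: "finite (range (rounding n))"
  using rounding(1)[of n] by (simp add: simple_function_def)

lemma rounding_sum: "F (rounding n u) = (\<Sum>w\<in>range (rounding n). F w * indicator (rounding n -` {w}) u)" for F :: "'a \<Rightarrow> real"
proof -
  have "(\<Sum>w\<in>range (rounding n). F w * indicator (rounding n -` {w}) u) = (\<Sum>w\<in>range (rounding n). if w = rounding n u then F w else 0)"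
    by (intro sum.cong) (auto simp: indicator_def)
  then show ?thesis using rounding_range[of n] by simp
qed

lemma rounding_vimage [measurable]: "rounding n -` {w} \<in> sets borel"
  using simple_functionD(2)[OF rounding(1)[of n], of "{w}"] by simp

lemma rounding_measurable [measurable]: "rounding n \<in> borel_measurable borel"
  using rounding(1) by (rule borel_measurable_simple_function)

lemma B_rounding_measurable:
  assumes H [measurable]: "H \<in> {0<..<H0}"
  shows "(\<lambda>(\<omega>, u). B H (rounding n u) \<omega>) \<in> borel_measurable (M \<Otimes>\<^sub>M borel)"
  unfolding rounding_sum[of "\<lambda>u. B H u _"] by measurable

text \<open>By continuity of the paths \<open>B\<close> is the pointwise limit of its compositions
  with \<open>rounding\<close>, each of which is a finite sum of measurable products.\<close>

lemma B_jointly_measurable: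
  assumes H: "H \<in> {0<..<H0}"
  shows "(\<lambda>(\<omega>, u). B H u \<omega>) \<in> borel_measurable (M \<Otimes>\<^sub>M borel)"
proof (rule borel_measurable_LIMSEQ_metric)
  show "(\<lambda>(\<omega>, u). B H (rounding n u) \<omega>) \<in> borel_measurable (M \<Otimes>\<^sub>M borel)" for n
    by (rule B_rounding_measurable[OF H])
  fix z assume "z \<in> space (M \<Otimes>\<^sub>M (borel :: 'a measure))"
  then obtain \<omega> u where z: "z = (\<omega>, u)" "\<omega> \<in> space M" by (auto simp: space_pair_measure)
  have "isCont (\<lambda>x. B H x \<omega>) u"
    using continuous_paths[OF H z(2)] by (simp add: continuous_on_eq_continuous_at)
  then show "(\<lambda>n. case z of (\<omega>, u) \<Rightarrow> B H (rounding n u) \<omega>) \<longlonglongrightarrow> (case z of (\<omega>, u) \<Rightarrow> B H u \<omega>)"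
    using isCont_tendsto_compose[OF _ rounding(2)[of u]] by (simp add: z(1))
qed

end

section \<open>Logarithmic moments\<close>

lemma norm_diff_powr_le:
  fixes x y :: "'a::real_normed_vector"
  assumes "0 < q" "q < 1"
  shows "norm (x - y) powr q \<le> 2 * norm x powr q + 2 * norm y powr q"
proof -
  let ?m = "max (norm x) (norm y)"
  have "norm (x - y) \<le> 2 * ?m" using norm_triangle_ineq4[of x y] by simp
  then have "norm (x - y) powr q \<le> (2 * ?m) powr q" using assms by (intro powr_mono2) auto
  also have "\<dots> = 2 powr q * ?m powr q" by (simp add: powr_mult)
  also have "\<dots> \<le> 2 * ?m powr q"
    using assms powr_mono[of q 1 2] by (intro mult_right_mono) auto
  also have "?m powr q \<le> norm x powr q + norm y powr q" by (cases "norm x \<le> norm y") (auto simp: max_def)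
  finally show ?thesis by simp
qed

lemma powr_le_one_plus:
  fixes r :: real
  assumes "0 \<le> r" "0 < p" "p \<le> q"
  shows "r powr p \<le> 1 + r powr q"
proof (cases "r \<le> 1")
  case True
  then have "r powr p \<le> 1 powr p" using assms by (intro powr_mono2) auto
  then show ?thesis by (simp add: add_increasing2)
next
  case False
  then have "r powr p \<le> r powr q" using assms by (intro powr_mono) auto
  then show ?thesis by simp
qed

text \<open>A second order Taylor bound, derived on both sides of 0 from
  \<open>1 - t \<le> exp (- t)\<close>.\<close>

lemma abs_exp_minus_affine_le:
  fixes t :: real
  shows "\<bar>exp t - 1 - t\<bar> \<le> t\<^sup>2 * max 1 (exp t)"
proof -
  have lower: "0 \<le> exp t - 1 - t" using exp_ge_add_one_self[of t] by linarith
  show ?thesis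
  proof (cases "0 \<le> t")
    case True
    have "1 - t \<le> exp (- t)" using exp_ge_add_one_self[of "- t"] by simp
    then have "exp t * (1 - t) \<le> exp t * exp (- t)" by (intro mult_left_mono) auto
    then have "exp t - 1 \<le> t * exp t" by (simp add: exp_minus algebra_simps)
    then have "t * (exp t - 1) \<le> t * (t * exp t)" using True by (intro mult_left_mono) auto
    moreover have "exp t - 1 - t \<le> t * (exp t - 1)"
      using \<open>exp t - 1 \<le> t * exp t\<close> by (simp add: algebra_simps)
    ultimately show ?thesis using lower True by (simp add: power2_eq_square max_def)
  next
    case False
    have "exp t * (1 - t) \<le> exp t * exp (- t)" using exp_ge_add_one_self[of "- t"] by (intro mult_left_mono) auto
    then have "exp t * (1 - t) \<le> 1" by (simp add: exp_minus)
    then have "exp t \<le> 1 / (1 - t)" using False by (simp add: field_simps)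
    \<comment> \<open>The product of \<open>1 + t + t * t\<close> and \<open>1 - t\<close> is 1
      minus the cube of \<open>t\<close>, at least 1 for negative \<open>t\<close>.\<close>
    also have "1 / (1 - t) \<le> 1 + t + t\<^sup>2"
    proof -
      have "1 \<le> (1 + t + t\<^sup>2) * (1 - t)"
        using False by (simp add: power2_eq_square algebra_simps mult_nonneg_nonpos2 mult_nonneg_nonpos)
      then show ?thesis using False by (simp add: field_simps)
    qed
    finally show ?thesis using lower False by (simp add: max_def)
  qed
qed

text \<open>With \<open>t = p * ln r\<close> the left-hand side is the Taylor remainder divided by
  \<open>p\<close>, of order \<open>p\<close> times the squared logarithm. For
  \<open>r \<le> 1\<close> this square is controlled by \<open>ln_minus\<close>, for large
  \<open>r\<close> by a power. With \<open>q = H0\<close> the last factor contains just the two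
  quantities that the kernel conditions bound.\<close>

lemma powr_quotient_minus_ln_le:
  fixes r :: real
  assumes "0 < r" "0 < p" "p \<le> q"
  shows "\<bar>(r powr p - 1) / p - ln r\<bar> \<le> p * (1 + 4 / q\<^sup>2) * ((ln_minus r)\<^sup>2 + r powr (2 * q))"
proof -
  let ?t = "p * ln r"
  have "(r powr p - 1) / p - ln r = (exp ?t - 1 - ?t) / p"
    using assms by (simp add: powr_def field_simps)
  then have "\<bar>(r powr p - 1) / p - ln r\<bar> = \<bar>exp ?t - 1 - ?t\<bar> / p" using assms by simp
  also have "\<dots> \<le> ?t\<^sup>2 * max 1 (exp ?t) / p"
    using assms by (intro divide_right_mono abs_exp_minus_affine_le) auto
  also have "\<dots> = p * ((ln r)\<^sup>2 * max 1 (exp ?t))" using assms by (simp add: power2_eq_square)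
  also have "\<dots> \<le> p * ((1 + 4 / q\<^sup>2) * ((ln_minus r)\<^sup>2 + r powr (2 * q)))"
  proof (intro mult_left_mono)
    show "(ln r)\<^sup>2 * max 1 (exp ?t) \<le> (1 + 4 / q\<^sup>2) * ((ln_minus r)\<^sup>2 + r powr (2 * q))"
    proof (cases "r \<le> 1")
      case True
      then have "ln r \<le> 0" using assms by simp
      moreover from this have "?t \<le> 0" using assms by (simp add: mult_nonneg_nonpos)
      ultimately have m: "ln_minus r = ln r" "max 1 (exp ?t) = 1"
        by (simp_all add: ln_minus_def max.absorb1)
      have "(ln r)\<^sup>2 * 1 \<le> ((ln r)\<^sup>2 + r powr (2 * q)) * (1 + 4 / q\<^sup>2)"
        by (intro mult_mono) auto
      then show ?thesis unfolding m by (simp only: mult.commute)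
    next
      case False
      then have ln: "0 \<le> ln r" by simp
      \<comment> \<open>The exponent \<open>q / 2\<close> makes the square of the logarithm cost
        \<open>r powr q\<close>, which together with \<open>r powr p \<le> r powr q\<close> gives
        \<open>r powr (2 * q)\<close>.\<close>
      have "ln r = (2 / q) * ln (r powr (q / 2))" using assms by (simp add: ln_powr)
      also have "\<dots> \<le> (2 / q) * r powr (q / 2)"
        using assms by (intro mult_left_mono less_imp_le[OF ln_less_self]) auto
      finally have "(ln r)\<^sup>2 \<le> ((2 / q) * r powr (q / 2))\<^sup>2" using ln by (intro power_mono) auto
      also have "\<dots> = 4 / q\<^sup>2 * r powr q"
        by (simp add: power_mult_distrib power_divide power2_eq_square powr_add[symmetric])
      finally have l2: "(ln r)\<^sup>2 \<le> 4 / q\<^sup>2 * r powr q" .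
      have "max 1 (exp ?t) = r powr p" using False assms ln by (auto simp: powr_def max_def)
      also have "\<dots> \<le> r powr q" using False assms by (intro powr_mono) auto
      finally have "(ln r)\<^sup>2 * max 1 (exp ?t) \<le> (4 / q\<^sup>2 * r powr q) * r powr q"
        using l2 by (intro mult_mono) auto
      also have "\<dots> = 4 / q\<^sup>2 * r powr (2 * q)" by (simp add: powr_add[symmetric])
      also have "\<dots> \<le> (1 + 4 / q\<^sup>2) * ((ln_minus r)\<^sup>2 + r powr (2 * q))"
        by (intro mult_mono) auto
      finally show ?thesis .
    qed
  qed (use assms in auto)
  finally show ?thesis by (simp only: mult.assoc)
qed

lemma abs_ln_le:
  fixes r :: real
  assumes "0 < r" "0 < q"
  shows "\<bar>ln r\<bar> \<le> 1 + (1 + 1 / q) * ((ln_minus r)\<^sup>2 + r powr (2 * q))"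
proof (cases "r \<le> 1")
  case True
  then have l: "ln_minus r = ln r" using assms by (simp add: ln_minus_def)
  have "\<bar>ln r\<bar> \<le> 1 + (ln r)\<^sup>2" using sum_squares_bound[of 1 "\<bar>ln r\<bar>"] by (simp add: power2_abs) 
  also have "1 + (ln r)\<^sup>2 \<le> 1 + (1 + 1 / q) * ((ln r)\<^sup>2 + r powr (2 * q))"
    using mult_mono[of 1 "1 + 1 / q" "(ln r)\<^sup>2" "(ln r)\<^sup>2 + r powr (2 * q)"] assms by simp
  finally show ?thesis unfolding l .
next
  case False
  have "ln r = ln (r powr (2 * q)) / (2 * q)" using assms by (simp add: ln_powr)
  also have "\<dots> \<le> r powr (2 * q) / (2 * q)"
    using assms by (intro divide_right_mono less_imp_le[OF ln_less_self]) auto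
  also have "\<dots> \<le> r powr (2 * q) / q" using assms by (intro divide_left_mono) auto
  also have "\<dots> = (1 / q) * r powr (2 * q)" by simp
  also have "\<dots> \<le> (1 + 1 / q) * ((ln_minus r)\<^sup>2 + r powr (2 * q))"
    using assms by (intro mult_mono) auto
  finally show ?thesis using False by simp
qed

text \<open>Every bound depends on \<open>r\<close> and on the probability measure only through
  \<open>A\<close>. It is applied to distances between points under products of kernel measures,
  where one \<open>A\<close> serves all points of \<open>D\<close>.\<close>

lemma (in prob_space) log_moment_estimates:
  fixes r :: "'a \<Rightarrow> real"
  assumes [measurable]: "r \<in> borel_measurable M" and nonneg: "\<And>z. 0 \<le> r z" and pos: "AE z in M. 0 < r z"
    and A: "(\<integral>\<^sup>+ z. ennreal ((ln_minus (r z))\<^sup>2 + r z powr (2 * q)) \<partial>M) \<le> ennreal A" and "0 \<le> A" "0 < q"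
  shows "integrable M (\<lambda>z. ln (r z))" "\<bar>\<integral>z. ln (r z) \<partial>M\<bar> \<le> 1 + (1 + 1 / q) * A"
    and "\<And>p. 0 < p \<Longrightarrow> p \<le> 2 * q \<Longrightarrow> integrable M (\<lambda>z. r z powr p)"
    and "\<And>p. 0 < p \<Longrightarrow> p \<le> 2 * q \<Longrightarrow> (\<integral>z. r z powr p \<partial>M) \<le> 1 + A"
    and "\<And>p. 0 < p \<Longrightarrow> p \<le> q \<Longrightarrow> \<bar>((\<integral>z. r z powr p \<partial>M) - 1) / p - (\<integral>z. ln (r z) \<partial>M)\<bar> \<le> p * (1 + 4 / q\<^sup>2) * A"
proof -
  let ?E = "\<lambda>z. (ln_minus (r z))\<^sup>2 + r z powr (2 * q)"
  have lnm [measurable]: "ln_minus \<in> borel_measurable borel" unfolding ln_minus_def[abs_def] by measurable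
  have Ei: "integrable M ?E"
    by (rule integrableI_nonneg) (use A in \<open>auto intro: le_less_trans\<close>)
  have "ennreal (\<integral>z. ?E z \<partial>M) \<le> ennreal A"
    using A by (subst (asm) nn_integral_eq_integral[OF Ei]) auto
  then have EA: "(\<integral>z. ?E z \<partial>M) \<le> A" using \<open>0 \<le> A\<close> by simp
  let ?b = "\<lambda>z. 1 + (1 + 1 / q) * ?E z"
  have bi: "integrable M ?b" by (rule Bochner_Integration.integrable_add[OF integrable_const integrable_mult_right[OF Ei]])
  have be: "AE z in M. \<bar>ln (r z)\<bar> \<le> ?b z"
    using pos by eventually_elim (rule abs_ln_le[OF _ \<open>0 < q\<close>])
  show li: "integrable M (\<lambda>z. ln (r z))"
    by (rule Bochner_Integration.integrable_bound[OF bi]) (use be in \<open>auto elim!: eventually_mono intro: order_trans[OF _ abs_ge_self]\<close>)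
  have "\<bar>\<integral>z. ln (r z) \<partial>M\<bar> \<le> (\<integral>z. \<bar>ln (r z)\<bar> \<partial>M)" by (rule integral_abs_bound)
  also have "\<dots> \<le> (\<integral>z. ?b z \<partial>M)" by (rule integral_mono_AE[OF _ bi be]) (use li in auto)
  also have "\<dots> = 1 + (1 + 1 / q) * (\<integral>z. ?E z \<partial>M)"
    by (subst Bochner_Integration.integral_add[OF integrable_const integrable_mult_right[OF Ei]])
      (simp only: integral_mult_right_zero lebesgue_integral_const prob_space scaleR_one)
  also have "\<dots> \<le> 1 + (1 + 1 / q) * A" using EA \<open>0 < q\<close> by (intro add_left_mono mult_left_mono) auto
  finally show "\<bar>\<integral>z. ln (r z) \<partial>M\<bar> \<le> 1 + (1 + 1 / q) * A" .
  have pb: "r z powr p \<le> 1 + ?E z" if "0 < p" "p \<le> 2 * q" for p z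
    by (rule order_trans[OF powr_le_one_plus[OF nonneg[of z] that]]) simp
  have b1: "integrable M (\<lambda>z. 1 + ?E z)" using Ei by (intro Bochner_Integration.integrable_add[OF integrable_const])
  show ri: "integrable M (\<lambda>z. r z powr p)" if "0 < p" "p \<le> 2 * q" for p
    by (rule Bochner_Integration.integrable_bound[OF b1]) (use pb[OF that] in \<open>auto intro: order_trans[OF _ abs_ge_self]\<close>)
  show "(\<integral>z. r z powr p \<partial>M) \<le> 1 + A" if "0 < p" "p \<le> 2 * q" for p
  proof -
    have "(\<integral>z. r z powr p \<partial>M) \<le> (\<integral>z. 1 + ?E z \<partial>M)"
      by (rule integral_mono[OF ri[OF that] b1 pb[OF that]])
    also have "\<dots> = 1 + (\<integral>z. ?E z \<partial>M)"
      by (subst Bochner_Integration.integral_add[OF integrable_const Ei]) (simp add: prob_space)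
    finally show ?thesis using EA by simp
  qed
  show "\<bar>((\<integral>z. r z powr p \<partial>M) - 1) / p - (\<integral>z. ln (r z) \<partial>M)\<bar> \<le> p * (1 + 4 / q\<^sup>2) * A" if "0 < p" "p \<le> q" for p
  proof -
    have rp: "integrable M (\<lambda>z. r z powr p)" using that by (intro ri) auto
    have r1: "integrable M (\<lambda>z. r z powr p - 1)" by (rule Bochner_Integration.integrable_diff[OF rp integrable_const])
    have "(\<integral>z. r z powr p - 1 \<partial>M) = (\<integral>z. r z powr p \<partial>M) - 1"
      by (subst Bochner_Integration.integral_diff[OF rp integrable_const]) (simp add: prob_space)
    then have "((\<integral>z. r z powr p \<partial>M) - 1) / p - (\<integral>z. ln (r z) \<partial>M) = (\<integral>z. (r z powr p - 1) / p - ln (r z) \<partial>M)"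
      using Bochner_Integration.integral_diff[OF integrable_divide[OF r1, of p] li] by simp
    also have "\<bar>\<dots>\<bar> \<le> (\<integral>z. \<bar>(r z powr p - 1) / p - ln (r z)\<bar> \<partial>M)" by (rule integral_abs_bound)
    also have "\<dots> \<le> (\<integral>z. p * (1 + 4 / q\<^sup>2) * ?E z \<partial>M)"
    proof (rule integral_mono_AE)
      show "integrable M (\<lambda>z. \<bar>(r z powr p - 1) / p - ln (r z)\<bar>)"
        by (intro integrable_abs Bochner_Integration.integrable_diff integrable_divide[OF r1] li)
      show "integrable M (\<lambda>z. p * (1 + 4 / q\<^sup>2) * ?E z)" by (intro integrable_mult_right Ei)
      show "AE z in M. \<bar>(r z powr p - 1) / p - ln (r z)\<bar> \<le> p * (1 + 4 / q\<^sup>2) * ?E z"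
        using pos by eventually_elim (rule powr_quotient_minus_ln_le[OF _ that])
    qed
    also have "\<dots> = p * (1 + 4 / q\<^sup>2) * (\<integral>z. ?E z \<partial>M)" by (rule integral_mult_right_zero)
    also have "\<dots> \<le> p * (1 + 4 / q\<^sup>2) * A" using EA that by (intro mult_left_mono) auto
    finally show ?thesis .
  qed
qed

section \<open>The normalized field\<close>

lemma (in prob_space) L2_tendsto_sum:
  fixes Y :: "'j \<Rightarrow> 'a \<Rightarrow> real"
  assumes "finite J"
    and "\<And>j. j \<in> J \<Longrightarrow> Y j \<in> borel_measurable M" "\<And>j n. j \<in> J \<Longrightarrow> F j n \<in> borel_measurable M"
    and "\<And>j. j \<in> J \<Longrightarrow> (\<lambda>n. \<integral>\<^sup>+ \<omega>. ennreal ((Y j \<omega> - F j n \<omega>)\<^sup>2) \<partial>M) \<longlonglongrightarrow> 0"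
  shows "(\<lambda>n. \<integral>\<^sup>+ \<omega>. ennreal (((\<Sum>j\<in>J. c j * Y j \<omega>) - (\<Sum>j\<in>J. c j * F j n \<omega>))\<^sup>2) \<partial>M) \<longlonglongrightarrow> 0"
  using assms
proof (induction J)
  case (insert j J)
  have [measurable]: "Y j \<in> borel_measurable M" "F j n \<in> borel_measurable M" for n
    using insert.prems by auto
  have [measurable]: "(\<lambda>\<omega>. \<Sum>j\<in>J. c j * Y j \<omega>) \<in> borel_measurable M" "(\<lambda>\<omega>. \<Sum>j\<in>J. c j * F j n \<omega>) \<in> borel_measurable M" for n
    using insert.prems by (auto intro!: borel_measurable_sum borel_measurable_times)
  have "(\<lambda>n. \<integral>\<^sup>+ \<omega>. ennreal ((c j * (Y j \<omega> - F j n \<omega>) + 1 * ((\<Sum>j\<in>J. c j * Y j \<omega>) - (\<Sum>j\<in>J. c j * F j n \<omega>)))\<^sup>2) \<partial>M) \<longlonglongrightarrow> 0"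
    by (rule nn_integral_square_combination_tendsto[OF _ _ insert.prems(3) insert.IH]) (use insert.prems in auto)
  moreover have "(\<Sum>j\<in>insert j J. c j * Y j \<omega>) - (\<Sum>j\<in>insert j J. c j * F j n \<omega>) =
      c j * (Y j \<omega> - F j n \<omega>) + 1 * ((\<Sum>j\<in>J. c j * Y j \<omega>) - (\<Sum>j\<in>J. c j * F j n \<omega>))" for n \<omega>
    using insert.hyps by (simp add: algebra_simps)
  ultimately show ?case by (simp only:)
qed simp

locale normalized_fbm = fbm_family M I S Z K \<kappa> H0 k B
  for M :: "'w measure" and I :: "'i set" and S :: "'i \<Rightarrow> 'a::euclidean_space set" and Z :: "'i \<Rightarrow> 'w \<Rightarrow> real"
    and K :: "'a set" and \<kappa> and H0 and k and B +
  fixes D :: "'a set" and \<psi> :: "'a \<Rightarrow> 'a \<Rightarrow> real"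
  assumes domain: "bounded_domain D" and kernel: "\<psi> \<in> normalizing_kernels H0 D" and log_bound: "uniform_log_bound D \<psi>"
begin

section \<open>The normalizing kernel as a family of probability measures\<close>

definition \<mu> :: "'a \<Rightarrow> 'a measure" where
  "\<mu> y = density lborel (\<lambda>u. ennreal (\<psi> u y))"

lemma \<psi>_measurable [measurable]: "(\<lambda>u. \<psi> u y) \<in> borel_measurable borel"
proof -
  have m: "(\<lambda>(x, y). \<psi> x y) \<in> borel_measurable borel" using kernel by (simp add: normalizing_kernels_def)
  have "(\<lambda>u. (u, y)) \<in> borel_measurable borel" by (intro borel_measurable_continuous_onI continuous_intros)
  from measurable_compose[OF this m] show ?thesis by simp
qed

lemma \<psi>_nonneg [simp]: "0 \<le> \<psi> u y"
  using kernel by (simp add: normalizing_kernels_def)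

lemma sets_\<mu> [simp, measurable_cong]: "sets (\<mu> y) = sets borel"
  and space_\<mu> [simp]: "space (\<mu> y) = UNIV"
  by (simp_all add: \<mu>_def)

lemma nn_integral_\<mu>: "f \<in> borel_measurable borel \<Longrightarrow> (\<integral>\<^sup>+ u. f u \<partial>\<mu> y) = (\<integral>\<^sup>+ u. ennreal (\<psi> u y) * f u \<partial>lborel)"
  unfolding \<mu>_def by (rule nn_integral_density) auto

lemma integrable_\<mu>: "f \<in> borel_measurable borel \<Longrightarrow> integrable (\<mu> y) f \<longleftrightarrow> integrable lborel (\<lambda>u. f u * \<psi> u y)"
  for f :: "'a \<Rightarrow> real"
  unfolding \<mu>_def by (subst integrable_density) (auto simp: mult.commute)

lemma integral_\<mu>: "f \<in> borel_measurable borel \<Longrightarrow> (\<integral>u. f u \<partial>\<mu> y) = (\<integral>u. f u * \<psi> u y \<partial>lborel)"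
  for f :: "'a \<Rightarrow> real"
  unfolding \<mu>_def by (subst integral_density) (auto simp: mult.commute)

lemma prob_space_\<mu>: "y \<in> D \<Longrightarrow> prob_space (\<mu> y)"
proof
  assume "y \<in> D"
  then have 1: "(\<integral>u. \<psi> u y \<partial>lborel) = 1" using kernel by (simp add: normalizing_kernels_def)
  then have "integrable lborel (\<lambda>u. \<psi> u y)" using not_integrable_integral_eq by fastforce
  then have "(\<integral>\<^sup>+ u. ennreal (\<psi> u y) \<partial>lborel) = 1" using 1 by (simp add: nn_integral_eq_integral)
  then show "emeasure (\<mu> y) (space (\<mu> y)) = 1" by (simp add: \<mu>_def emeasure_density)
qed

lemma emeasure_\<mu>_singleton [simp]: "emeasure (\<mu> y) {u} = 0"
proof -
  have "emeasure (\<mu> y) {u} = (\<integral>\<^sup>+ z. ennreal (\<psi> z y) * indicator {u} z \<partial>lborel)"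
    by (simp add: \<mu>_def emeasure_density)
  also have "\<dots> = (\<integral>\<^sup>+ z. 0 \<partial>(lborel :: 'a measure))"
    by (rule nn_integral_cong_AE) (use AE_lborel_singleton[of u] in eventually_elim, auto simp: indicator_def)
  finally show ?thesis by simp
qed

text \<open>One real constant for the three finite suprema. The middle bound, with \<open>w\<close>
  independent of \<open>y\<close>, is the one that comes from
  \<open>uniform_log_bound\<close>.\<close>

lemma kernel_bounds:
  obtains A where "0 \<le> A"
    "\<And>y. y \<in> D \<Longrightarrow> (\<integral>\<^sup>+ u. ennreal (norm u powr (2 * H0)) \<partial>\<mu> y) \<le> ennreal A"
    "\<And>y w. y \<in> D \<Longrightarrow> w \<in> D \<Longrightarrow> (\<integral>\<^sup>+ u. ennreal ((ln_minus (norm (u - w)))\<^sup>2) \<partial>\<mu> y) \<le> ennreal A"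
    "\<And>y w. y \<in> D \<Longrightarrow> w \<in> D \<Longrightarrow> (\<integral>\<^sup>+ v. \<integral>\<^sup>+ u. ennreal ((ln_minus (norm (u - v)))\<^sup>2) \<partial>\<mu> y \<partial>\<mu> w) \<le> ennreal A"
proof -
  let ?S1 = "SUP y\<in>D. \<integral>\<^sup>+ x. ennreal (norm x powr (2 * H0) * \<psi> x y) \<partial>lborel"
  let ?S2 = "SUP (y, w)\<in>D \<times> D. \<integral>\<^sup>+ x. ennreal ((ln_minus (norm (x - w)))\<^sup>2 * \<psi> x y) \<partial>lborel"
  let ?S3 = "SUP (y, w)\<in>D \<times> D. \<integral>\<^sup>+ v. \<integral>\<^sup>+ x. ennreal ((ln_minus (norm (x - v)))\<^sup>2 * \<psi> x y * \<psi> v w) \<partial>lborel \<partial>lborel"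
  have fin: "?S1 < \<infinity>" "?S2 < \<infinity>" "?S3 < \<infinity>"
    using kernel log_bound by (simp_all only: normalizing_kernels_def uniform_log_bound_def mem_Collect_eq)
  define A where "A = enn2real (?S1 + ?S2 + ?S3)"
  have A: "?S1 + ?S2 + ?S3 = ennreal A" using fin by (simp add: A_def)
  have le: "?S1 \<le> ennreal A" "?S2 \<le> ennreal A" "?S3 \<le> ennreal A"
    unfolding A[symmetric] by (auto intro: add_increasing add_increasing2)
  have lnm [measurable]: "ln_minus \<in> borel_measurable borel" unfolding ln_minus_def[abs_def] by measurable
  show ?thesis
  proof (rule that[of A])
    show "0 \<le> A" by (simp add: A_def)
    fix y assume y: "y \<in> D"
    have "(\<integral>\<^sup>+ u. ennreal (norm u powr (2 * H0)) \<partial>\<mu> y) = (\<integral>\<^sup>+ x. ennreal (norm x powr (2 * H0) * \<psi> x y) \<partial>lborel)"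
      by (subst nn_integral_\<mu>) (auto simp: ennreal_mult' mult.commute intro!: nn_integral_cong)
    also have "\<dots> \<le> ?S1" by (rule SUP_upper[OF y])
    finally show "(\<integral>\<^sup>+ u. ennreal (norm u powr (2 * H0)) \<partial>\<mu> y) \<le> ennreal A" using le(1) by (rule order_trans)
    fix w assume w: "w \<in> D"
    have "(\<integral>\<^sup>+ u. ennreal ((ln_minus (norm (u - w)))\<^sup>2) \<partial>\<mu> y) = (\<integral>\<^sup>+ x. ennreal ((ln_minus (norm (x - w)))\<^sup>2 * \<psi> x y) \<partial>lborel)"
      by (subst nn_integral_\<mu>) (auto simp: ennreal_mult' mult.commute intro!: nn_integral_cong)
    also have "\<dots> \<le> ?S2" using SUP_upper[of "(y, w)" "D \<times> D" "\<lambda>(y, w). \<integral>\<^sup>+ x. ennreal ((ln_minus (norm (x - w)))\<^sup>2 * \<psi> x y) \<partial>lborel"] y w by simp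
    finally show "(\<integral>\<^sup>+ u. ennreal ((ln_minus (norm (u - w)))\<^sup>2) \<partial>\<mu> y) \<le> ennreal A" using le(2) by (rule order_trans)
    have "(\<integral>\<^sup>+ v. \<integral>\<^sup>+ u. ennreal ((ln_minus (norm (u - v)))\<^sup>2) \<partial>\<mu> y \<partial>\<mu> w) =
        (\<integral>\<^sup>+ v. ennreal (\<psi> v w) * (\<integral>\<^sup>+ u. ennreal (\<psi> u y) * ennreal ((ln_minus (norm (u - v)))\<^sup>2) \<partial>lborel) \<partial>lborel)"
      by (subst nn_integral_\<mu>) (auto simp: nn_integral_\<mu>)
    also have "\<dots> = (\<integral>\<^sup>+ v. \<integral>\<^sup>+ x. ennreal ((ln_minus (norm (x - v)))\<^sup>2 * \<psi> x y * \<psi> v w) \<partial>lborel \<partial>lborel)"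
      by (intro nn_integral_cong, subst nn_integral_cmult[symmetric])
         (auto simp: ennreal_mult' mult_ac intro!: nn_integral_cong)
    also have "\<dots> \<le> ?S3" using SUP_upper[of "(y, w)" "D \<times> D" "\<lambda>(y, w). \<integral>\<^sup>+ v. \<integral>\<^sup>+ x. ennreal ((ln_minus (norm (x - v)))\<^sup>2 * \<psi> x y * \<psi> v w) \<partial>lborel \<partial>lborel"] y w by simp
    finally show "(\<integral>\<^sup>+ v. \<integral>\<^sup>+ u. ennreal ((ln_minus (norm (u - v)))\<^sup>2) \<partial>\<mu> y \<partial>\<mu> w) \<le> ennreal A"
      using le(3) by (rule order_trans)
  qed
qed

text \<open>The smaller exponent \<open>2 * H\<close> is at the expense of a constant covered by the
  moment of order \<open>2 * H0\<close>.\<close>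

lemma \<mu>_moment_finite:
  assumes y: "y \<in> D" and "H \<in> {0<..<H0}" "0 \<le> a"
  shows "(\<integral>\<^sup>+ u. ennreal (a * norm (x - u) powr (2 * H)) \<partial>\<mu> y) < \<infinity>"
proof -
  interpret \<mu>: prob_space "\<mu> y" using y by (rule prob_space_\<mu>)
  obtain A where A: "(\<integral>\<^sup>+ u. ennreal (norm u powr (2 * H0)) \<partial>\<mu> y) \<le> ennreal A"
  proof (rule kernel_bounds)
    fix A assume "\<And>y. y \<in> D \<Longrightarrow> (\<integral>\<^sup>+ u. ennreal (norm u powr (2 * H0)) \<partial>\<mu> y) \<le> ennreal A"
    from that[OF this[OF y]] show thesis .
  qed
  have "norm (x - u) powr (2 * H) \<le> (1 + 2 * norm x powr (2 * H0)) + 2 * norm u powr (2 * H0)" for u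
    using norm_diff_powr_le[of "2 * H0" x u] powr_le_one_plus[of "norm (x - u)" "2 * H" "2 * H0"] H0 assms by auto
  from mult_left_mono[OF this \<open>0 \<le> a\<close>]
  have "a * norm (x - u) powr (2 * H) \<le> a * (1 + 2 * norm x powr (2 * H0)) + 2 * a * norm u powr (2 * H0)" for u
    by (simp only: distrib_left mult.assoc mult.left_commute)
  then have "(\<integral>\<^sup>+ u. ennreal (a * norm (x - u) powr (2 * H)) \<partial>\<mu> y) \<le>
      (\<integral>\<^sup>+ u. ennreal (a * (1 + 2 * norm x powr (2 * H0))) + ennreal (2 * a) * ennreal (norm u powr (2 * H0)) \<partial>\<mu> y)"
    using \<open>0 \<le> a\<close> by (intro nn_integral_mono) (simp add: ennreal_mult[symmetric] ennreal_plus[symmetric] ennreal_leI del: ennreal_plus)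
  also have "\<dots> = ennreal (a * (1 + 2 * norm x powr (2 * H0))) + ennreal (2 * a) * (\<integral>\<^sup>+ u. ennreal (norm u powr (2 * H0)) \<partial>\<mu> y)"
    by (simp add: nn_integral_add nn_integral_cmult \<mu>.emeasure_space_1[simplified])
  also have "\<dots> < \<infinity>" using A by (auto simp: ennreal_mult_less_top intro: le_less_trans)
  finally show ?thesis .
qed

lemma measurable_pair_\<mu>: "f \<in> borel_measurable (M \<Otimes>\<^sub>M \<mu> y) \<longleftrightarrow> f \<in> borel_measurable (M \<Otimes>\<^sub>M borel)"
  by (simp cong: measurable_cong_sets sets_pair_measure_cong)

lemma B_section_measurable: "H \<in> {0<..<H0} \<Longrightarrow> \<omega> \<in> space M \<Longrightarrow> (\<lambda>u. B H u \<omega>) \<in> borel_measurable borel"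
  by (rule borel_measurable_continuous_onI) (rule continuous_paths)

lemma increment_jointly_measurable:
  assumes H: "H \<in> {0<..<H0}"
  shows "(\<lambda>(\<omega>, u). B H x \<omega> - B H u \<omega>) \<in> borel_measurable (M \<Otimes>\<^sub>M \<mu> y)"
  unfolding measurable_pair_\<mu> using B_jointly_measurable[OF H] B_measurable[OF H]
  by (simp add: case_prod_beta')

lemma increment_integrable:
  assumes H: "H \<in> {0<..<H0}" and y: "y \<in> D"
  shows "AE \<omega> in M. integrable (\<mu> y) (\<lambda>u. B H x \<omega> - B H u \<omega>)"
  by (rule AE_integrable_of_second_moments[OF prob_space_\<mu>[OF y] increment_jointly_measurable[OF H] increment_second_moment[OF H]])
     (rule \<mu>_moment_finite[OF y H], use \<Phi>_nonneg[OF H H] in auto)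

lemma B_integrable_\<mu>:
  assumes H: "H \<in> {0<..<H0}" and y: "y \<in> D"
  shows "AE \<omega> in M. integrable (\<mu> y) (\<lambda>u. B H u \<omega>)"
  using increment_integrable[OF assms, of 0]
proof eventually_elim
  case (elim \<omega>)
  interpret \<mu>: prob_space "\<mu> y" using y by (rule prob_space_\<mu>)
  from Bochner_Integration.integrable_diff[OF \<mu>.integrable_const[of "B H 0 \<omega>"] elim] show ?case by simp
qed

lemma B_integrable:
  assumes H: "H \<in> {0<..<H0}" and y: "y \<in> D"
  shows "AE \<omega> in M. integrable lborel (\<lambda>u. B H u \<omega> * \<psi> u y)"
  using B_integrable_\<mu>[OF assms] AE_space
  by eventually_elim (simp add: integrable_\<mu> B_section_measurable[OF H])

section \<open>Gaussianity of the normalized field\<close>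

abbreviation "X \<equiv> normalized_field \<psi> B"

abbreviation "G H \<equiv> Gamma H powr (1/2)"

text \<open>Only almost sure: on a path that is not integrable against the kernel, both integrals
  are 0 by convention and the identity may fail.\<close>

lemma normalized_field_increment:
  assumes H: "H \<in> {0<..<H0}" and y: "y \<in> D"
  shows "AE \<omega> in M. X H y \<omega> = G H * (\<integral>u. B H y \<omega> - B H u \<omega> \<partial>\<mu> y)"
  using B_integrable_\<mu>[OF assms] AE_space
proof eventually_elim
  case (elim \<omega>)
  interpret \<mu>: prob_space "\<mu> y" using y by (rule prob_space_\<mu>)
  show ?case using elim \<mu>.prob_space
    by (simp add: normalized_field_def integral_\<mu>[symmetric] B_section_measurable[OF H])
qed

lemma normalized_field_measurable:
  assumes H [measurable]: "H \<in> {0<..<H0}"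
  shows "X H y \<in> borel_measurable M"
proof -
  have [measurable]: "(\<lambda>(\<omega>, u). B H u \<omega> * \<psi> u y) \<in> borel_measurable (M \<Otimes>\<^sub>M lborel)"
    using B_jointly_measurable[OF H] by (simp add: case_prod_beta' measurable_lborel2 cong: measurable_cong_sets sets_pair_measure_cong)
  show ?thesis unfolding normalized_field_def[abs_def] by measurable
qed

text \<open>The average over the kernel is replaced by the finite sum over the values of
  \<open>rounding n\<close>, so this variable is a Wiener integral and hence Gaussian.\<close>

definition discretised :: "nat \<Rightarrow> real \<Rightarrow> 'a \<Rightarrow> 'w \<Rightarrow> real" where
  "discretised n H y \<omega> = G H * (B H y \<omega> - (\<Sum>w\<in>range (rounding n). measure (\<mu> y) (rounding n -` {w}) * B H w \<omega>))"

lemma wiener_discretised: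
  assumes H: "H \<in> {0<..<H0}"
  shows "\<exists>f. W f (discretised n H y)"
proof -
  have s: "W (\<lambda>s. \<Sum>w\<in>range (rounding n). measure (\<mu> y) (rounding n -` {w}) * (k H * fbm_kernel H w s))
      (\<lambda>\<omega>. \<Sum>w\<in>range (rounding n). measure (\<mu> y) (rounding n -` {w}) * B H w \<omega>)"
    by (rule wiener_integral_sum[OF rounding_range wiener_B[OF H]])
  from wiener_integral_combination[OF wiener_B[OF H, of y] s, of "G H" "- G H"]
  show ?thesis by (auto simp: discretised_def[abs_def] algebra_simps)
qed

text \<open>The error is \<open>G H\<close> times the average of \<open>B\<close> at
  \<open>rounding n u\<close> minus \<open>B\<close> at \<open>u\<close>. Jensen's inequality and
  Tonelli reduce its second moment to the average of
  \<open>norm (rounding n u - u) powr (2 * H)\<close>, which tends to 0 by dominated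
  convergence.\<close>

lemma discretised_tendsto:
  assumes H: "H \<in> {0<..<H0}" and y: "y \<in> D"
  shows "(\<lambda>n. \<integral>\<^sup>+ \<omega>. ennreal ((X H y \<omega> - discretised n H y \<omega>)\<^sup>2) \<partial>M) \<longlonglongrightarrow> 0"
proof (rule tendsto_sandwich[where f="\<lambda>_. 0"])
  interpret \<mu>: prob_space "\<mu> y" using y by (rule prob_space_\<mu>)
  interpret P: pair_sigma_finite M "\<mu> y" ..
  let ?a = "2 * (k H)\<^sup>2 * \<Phi> H H"
  have a: "0 \<le> ?a" using \<Phi>_nonneg[OF H H] by simp
  let ?b = "\<lambda>n. ennreal ((G H)\<^sup>2) * (\<integral>\<^sup>+ u. ennreal (?a * norm (rounding n u - u) powr (2 * H)) \<partial>\<mu> y)"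
  have "(\<lambda>n. \<integral>\<^sup>+ u. ennreal (?a * norm (rounding n u - u) powr (2 * H)) \<partial>\<mu> y) \<longlonglongrightarrow> (\<integral>\<^sup>+ u. 0 \<partial>\<mu> y)"
  proof (rule nn_integral_dominated_convergence)
    \<comment> \<open>The factor 3 comes from \<open>norm (rounding n u) \<le> 2 * norm u\<close>
      and the triangle inequality.\<close>
    show "(\<integral>\<^sup>+ u. ennreal (?a * 3 powr (2 * H) * norm (0 - u) powr (2 * H)) \<partial>\<mu> y) < \<infinity>"
      by (rule \<mu>_moment_finite[OF y H]) (use a in auto)
    show "AE u in \<mu> y. ennreal (?a * norm (rounding n u - u) powr (2 * H)) \<le> ennreal (?a * 3 powr (2 * H) * norm (0 - u) powr (2 * H))" for n
    proof (rule AE_I2)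
      fix u
      have "norm (rounding n u - u) \<le> 3 * norm u"
        using norm_triangle_ineq4[of "rounding n u" u] rounding(3)[of n u] by simp
      then have "norm (rounding n u - u) powr (2 * H) \<le> (3 * norm u) powr (2 * H)"
        using H by (intro powr_mono2) auto
      then have "?a * norm (rounding n u - u) powr (2 * H) \<le> ?a * (3 powr (2 * H) * norm u powr (2 * H))"
        using a by (intro mult_left_mono) (auto simp: powr_mult)
      then show "ennreal (?a * norm (rounding n u - u) powr (2 * H)) \<le> ennreal (?a * 3 powr (2 * H) * norm (0 - u) powr (2 * H))"
        by (intro ennreal_leI) (simp add: mult.assoc)
    qed
    show "AE u in \<mu> y. (\<lambda>n. ennreal (?a * norm (rounding n u - u) powr (2 * H))) \<longlonglongrightarrow> 0"
    proof (rule AE_I2)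
      fix u
      have "(\<lambda>n. norm (rounding n u - u)) \<longlonglongrightarrow> 0"
        by (rule tendsto_norm_zero[OF LIM_zero[OF rounding(2)]])
      then have "(\<lambda>n. norm (rounding n u - u) powr (2 * H)) \<longlonglongrightarrow> 0 powr (2 * H)"
        using H by (intro tendsto_powr') auto
      then have "(\<lambda>n. norm (rounding n u - u) powr (2 * H)) \<longlonglongrightarrow> 0" by simp
      from tendsto_mult_right_zero[OF this]
      have "(\<lambda>n. ?a * norm (rounding n u - u) powr (2 * H)) \<longlonglongrightarrow> 0" .
      from tendsto_ennrealI[OF this] show "(\<lambda>n. ennreal (?a * norm (rounding n u - u) powr (2 * H))) \<longlonglongrightarrow> 0"
        by simp
    qed
  qed measurable
  from ennreal_tendsto_cmult[OF _ this, of "ennreal ((G H)\<^sup>2)"]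
  show "?b \<longlonglongrightarrow> 0" by simp
  have "(\<integral>\<^sup>+ \<omega>. ennreal ((X H y \<omega> - discretised n H y \<omega>)\<^sup>2) \<partial>M) \<le> ?b n" for n
  proof -
    let ?D = "\<lambda>\<omega> u. B H (rounding n u) \<omega> - B H u \<omega>"
    have D: "(\<lambda>(\<omega>, u). ?D \<omega> u) \<in> borel_measurable (M \<Otimes>\<^sub>M \<mu> y)"
      unfolding measurable_pair_\<mu> using B_jointly_measurable[OF H] B_rounding_measurable[OF H, of n]
      by (simp add: case_prod_beta')
    have D2: "(\<lambda>(\<omega>, u). ennreal ((?D \<omega> u)\<^sup>2)) \<in> borel_measurable (M \<Otimes>\<^sub>M \<mu> y)"
      using borel_measurable_power[OF D, of 2] by (simp add: case_prod_beta')
    have ae: "AE \<omega> in M. ennreal ((X H y \<omega> - discretised n H y \<omega>)\<^sup>2) \<le> ennreal ((G H)\<^sup>2) * (\<integral>\<^sup>+ u. ennreal ((?D \<omega> u)\<^sup>2) \<partial>\<mu> y)"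
      using B_integrable_\<mu>[OF H y] normalized_field_increment[OF H y] AE_space
    proof eventually_elim
      case (elim \<omega>)
      have ir: "integrable (\<mu> y) (\<lambda>u. B H (rounding n u) \<omega>)"
        and er: "(\<integral>u. B H (rounding n u) \<omega> \<partial>\<mu> y) = (\<Sum>w\<in>range (rounding n). measure (\<mu> y) (rounding n -` {w}) * B H w \<omega>)"
        unfolding rounding_sum[of "\<lambda>u. B H u \<omega>"] by (simp_all add: mult.commute \<mu>.emeasure_finite less_top[symmetric])
      have "X H y \<omega> - discretised n H y \<omega> = G H * (\<integral>u. ?D \<omega> u \<partial>\<mu> y)"
        using elim(1) \<mu>.prob_space unfolding elim(2) discretised_def er[symmetric]
        by (simp add: ir right_diff_distrib)
      then have "ennreal ((X H y \<omega> - discretised n H y \<omega>)\<^sup>2) = ennreal ((G H)\<^sup>2) * ennreal ((\<integral>u. ?D \<omega> u \<partial>\<mu> y)\<^sup>2)"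
        by (simp add: power_mult_distrib ennreal_mult)
      also have "\<dots> \<le> ennreal ((G H)\<^sup>2) * (\<integral>\<^sup>+ u. ennreal ((?D \<omega> u)\<^sup>2) \<partial>\<mu> y)"
        using elim(1) ir by (intro mult_left_mono \<mu>.Jensen_square) auto
      finally show ?case .
    qed
    have "(\<integral>\<^sup>+ \<omega>. ennreal ((X H y \<omega> - discretised n H y \<omega>)\<^sup>2) \<partial>M) \<le> (\<integral>\<^sup>+ \<omega>. ennreal ((G H)\<^sup>2) * (\<integral>\<^sup>+ u. ennreal ((?D \<omega> u)\<^sup>2) \<partial>\<mu> y) \<partial>M)"
      by (rule nn_integral_mono_AE[OF ae])
    also have "\<dots> = ennreal ((G H)\<^sup>2) * (\<integral>\<^sup>+ \<omega>. \<integral>\<^sup>+ u. ennreal ((?D \<omega> u)\<^sup>2) \<partial>\<mu> y \<partial>M)"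
      by (rule nn_integral_cmult[OF \<mu>.borel_measurable_nn_integral[OF D2]])
    also have "(\<integral>\<^sup>+ \<omega>. \<integral>\<^sup>+ u. ennreal ((?D \<omega> u)\<^sup>2) \<partial>\<mu> y \<partial>M) = (\<integral>\<^sup>+ u. \<integral>\<^sup>+ \<omega>. ennreal ((?D \<omega> u)\<^sup>2) \<partial>M \<partial>\<mu> y)"
      by (rule P.Fubini'[OF D2, symmetric])
    also have "\<dots> \<le> (\<integral>\<^sup>+ u. ennreal (?a * norm (rounding n u - u) powr (2 * H)) \<partial>\<mu> y)"
      by (intro nn_integral_mono increment_second_moment[OF H])
    finally show ?thesis by (simp add: mult_left_mono)
  qed
  then show "\<forall>\<^sub>F n in sequentially. (\<integral>\<^sup>+ \<omega>. ennreal ((X H y \<omega> - discretised n H y \<omega>)\<^sup>2) \<partial>M) \<le> ?b n" by simp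
qed auto

text \<open>Since all \<open>H\<close> share one noise, a finite combination of discretised fields
  is a single Wiener integral, even across different \<open>H\<close>; the combination of the fields
  themselves is a mean-square limit of such variables.\<close>

lemma normalized_field_gaussian: "centred_gaussian_family M ({0<..<H0} \<times> D) (\<lambda>(H, y). X H y)"
  unfolding centred_gaussian_family_def
proof (intro allI impI, elim conjE)
  fix J and c :: "real \<times> 'a \<Rightarrow> real" assume J: "finite J" "J \<subseteq> {0<..<H0} \<times> D"
  let ?F = "\<lambda>j n. discretised n (fst j) (snd j)"
  define f where "f n j = (SOME f. W f (?F j n))" for n j
  have HJ: "fst j \<in> {0<..<H0}" "snd j \<in> D" if "j \<in> J" for j
    using subsetD[OF J(2) that] by (cases j; simp)+
  have f: "W (f n j) (?F j n)" if "j \<in> J" for n j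
    unfolding f_def by (rule someI_ex[of "\<lambda>f. W f (?F j n)"]) (rule wiener_discretised[OF HJ(1)[OF that]])
  have g: "centred_gaussian_rv M (\<lambda>\<omega>. \<Sum>j\<in>J. c j * ?F j n \<omega>)" for n
    by (rule wiener_integral(6)[OF wiener_integral_sum[OF J(1) f]])
  have XJ: "X (fst j) (snd j) \<in> borel_measurable M" if "j \<in> J" for j
    by (rule normalized_field_measurable[OF HJ(1)[OF that]])
  have "centred_gaussian_rv M (\<lambda>\<omega>. \<Sum>j\<in>J. c j * X (fst j) (snd j) \<omega>)"
  proof (rule centred_gaussian_L2_limit[OF g])
    show "(\<lambda>\<omega>. \<Sum>j\<in>J. c j * X (fst j) (snd j) \<omega>) \<in> borel_measurable M"
      using XJ by (intro borel_measurable_sum borel_measurable_times) auto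
    show "(\<lambda>n. \<integral>\<^sup>+ \<omega>. ennreal (((\<Sum>j\<in>J. c j * X (fst j) (snd j) \<omega>) - (\<Sum>j\<in>J. c j * ?F j n \<omega>))\<^sup>2) \<partial>M) \<longlonglongrightarrow> 0"
      by (rule L2_tendsto_sum[OF J(1) XJ wiener_integral(2)[OF f] discretised_tendsto[OF HJ]])
  qed
  then show "centred_gaussian_rv M (\<lambda>\<omega>. \<Sum>j\<in>J. c j * (case j of (H, y) \<Rightarrow> X H y) \<omega>)"
    by (simp only: case_prod_unfold)
qed

section \<open>The covariance as a double integral against the kernel\<close>

definition increment_bound :: "real \<Rightarrow> 'a \<Rightarrow> 'a \<Rightarrow> ennreal" where
  "increment_bound H z u = ennreal (2 * (k H)\<^sup>2 * \<Phi> H H * norm (z - u) powr (2 * H))"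

lemma increment_bound:
  "increment_bound H z \<in> borel_measurable (\<mu> z')"
  "H \<in> {0<..<H0} \<Longrightarrow> z' \<in> D \<Longrightarrow> (\<integral>\<^sup>+ u. increment_bound H z u \<partial>\<mu> z') < \<infinity>"
  "H \<in> {0<..<H0} \<Longrightarrow> (\<integral>\<^sup>+ \<omega>. ennreal ((B H z \<omega> - B H u \<omega>)\<^sup>2) \<partial>M) \<le> increment_bound H z u"
proof -
  have "increment_bound H z \<in> borel_measurable borel"
    unfolding increment_bound_def[abs_def] by measurable
  then show "increment_bound H z \<in> borel_measurable (\<mu> z')"
    unfolding measurable_cong_sets[OF sets_\<mu> refl] .
  show "(\<integral>\<^sup>+ u. increment_bound H z u \<partial>\<mu> z') < \<infinity>" if "H \<in> {0<..<H0}" "z' \<in> D"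
    unfolding increment_bound_def by (rule \<mu>_moment_finite[OF that(2,1)]) (simp add: \<Phi>_nonneg[OF that(1,1)])
  show "(\<integral>\<^sup>+ \<omega>. ennreal ((B H z \<omega> - B H u \<omega>)\<^sup>2) \<partial>M) \<le> increment_bound H z u" if "H \<in> {0<..<H0}"
    unfolding increment_bound_def by (rule increment_second_moment[OF that])
qed

lemma increment_product_expectation:
  assumes H: "H \<in> {0<..<H0}" and h: "h \<in> {0<..<H0}" and x: "x \<in> D" and y: "y \<in> D"
  shows "integrable (\<mu> x \<Otimes>\<^sub>M \<mu> y) (\<lambda>(u, w). expectation (\<lambda>\<omega>. (B H x \<omega> - B H u \<omega>) * (B h y \<omega> - B h w \<omega>)))" (is ?thesis1)
    and "expectation (\<lambda>\<omega>. (\<integral>u. B H x \<omega> - B H u \<omega> \<partial>\<mu> x) * (\<integral>w. B h y \<omega> - B h w \<omega> \<partial>\<mu> y)) =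
      (\<integral>(u, w). expectation (\<lambda>\<omega>. (B H x \<omega> - B H u \<omega>) * (B h y \<omega> - B h w \<omega>)) \<partial>(\<mu> x \<Otimes>\<^sub>M \<mu> y))" (is ?thesis2)
proof -
  note E = expectation_product_of_integrals[OF prob_space_\<mu>[OF x] prob_space_\<mu>[OF y]
      increment_jointly_measurable[OF H] increment_jointly_measurable[OF h] increment_bound(1) increment_bound(3)[OF H] increment_bound(2)[OF H x] increment_bound(1) increment_bound(3)[OF h] increment_bound(2)[OF h y]]
  show ?thesis1 by (rule E(1))
  show ?thesis2 by (rule E(2))
qed

lemma normalized_field_covariance:
  assumes H: "H \<in> {0<..<H0}" and h: "h \<in> {0<..<H0}" and x: "x \<in> D" and y: "y \<in> D"
  shows "integrable (\<mu> x \<Otimes>\<^sub>M \<mu> y) (\<lambda>(u, w). \<phi> H h (x - y) - \<phi> H h (x - w) - \<phi> H h (u - y) + \<phi> H h (u - w))"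
    and "expectation (\<lambda>\<omega>. X H x \<omega> * X h y \<omega>) = (G H * k H) * (G h * k h) *
      (\<integral>(u, w). \<phi> H h (x - y) - \<phi> H h (x - w) - \<phi> H h (u - y) + \<phi> H h (u - w) \<partial>(\<mu> x \<Otimes>\<^sub>M \<mu> y))"
proof -
  define E where "E = (\<lambda>(u, w). \<phi> H h (x - y) - \<phi> H h (x - w) - \<phi> H h (u - y) + \<phi> H h (u - w))"
  have cov: "(\<lambda>(u, w). expectation (\<lambda>\<omega>. (B H x \<omega> - B H u \<omega>) * (B h y \<omega> - B h w \<omega>))) = (\<lambda>z. k H * k h * E z)"
    by (simp add: increment_covariance[OF H h] E_def fun_eq_iff)
  note F = increment_product_expectation[OF assms, unfolded cov]
  have "k H * k h \<noteq> 0" using k_pos[OF H] k_pos[OF h] by simp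
  then show "integrable (\<mu> x \<Otimes>\<^sub>M \<mu> y) (\<lambda>(u, w). \<phi> H h (x - y) - \<phi> H h (x - w) - \<phi> H h (u - y) + \<phi> H h (u - w))"
    using F(1) integrable_mult_left_iff[of "\<mu> x \<Otimes>\<^sub>M \<mu> y" "k H * k h" E] unfolding E_def[symmetric] by blast
  have "expectation (\<lambda>\<omega>. X H x \<omega> * X h y \<omega>) =
      expectation (\<lambda>\<omega>. (G H * G h) * ((\<integral>u. B H x \<omega> - B H u \<omega> \<partial>\<mu> x) * (\<integral>v. B h y \<omega> - B h v \<omega> \<partial>\<mu> y)))"
  proof (rule integral_cong_AE)
    note sf = prob_space_imp_sigma_finite[OF prob_space_\<mu>]
    show "(\<lambda>\<omega>. X H x \<omega> * X h y \<omega>) \<in> borel_measurable M"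
      using normalized_field_measurable H h by simp
    show "(\<lambda>\<omega>. (G H * G h) * ((\<integral>u. B H x \<omega> - B H u \<omega> \<partial>\<mu> x) * (\<integral>v. B h y \<omega> - B h v \<omega> \<partial>\<mu> y))) \<in> borel_measurable M"
      by (intro borel_measurable_times borel_measurable_const sigma_finite_measure.borel_measurable_lebesgue_integral[OF sf]
          increment_jointly_measurable H h x y)
    show "AE \<omega> in M. X H x \<omega> * X h y \<omega> = (G H * G h) * ((\<integral>u. B H x \<omega> - B H u \<omega> \<partial>\<mu> x) * (\<integral>v. B h y \<omega> - B h v \<omega> \<partial>\<mu> y))"
      using normalized_field_increment[OF H x] normalized_field_increment[OF h y]
      by eventually_elim simp
  qed
  also have "\<dots> = (G H * G h) * (k H * k h * (\<integral>z. E z \<partial>(\<mu> x \<Otimes>\<^sub>M \<mu> y)))"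
    unfolding integral_mult_right_zero F(2) ..
  finally show "expectation (\<lambda>\<omega>. X H x \<omega> * X h y \<omega>) = (G H * k H) * (G h * k h) *
      (\<integral>(u, w). \<phi> H h (x - y) - \<phi> H h (x - w) - \<phi> H h (u - y) + \<phi> H h (u - w) \<partial>(\<mu> x \<Otimes>\<^sub>M \<mu> y))"
    unfolding E_def[symmetric] by (simp only: mult_ac)
qed

subsection \<open>Logarithmic asymptotics of the covariance\<close>

text \<open>One predicate for the three random distances in the covariance. The integrand is the
  majorant of \<open>powr_quotient_minus_ln_le\<close> at \<open>q = H0\<close>, and
  \<open>A\<close> is to be independent of \<open>x\<close> and \<open>y\<close>.\<close>

definition tame :: "real \<Rightarrow> 'a \<Rightarrow> 'a \<Rightarrow> ('a \<times> 'a \<Rightarrow> real) \<Rightarrow> bool" where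
  "tame A x y r \<longleftrightarrow> r \<in> borel_measurable (\<mu> x \<Otimes>\<^sub>M \<mu> y) \<and> (\<forall>z. 0 \<le> r z) \<and> (AE z in \<mu> x \<Otimes>\<^sub>M \<mu> y. 0 < r z) \<and>
    (\<integral>\<^sup>+ z. ennreal ((ln_minus (r z))\<^sup>2 + r z powr (2 * H0)) \<partial>(\<mu> x \<Otimes>\<^sub>M \<mu> y)) \<le> ennreal A"

abbreviation "dist1 \<equiv> \<lambda>x y (u :: 'a, w :: 'a). norm (x - w)"
abbreviation "dist2 \<equiv> \<lambda>x y (u :: 'a, w :: 'a). norm (u - y)"
abbreviation "dist3 \<equiv> \<lambda>x y (u :: 'a, w :: 'a). norm (u - w)"

lemma domain_powr_bound:
  obtains R where "0 \<le> R" "\<And>x. x \<in> D \<Longrightarrow> norm x powr (2 * H0) \<le> R"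
proof -
  obtain a where a: "\<And>x. x \<in> D \<Longrightarrow> norm x \<le> a"
    using domain by (auto simp: bounded_domain_def bounded_iff)
  show ?thesis
    by (rule that[of "\<bar>a\<bar> powr (2 * H0)"]) (use a H0 in \<open>force intro!: powr_mono2 order_trans[OF _ abs_ge_self]\<close>)+
qed

text \<open>The logarithmic singularities of \<open>dist1\<close> and \<open>dist2\<close> lie at a
  point of \<open>D\<close> other than the base point of the kernel in question and are controlled
  by the bound uniform in two points; that of \<open>dist3\<close> is controlled by the double
  integral. The powers are handled by the moment of order \<open>2 * H0\<close> and boundedness of
  \<open>D\<close>.\<close>

lemma tame_distances:
  obtains A where "0 \<le> A" "\<And>x y. x \<in> D \<Longrightarrow> y \<in> D \<Longrightarrow> tame A x y (dist1 x y)"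
    "\<And>x y. x \<in> D \<Longrightarrow> y \<in> D \<Longrightarrow> tame A x y (dist2 x y)" "\<And>x y. x \<in> D \<Longrightarrow> y \<in> D \<Longrightarrow> tame A x y (dist3 x y)"
    "\<And>x y. x \<in> D \<Longrightarrow> y \<in> D \<Longrightarrow> norm (x - y) powr (2 * H0) \<le> A"
proof -
  obtain A where A: "0 \<le> A"
    "\<And>y. y \<in> D \<Longrightarrow> (\<integral>\<^sup>+ u. ennreal (norm u powr (2 * H0)) \<partial>\<mu> y) \<le> ennreal A"
    "\<And>y w. y \<in> D \<Longrightarrow> w \<in> D \<Longrightarrow> (\<integral>\<^sup>+ u. ennreal ((ln_minus (norm (u - w)))\<^sup>2) \<partial>\<mu> y) \<le> ennreal A"
    "\<And>y w. y \<in> D \<Longrightarrow> w \<in> D \<Longrightarrow> (\<integral>\<^sup>+ v. \<integral>\<^sup>+ u. ennreal ((ln_minus (norm (u - v)))\<^sup>2) \<partial>\<mu> y \<partial>\<mu> w) \<le> ennreal A"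
    using kernel_bounds by blast
  obtain R where R: "0 \<le> R" "\<And>x. x \<in> D \<Longrightarrow> norm x powr (2 * H0) \<le> R" using domain_powr_bound by blast
  have lnm [measurable]: "ln_minus \<in> borel_measurable borel" unfolding ln_minus_def[abs_def] by measurable
  have d: "norm (a - b) powr (2 * H0) \<le> 2 * norm a powr (2 * H0) + 2 * norm b powr (2 * H0)" for a b :: 'a
    using norm_diff_powr_le[of "2 * H0" a b] H0 by simp
  \<comment> \<open>The logarithm contributes \<open>A\<close>, the two moments \<open>2 * A\<close>
    each; \<open>2 * R\<close> suffices for a random distance, while
    \<open>norm (x - y) powr (2 * H0)\<close> takes \<open>4 * R\<close>.\<close>
  let ?A = "4 * R + 5 * A"
  have tame: "tame ?A x y r"
    if x: "x \<in> D" and y: "y \<in> D"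
      and r: "r \<in> borel_measurable (borel \<Otimes>\<^sub>M borel)" "\<And>z. 0 \<le> r z" "AE z in \<mu> x \<Otimes>\<^sub>M \<mu> y. 0 < r z"
      and l: "(\<integral>\<^sup>+ z. ennreal ((ln_minus (r z))\<^sup>2) \<partial>(\<mu> x \<Otimes>\<^sub>M \<mu> y)) \<le> ennreal A"
      and rd: "\<And>u w. r (u, w) powr (2 * H0) \<le> 2 * R + 2 * norm u powr (2 * H0) + 2 * norm w powr (2 * H0)"
    for x y r
  proof -
    interpret \<mu>x: prob_space "\<mu> x" using x by (rule prob_space_\<mu>)
    interpret \<mu>y: prob_space "\<mu> y" using y by (rule prob_space_\<mu>)
    have rm [measurable]: "r \<in> borel_measurable (\<mu> x \<Otimes>\<^sub>M \<mu> y)"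
      using r(1) by (simp cong: measurable_cong_sets sets_pair_measure_cong)
    let ?P = "\<mu> x \<Otimes>\<^sub>M \<mu> y"
    let ?N = "\<lambda>u :: 'a. ennreal (norm u powr (2 * H0))"
    have fst: "(\<integral>\<^sup>+ z. ?N (fst z) \<partial>?P) = (\<integral>\<^sup>+ u. ?N u \<partial>\<mu> x)"
      by (subst \<mu>y.nn_integral_fst[symmetric]) (simp_all add: \<mu>y.emeasure_space_1[simplified])
    have snd: "(\<integral>\<^sup>+ z. ?N (snd z) \<partial>?P) = (\<integral>\<^sup>+ u. ?N u \<partial>\<mu> y)"
      by (subst \<mu>y.nn_integral_fst[symmetric]) (simp_all add: \<mu>x.emeasure_space_1[simplified])
    have one: "(\<integral>\<^sup>+ z. ennreal (2 * R) \<partial>?P) = ennreal (2 * R)"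
      by (subst \<mu>y.nn_integral_fst[symmetric]) (simp_all add: \<mu>x.emeasure_space_1[simplified] \<mu>y.emeasure_space_1[simplified])
    have "(\<integral>\<^sup>+ z. ennreal ((ln_minus (r z))\<^sup>2 + r z powr (2 * H0)) \<partial>?P) \<le>
        (\<integral>\<^sup>+ z. ennreal ((ln_minus (r z))\<^sup>2) + (ennreal (2 * R) + (ennreal 2 * ?N (fst z) + ennreal 2 * ?N (snd z))) \<partial>?P)"
    proof (rule nn_integral_mono)
      fix z
      have "(ln_minus (r z))\<^sup>2 + r z powr (2 * H0) \<le> (ln_minus (r z))\<^sup>2 + (2 * R + (2 * norm (fst z) powr (2 * H0) + 2 * norm (snd z) powr (2 * H0)))"
        using rd[of "fst z" "snd z"] by simp
      then show "ennreal ((ln_minus (r z))\<^sup>2 + r z powr (2 * H0)) \<le> ennreal ((ln_minus (r z))\<^sup>2) + (ennreal (2 * R) + (ennreal 2 * ?N (fst z) + ennreal 2 * ?N (snd z)))"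
        using \<open>0 \<le> R\<close> by (simp add: ennreal_mult[symmetric] ennreal_plus[symmetric] ennreal_leI del: ennreal_plus ennreal_numeral)
    qed
    also have "\<dots> = (\<integral>\<^sup>+ z. ennreal ((ln_minus (r z))\<^sup>2) \<partial>?P) + ((\<integral>\<^sup>+ z. ennreal (2 * R) \<partial>?P) + (ennreal 2 * (\<integral>\<^sup>+ z. ?N (fst z) \<partial>?P) + ennreal 2 * (\<integral>\<^sup>+ z. ?N (snd z) \<partial>?P)))"
      by (simp add: nn_integral_add nn_integral_cmult)
    also have "\<dots> \<le> ennreal A + (ennreal (2 * R) + (ennreal 2 * ennreal A + ennreal 2 * ennreal A))"
      unfolding fst snd one by (intro add_mono mult_left_mono l A(2) x y order_refl) auto
    also have "\<dots> = ennreal (A + (2 * R + (2 * A + 2 * A)))"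
      using \<open>0 \<le> A\<close> \<open>0 \<le> R\<close> by (simp add: ennreal_mult[symmetric] ennreal_plus[symmetric] del: ennreal_plus ennreal_numeral)
    also have "\<dots> \<le> ennreal ?A" using \<open>0 \<le> R\<close> by (intro ennreal_leI) simp
    finally show ?thesis using r rm by (simp add: tame_def)
  qed
  show ?thesis
  proof (rule that[of ?A])
    show "0 \<le> ?A" using A(1) R(1) by simp
    fix x y assume x: "x \<in> D" and y: "y \<in> D"
    interpret \<mu>x: prob_space "\<mu> x" using x by (rule prob_space_\<mu>)
    interpret \<mu>y: prob_space "\<mu> y" using y by (rule prob_space_\<mu>)
    interpret P: pair_sigma_finite "\<mu> x" "\<mu> y" ..
    show "norm (x - y) powr (2 * H0) \<le> ?A" using d[of x y] R(2)[OF x] R(2)[OF y] A(1) by simp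
    \<comment> \<open>The kernel measures have densities, so coincidence with a given point is a
      null event and the distances are almost everywhere positive.\<close>
    have ne: "AE w in \<mu> y. w \<noteq> a" "AE u in \<mu> x. u \<noteq> a" for a
      by (simp_all add: AE_iff_measurable[OF _ refl])
    show "tame ?A x y (dist1 x y)"
    proof (rule tame[OF x y])
      show "dist1 x y \<in> borel_measurable (borel \<Otimes>\<^sub>M borel)" by measurable
      show "AE z in \<mu> x \<Otimes>\<^sub>M \<mu> y. 0 < dist1 x y z"
      proof (rule P.AE_pair_measure)
        show "{z \<in> space (\<mu> x \<Otimes>\<^sub>M \<mu> y). 0 < dist1 x y z} \<in> sets (\<mu> x \<Otimes>\<^sub>M \<mu> y)" by measurable
        show "AE u in \<mu> x. AE w in \<mu> y. 0 < dist1 x y (u, w)" using ne(1)[of x] by auto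
      qed
      have "(\<integral>\<^sup>+ z. ennreal ((ln_minus (dist1 x y z))\<^sup>2) \<partial>(\<mu> x \<Otimes>\<^sub>M \<mu> y)) = (\<integral>\<^sup>+ w. ennreal ((ln_minus (norm (w - x)))\<^sup>2) \<partial>\<mu> y)"
        by (subst \<mu>y.nn_integral_fst[symmetric]) (simp_all add: \<mu>x.emeasure_space_1[simplified] norm_minus_commute case_prod_beta')
      then show "(\<integral>\<^sup>+ z. ennreal ((ln_minus (dist1 x y z))\<^sup>2) \<partial>(\<mu> x \<Otimes>\<^sub>M \<mu> y)) \<le> ennreal A"
        using A(3)[OF y x] by simp
      show "dist1 x y (u, w) powr (2 * H0) \<le> 2 * R + 2 * norm u powr (2 * H0) + 2 * norm w powr (2 * H0)" for u w
        using d[of x w] R(2)[OF x] by simp (smt (verit) powr_ge_zero)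
    qed auto
    show "tame ?A x y (dist2 x y)"
    proof (rule tame[OF x y])
      show "dist2 x y \<in> borel_measurable (borel \<Otimes>\<^sub>M borel)" by measurable
      show "AE z in \<mu> x \<Otimes>\<^sub>M \<mu> y. 0 < dist2 x y z"
      proof (rule P.AE_pair_measure)
        show "{z \<in> space (\<mu> x \<Otimes>\<^sub>M \<mu> y). 0 < dist2 x y z} \<in> sets (\<mu> x \<Otimes>\<^sub>M \<mu> y)" by measurable
        show "AE u in \<mu> x. AE w in \<mu> y. 0 < dist2 x y (u, w)" using ne(2)[of y] by auto
      qed
      have "(\<integral>\<^sup>+ z. ennreal ((ln_minus (dist2 x y z))\<^sup>2) \<partial>(\<mu> x \<Otimes>\<^sub>M \<mu> y)) = (\<integral>\<^sup>+ u. ennreal ((ln_minus (norm (u - y)))\<^sup>2) \<partial>\<mu> x)"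
        by (subst \<mu>y.nn_integral_fst[symmetric]) (simp_all add: \<mu>y.emeasure_space_1[simplified] case_prod_beta')
      then show "(\<integral>\<^sup>+ z. ennreal ((ln_minus (dist2 x y z))\<^sup>2) \<partial>(\<mu> x \<Otimes>\<^sub>M \<mu> y)) \<le> ennreal A"
        using A(3)[OF x y] by simp
      show "dist2 x y (u, w) powr (2 * H0) \<le> 2 * R + 2 * norm u powr (2 * H0) + 2 * norm w powr (2 * H0)" for u w
        using d[of u y] R(2)[OF y] by simp (smt (verit) powr_ge_zero)
    qed auto
    show "tame ?A x y (dist3 x y)"
    proof (rule tame[OF x y])
      show "dist3 x y \<in> borel_measurable (borel \<Otimes>\<^sub>M borel)" by measurable
      show "AE z in \<mu> x \<Otimes>\<^sub>M \<mu> y. 0 < dist3 x y z"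
      proof (rule P.AE_pair_measure)
        show "{z \<in> space (\<mu> x \<Otimes>\<^sub>M \<mu> y). 0 < dist3 x y z} \<in> sets (\<mu> x \<Otimes>\<^sub>M \<mu> y)" by measurable
        show "AE u in \<mu> x. AE w in \<mu> y. 0 < dist3 x y (u, w)"
        proof (rule AE_I2)
          fix u
          show "AE w in \<mu> y. 0 < dist3 x y (u, w)" using ne(1)[of u] by eventually_elim auto
        qed
      qed
      have "(\<integral>\<^sup>+ z. ennreal ((ln_minus (dist3 x y z))\<^sup>2) \<partial>(\<mu> x \<Otimes>\<^sub>M \<mu> y)) = (\<integral>\<^sup>+ w. \<integral>\<^sup>+ u. ennreal ((ln_minus (norm (u - w)))\<^sup>2) \<partial>\<mu> x \<partial>\<mu> y)"
        by (subst P.nn_integral_snd[symmetric]) (simp_all add: case_prod_beta')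
      then show "(\<integral>\<^sup>+ z. ennreal ((ln_minus (dist3 x y z))\<^sup>2) \<partial>(\<mu> x \<Otimes>\<^sub>M \<mu> y)) \<le> ennreal A"
        using A(4)[OF x y] by simp
      show "dist3 x y (u, w) powr (2 * H0) \<le> 2 * R + 2 * norm u powr (2 * H0) + 2 * norm w powr (2 * H0)" for u w
        using d[of u w] R(1) by simp
    qed auto
  qed
qed

definition covariance_integral :: "real \<Rightarrow> real \<Rightarrow> 'a \<Rightarrow> 'a \<Rightarrow> real" where
  "covariance_integral H h x y =
     (\<integral>(u, w). \<phi> H h (x - y) - \<phi> H h (x - w) - \<phi> H h (u - y) + \<phi> H h (u - w) \<partial>(\<mu> x \<Otimes>\<^sub>M \<mu> y))"

text \<open>The factor \<open>c H h * (H + h)\<close> itself is split off, not its limit. With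
  \<open>g\<close> defined below as the remainder, the covariance formula holds exactly, and all
  analysis goes into the convergence of \<open>const\<close> and \<open>g\<close>.\<close>

definition const :: "real \<Rightarrow> real \<Rightarrow> real" where
  "const H h = (G H * k H) * (G h * k h) * (c H h * (H + h))"

definition g :: "real \<Rightarrow> real \<Rightarrow> 'a \<Rightarrow> 'a \<Rightarrow> real" where
  "g H h x y = covariance_integral H h x y / (c H h * (H + h)) - (1 - norm (x - y) powr (H + h)) / (H + h)"

text \<open>The limit of (R1 + R2 - R3 - 1)/p, where R1, R2, R3 are the averaged p-th powers of the
  three distances. The power of \<open>norm (x - y)\<close> has cancelled exactly, so
  \<open>g0\<close> stays bounded on the diagonal.\<close>

definition g0 :: "'a \<Rightarrow> 'a \<Rightarrow> real" where
  "g0 x y = (\<integral>z. ln (dist1 x y z) \<partial>(\<mu> x \<Otimes>\<^sub>M \<mu> y)) + (\<integral>z. ln (dist2 x y z) \<partial>(\<mu> x \<Otimes>\<^sub>M \<mu> y))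
     - (\<integral>z. ln (dist3 x y z) \<partial>(\<mu> x \<Otimes>\<^sub>M \<mu> y))"

lemma c_pos': "H \<in> {0<..<H0} \<Longrightarrow> h \<in> {0<..<H0} \<Longrightarrow> 0 < c H h"
  using H0 by (intro c_pos) auto

lemma const_pos: "H \<in> {0<..<H0} \<Longrightarrow> h \<in> {0<..<H0} \<Longrightarrow> 0 < const H h"
proof -
  assume H: "H \<in> {0<..<H0}" and h: "h \<in> {0<..<H0}"
  have "0 < G h" if "h \<in> {0<..<H0}" for h
  proof -
    have "0 < Gamma h" using that by (intro Gamma_real_pos) auto
    then show ?thesis unfolding powr_gt_zero by (rule less_imp_neq[symmetric])
  qed
  then show ?thesis
    unfolding const_def using c_pos'[OF H h] k_pos[OF H] k_pos[OF h] H h by (intro mult_pos_pos) auto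
qed

lemma covariance_formula:
  assumes "H \<in> {0<..<H0}" "h \<in> {0<..<H0}" "x \<in> D" "y \<in> D"
  shows "expectation (\<lambda>\<omega>. X H x \<omega> * X h y \<omega>) = const H h * ((1 - norm (x - y) powr (H + h)) / (H + h) + g H h x y)"
proof -
  have "c H h * (H + h) \<noteq> 0" using c_pos'[OF assms(1,2)] assms by auto
  then show ?thesis
    unfolding normalized_field_covariance(2)[OF assms] covariance_integral_def[symmetric] const_def g_def by simp
qed

lemma phi_close_to_power:
  assumes "\<And>z. norm z = 1 \<Longrightarrow> \<bar>\<phi> H h z + c H h\<bar> \<le> d"
  shows "\<bar>\<phi> H h z + c H h * norm z powr (H + h)\<bar> \<le> d * norm z powr (H + h)"
proof (cases "z = 0")
  case False
  let ?z = "z /\<^sub>R norm z"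
  have "\<phi> H h z + c H h * norm z powr (H + h) = (\<phi> H h ?z + c H h) * norm z powr (H + h)"
    using phi_homogeneous[OF False, of H h] by (simp add: algebra_simps)
  then have "\<bar>\<phi> H h z + c H h * norm z powr (H + h)\<bar> = \<bar>\<phi> H h ?z + c H h\<bar> * norm z powr (H + h)"
    by (simp add: abs_mult)
  also have "\<dots> \<le> d * norm z powr (H + h)"
    using False by (intro mult_right_mono assms) auto
  finally show ?thesis .
qed simp

lemma tame_estimates:
  assumes "tame A x y r" "0 \<le> A" "x \<in> D" "y \<in> D"
  shows "integrable (\<mu> x \<Otimes>\<^sub>M \<mu> y) (\<lambda>z. ln (r z))" "\<bar>\<integral>z. ln (r z) \<partial>(\<mu> x \<Otimes>\<^sub>M \<mu> y)\<bar> \<le> 1 + (1 + 1 / H0) * A"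
    and "\<And>p. 0 < p \<Longrightarrow> p \<le> 2 * H0 \<Longrightarrow> integrable (\<mu> x \<Otimes>\<^sub>M \<mu> y) (\<lambda>z. r z powr p)"
    and "\<And>p. 0 < p \<Longrightarrow> p \<le> 2 * H0 \<Longrightarrow> (\<integral>z. r z powr p \<partial>(\<mu> x \<Otimes>\<^sub>M \<mu> y)) \<le> 1 + A"
    and "\<And>p. 0 < p \<Longrightarrow> p \<le> H0 \<Longrightarrow>
      \<bar>((\<integral>z. r z powr p \<partial>(\<mu> x \<Otimes>\<^sub>M \<mu> y)) - 1) / p - (\<integral>z. ln (r z) \<partial>(\<mu> x \<Otimes>\<^sub>M \<mu> y))\<bar> \<le> p * (1 + 4 / H0\<^sup>2) * A"
proof -
  interpret \<mu>x: prob_space "\<mu> x" using assms(3) by (rule prob_space_\<mu>)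
  interpret \<mu>y: prob_space "\<mu> y" using assms(4) by (rule prob_space_\<mu>)
  interpret P: pair_prob_space "\<mu> x" "\<mu> y" ..
  note t = assms(1)[unfolded tame_def]
  have t: "r \<in> borel_measurable (\<mu> x \<Otimes>\<^sub>M \<mu> y)" "0 \<le> r z" "AE z in \<mu> x \<Otimes>\<^sub>M \<mu> y. 0 < r z"
    "(\<integral>\<^sup>+ z. ennreal ((ln_minus (r z))\<^sup>2 + r z powr (2 * H0)) \<partial>(\<mu> x \<Otimes>\<^sub>M \<mu> y)) \<le> ennreal A" for z
    by (rule t[THEN conjunct1], rule t[THEN conjunct2, THEN conjunct1, rule_format],
        rule t[THEN conjunct2, THEN conjunct2, THEN conjunct1], rule t[THEN conjunct2, THEN conjunct2, THEN conjunct2])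
  note E = P.log_moment_estimates[OF t assms(2) H0(1)]
  show "integrable (\<mu> x \<Otimes>\<^sub>M \<mu> y) (\<lambda>z. ln (r z))" "\<bar>\<integral>z. ln (r z) \<partial>(\<mu> x \<Otimes>\<^sub>M \<mu> y)\<bar> \<le> 1 + (1 + 1 / H0) * A"
    by (rule E)+
  show "integrable (\<mu> x \<Otimes>\<^sub>M \<mu> y) (\<lambda>z. r z powr p)" "(\<integral>z. r z powr p \<partial>(\<mu> x \<Otimes>\<^sub>M \<mu> y)) \<le> 1 + A"
    if "0 < p" "p \<le> 2 * H0" for p
    by (rule E(3)[OF that], rule E(4)[OF that])
  show "\<bar>((\<integral>z. r z powr p \<partial>(\<mu> x \<Otimes>\<^sub>M \<mu> y)) - 1) / p - (\<integral>z. ln (r z) \<partial>(\<mu> x \<Otimes>\<^sub>M \<mu> y))\<bar> \<le> p * (1 + 4 / H0\<^sup>2) * A"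
    if "0 < p" "p \<le> H0" for p
    by (rule E(5)[OF that])
qed

text \<open>Each of the four values of \<open>\<phi>\<close> is replaced by \<open>- c H h\<close>
  times a power of the norm. By homogeneity the error is at most \<open>d\<close> times the same
  power, and averaging keeps this form.\<close>

lemma covariance_integral_approx:
  assumes H: "H \<in> {0<..<H0}" and h: "h \<in> {0<..<H0}" and x: "x \<in> D" and y: "y \<in> D"
    and A: "0 \<le> A" "tame A x y (dist1 x y)" "tame A x y (dist2 x y)" "tame A x y (dist3 x y)"
    and d: "\<And>z. norm z = 1 \<Longrightarrow> \<bar>\<phi> H h z + c H h\<bar> \<le> d"
  defines "R r \<equiv> \<integral>z. r z powr (H + h) \<partial>(\<mu> x \<Otimes>\<^sub>M \<mu> y)"
  shows "\<bar>covariance_integral H h x y - c H h * (R (dist1 x y) + R (dist2 x y) - R (dist3 x y) - norm (x - y) powr (H + h))\<bar>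
    \<le> d * (norm (x - y) powr (H + h) + R (dist1 x y) + R (dist2 x y) + R (dist3 x y))"
proof -
  interpret \<mu>x: prob_space "\<mu> x" using x by (rule prob_space_\<mu>)
  interpret \<mu>y: prob_space "\<mu> y" using y by (rule prob_space_\<mu>)
  interpret P: pair_prob_space "\<mu> x" "\<mu> y" ..
  let ?P = "\<mu> x \<Otimes>\<^sub>M \<mu> y"
  let ?p = "H + h"
  have p: "0 < ?p" "?p \<le> 2 * H0" using H h by auto
  define N where "N = norm (x - y) powr ?p"
  define q1 q2 q3 where "q1 z = dist1 x y z powr ?p" and "q2 z = dist2 x y z powr ?p" and "q3 z = dist3 x y z powr ?p" for z
  have i: "integrable ?P q1" "integrable ?P q2" "integrable ?P q3"
    unfolding q1_def q2_def q3_def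
    by (rule tame_estimates(3)[OF A(2,1) x y p], rule tame_estimates(3)[OF A(3,1) x y p], rule tame_estimates(3)[OF A(4,1) x y p])
  define E where "E = (\<lambda>(u, w). \<phi> H h (x - y) - \<phi> H h (x - w) - \<phi> H h (u - y) + \<phi> H h (u - w))"
  define F where "F z = c H h * (q1 z + q2 z - q3 z - N)" for z
  have Ei: "integrable ?P E" unfolding E_def by (rule normalized_field_covariance(1)[OF H h x y])
  have q123: "integrable ?P (\<lambda>z. q1 z + q2 z - q3 z - N)"
    by (intro Bochner_Integration.integrable_diff Bochner_Integration.integrable_add i P.integrable_const)
  then have Fi: "integrable ?P F" unfolding F_def by (rule integrable_mult_right)
  have "(\<integral>z. q1 z + q2 z - q3 z - N \<partial>?P) = (\<integral>z. q1 z \<partial>?P) + (\<integral>z. q2 z \<partial>?P) - (\<integral>z. q3 z \<partial>?P) - N"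
    by (simp only: i Bochner_Integration.integral_diff Bochner_Integration.integral_add Bochner_Integration.integrable_add
        Bochner_Integration.integrable_diff P.integrable_const lebesgue_integral_const P.prob_space scaleR_one)
  then have F: "(\<integral>z. F z \<partial>?P) = c H h * ((\<integral>z. q1 z \<partial>?P) + (\<integral>z. q2 z \<partial>?P) - (\<integral>z. q3 z \<partial>?P) - N)"
    unfolding F_def by (simp only: integral_mult_right_zero)
  have "\<bar>(\<integral>z. E z \<partial>?P) - (\<integral>z. F z \<partial>?P)\<bar> = \<bar>\<integral>z. E z - F z \<partial>?P\<bar>"
    by (simp only: Bochner_Integration.integral_diff[OF Ei Fi])
  also have "\<dots> \<le> (\<integral>z. d * (N + q1 z + q2 z + q3 z) \<partial>?P)"
  proof (rule integral_abs_bound_integral)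
    show "integrable ?P (\<lambda>z. E z - F z)" by (rule Bochner_Integration.integrable_diff[OF Ei Fi])
    show "integrable ?P (\<lambda>z. d * (N + q1 z + q2 z + q3 z))"
      by (intro integrable_mult_right Bochner_Integration.integrable_add i P.integrable_const)
    fix z :: "'a \<times> 'a"
    obtain u w where z: "z = (u, w)" by (cases z)
    let ?e = "\<lambda>a. \<phi> H h a + c H h * norm a powr ?p"
    have eq: "E z - F z = ?e (x - y) - ?e (x - w) - ?e (u - y) + ?e (u - w)"
    proof -
      have "a1 - a2 - a3 + a4 - e * (p2 + p3 - p4 - p1) = (a1 + e * p1) - (a2 + e * p2) - (a3 + e * p3) + (a4 + e * p4)"
        for a1 a2 a3 a4 e p1 p2 p3 p4 :: real by (simp add: algebra_simps)
      then show ?thesis unfolding z E_def F_def q1_def q2_def q3_def N_def prod.case .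
    qed
    have "\<bar>E z - F z\<bar> \<le> \<bar>?e (x - y)\<bar> + \<bar>?e (x - w)\<bar> + \<bar>?e (u - y)\<bar> + \<bar>?e (u - w)\<bar>"
      unfolding eq by (rule order_trans[OF abs_triangle_ineq add_right_mono[OF order_trans[OF abs_triangle_ineq4 add_right_mono[OF abs_triangle_ineq4]]]])
    also have "\<dots> \<le> d * N + d * q1 z + d * q2 z + d * q3 z"
      unfolding z N_def q1_def q2_def q3_def prod.case by (intro add_mono phi_close_to_power d)
    finally show "\<bar>E z - F z\<bar> \<le> d * (N + q1 z + q2 z + q3 z)" by (simp add: algebra_simps)
  qed
  also have "\<dots> = d * (N + (\<integral>z. q1 z \<partial>?P) + (\<integral>z. q2 z \<partial>?P) + (\<integral>z. q3 z \<partial>?P))"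
  proof -
    have "(\<integral>z. N + q1 z + q2 z + q3 z \<partial>?P) = N + (\<integral>z. q1 z \<partial>?P) + (\<integral>z. q2 z \<partial>?P) + (\<integral>z. q3 z \<partial>?P)"
      by (simp only: i Bochner_Integration.integral_add Bochner_Integration.integrable_add
        P.integrable_const lebesgue_integral_const P.prob_space scaleR_one)
    then show ?thesis by (simp only: integral_mult_right_zero)
  qed
  finally show ?thesis
    unfolding F R_def q1_def q2_def q3_def N_def E_def covariance_integral_def .
qed

text \<open>The first bound only serves boundedness of \<open>g\<close> at fixed parameters and may
  grow as they tend to 0. The second is uniform on \<open>D\<close> and vanishes in the limit; it
  asks for \<open>H + h \<le> H0\<close> because the logarithmic estimate is used with
  \<open>q = H0\<close>.\<close>

lemma g_estimates:
  obtains A \<Delta> where "((\<lambda>(H, h). \<Delta> H h) \<longlongrightarrow> 0) (at (0, 0) within {0<..<H0} \<times> {0<..<H0})"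
    "\<And>H h x y. H \<in> {0<..<H0} \<Longrightarrow> h \<in> {0<..<H0} \<Longrightarrow> x \<in> D \<Longrightarrow> y \<in> D \<Longrightarrow>
       \<bar>g H h x y\<bar> \<le> (4 + 3 * A) / (H + h) + \<Delta> H h * (4 * (1 + A)) / (c H h * (H + h))"
    "\<And>H h x y. H \<in> {0<..<H0} \<Longrightarrow> h \<in> {0<..<H0} \<Longrightarrow> x \<in> D \<Longrightarrow> y \<in> D \<Longrightarrow> H + h \<le> H0 \<Longrightarrow>
       \<bar>g H h x y - g0 x y\<bar> \<le> 3 * ((H + h) * (1 + 4 / H0\<^sup>2) * A) + \<Delta> H h * (4 * (1 + A)) / (c H h * (H + h))"
    "\<And>x y. x \<in> D \<Longrightarrow> y \<in> D \<Longrightarrow> \<bar>g0 x y\<bar> \<le> 3 * (1 + (1 + 1 / H0) * A)"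
proof -
  obtain \<Delta> where \<Delta>: "((\<lambda>(H, h). \<Delta> H h) \<longlongrightarrow> 0) (at (0, 0) within {0<..<H0} \<times> {0<..<H0})"
    "\<And>H h z. H \<in> {0<..<H0} \<Longrightarrow> h \<in> {0<..<H0} \<Longrightarrow> norm z = 1 \<Longrightarrow> \<bar>\<phi> H h z + c H h\<bar> \<le> \<Delta> H h"
    using asymptotically_radial[OF H0] by blast
  obtain A where A: "0 \<le> A" "\<And>x y. x \<in> D \<Longrightarrow> y \<in> D \<Longrightarrow> tame A x y (dist1 x y)"
    "\<And>x y. x \<in> D \<Longrightarrow> y \<in> D \<Longrightarrow> tame A x y (dist2 x y)" "\<And>x y. x \<in> D \<Longrightarrow> y \<in> D \<Longrightarrow> tame A x y (dist3 x y)"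
    "\<And>x y. x \<in> D \<Longrightarrow> y \<in> D \<Longrightarrow> norm (x - y) powr (2 * H0) \<le> A"
    by (rule tame_distances) blast
  have main: "\<bar>g H h x y\<bar> \<le> (4 + 3 * A) / (H + h) + \<Delta> H h * (4 * (1 + A)) / (c H h * (H + h)) \<and>
      (H + h \<le> H0 \<longrightarrow> \<bar>g H h x y - g0 x y\<bar> \<le> 3 * ((H + h) * (1 + 4 / H0\<^sup>2) * A) + \<Delta> H h * (4 * (1 + A)) / (c H h * (H + h)))"
    if H: "H \<in> {0<..<H0}" and h: "h \<in> {0<..<H0}" and x: "x \<in> D" and y: "y \<in> D" for H h x y
  proof -
    let ?P = "\<mu> x \<Otimes>\<^sub>M \<mu> y"
    let ?p = "H + h"
    let ?R = "\<lambda>r. \<integral>z. r z powr ?p \<partial>?P"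
    have p: "0 < ?p" "?p \<le> 2 * H0" using H h by auto
    note c = c_pos'[OF H h]
    have d0: "0 \<le> \<Delta> H h" using \<Delta>(2)[OF H h, of e0] by (auto intro: order_trans[OF abs_ge_zero])
    define N R1 R2 R3 where "N = norm (x - y) powr ?p" and "R1 = ?R (dist1 x y)" and "R2 = ?R (dist2 x y)" and "R3 = ?R (dist3 x y)"
    have N: "0 \<le> N" "N \<le> 1 + A"
      using powr_le_one_plus[OF norm_ge_zero p, of "x - y"] A(5)[OF x y] by (auto simp: N_def)
    have R: "0 \<le> R1" "R1 \<le> 1 + A" "0 \<le> R2" "R2 \<le> 1 + A" "0 \<le> R3" "R3 \<le> 1 + A"
      unfolding R1_def R2_def R3_def
      using tame_estimates(4)[OF A(2)[OF x y] A(1) x y p] tame_estimates(4)[OF A(3)[OF x y] A(1) x y p] tame_estimates(4)[OF A(4)[OF x y] A(1) x y p]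
      by (simp_all add: Bochner_Integration.integral_nonneg)
    \<comment> \<open>What \<open>g\<close> would be if \<open>\<phi>\<close> were exactly radial:
      \<open>N\<close> occurs both in the covariance and in the explicit term and drops out.\<close>
    let ?q = "(R1 + R2 - R3 - 1) / ?p"
    have "g H h x y - ?q = (covariance_integral H h x y - c H h * (R1 + R2 - R3 - N)) / (c H h * ?p)"
    proof -
      have div: "I / (a * b) - (1 - N) / b - (s - 1) / b = (I - a * (s - N)) / (a * b)" if "a \<noteq> 0" "b \<noteq> 0" for I a b s :: real
        using that by (simp add: field_simps)
      show ?thesis unfolding g_def N_def[symmetric] by (rule div) (use c p in auto)
    qed
    then have "\<bar>g H h x y - ?q\<bar> = \<bar>covariance_integral H h x y - c H h * (R1 + R2 - R3 - N)\<bar> / (c H h * ?p)"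
      using c p by simp
    also have "\<dots> \<le> (\<Delta> H h * (N + R1 + R2 + R3)) / (c H h * ?p)"
      unfolding N_def R1_def R2_def R3_def using c p
      by (intro divide_right_mono covariance_integral_approx[OF H h x y A(1) A(2)[OF x y] A(3)[OF x y] A(4)[OF x y] \<Delta>(2)[OF H h]]) auto
    \<comment> \<open>\<open>N\<close> and the three averages are at most \<open>1 + A\<close> each.
      The denominator has a positive limit, so the whole bound is of the order of
      \<open>\<Delta>\<close>.\<close>
    also have "\<dots> \<le> (\<Delta> H h * (4 * (1 + A))) / (c H h * ?p)"
      using c p d0 N R by (intro divide_right_mono mult_left_mono) auto
    finally have gq: "\<bar>g H h x y - ?q\<bar> \<le> \<Delta> H h * (4 * (1 + A)) / (c H h * ?p)" .
    have "\<bar>?q\<bar> = \<bar>R1 + R2 - R3 - 1\<bar> / ?p" using p by simp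
    \<comment> \<open>Three averages of size at most \<open>1 + A\<close>, and the constant
      1.\<close>
    also have "\<dots> \<le> (4 + 3 * A) / ?p" using p R A(1) by (intro divide_right_mono) auto
    finally have q: "\<bar>?q\<bar> \<le> (4 + 3 * A) / ?p" .
    have "\<bar>?q - g0 x y\<bar> \<le> 3 * (?p * (1 + 4 / H0\<^sup>2) * A)" if "?p \<le> H0"
    proof -
      have "?q - g0 x y = ((R1 - 1) / ?p - (\<integral>z. ln (dist1 x y z) \<partial>?P)) + ((R2 - 1) / ?p - (\<integral>z. ln (dist2 x y z) \<partial>?P))
          - ((R3 - 1) / ?p - (\<integral>z. ln (dist3 x y z) \<partial>?P))"
        by (simp add: g0_def diff_divide_distrib add_divide_distrib)
      moreover have "\<bar>(R1 - 1) / ?p - (\<integral>z. ln (dist1 x y z) \<partial>?P)\<bar> \<le> ?p * (1 + 4 / H0\<^sup>2) * A"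
        unfolding R1_def by (rule tame_estimates(5)[OF A(2)[OF x y] A(1) x y p(1) that])
      moreover have "\<bar>(R2 - 1) / ?p - (\<integral>z. ln (dist2 x y z) \<partial>?P)\<bar> \<le> ?p * (1 + 4 / H0\<^sup>2) * A"
        unfolding R2_def by (rule tame_estimates(5)[OF A(3)[OF x y] A(1) x y p(1) that])
      moreover have "\<bar>(R3 - 1) / ?p - (\<integral>z. ln (dist3 x y z) \<partial>?P)\<bar> \<le> ?p * (1 + 4 / H0\<^sup>2) * A"
        unfolding R3_def by (rule tame_estimates(5)[OF A(4)[OF x y] A(1) x y p(1) that])
      ultimately show ?thesis by linarith
    qed
    with gq q show ?thesis by linarith
  qed
  have "\<bar>g0 x y\<bar> \<le> 3 * (1 + (1 + 1 / H0) * A)" if x: "x \<in> D" and y: "y \<in> D" for x y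
  proof -
    have tri: "\<bar>a + b - d\<bar> \<le> 3 * L" if "\<bar>a\<bar> \<le> L" "\<bar>b\<bar> \<le> L" "\<bar>d\<bar> \<le> L" for a b d L :: real
      using that unfolding abs_le_iff by linarith
    show ?thesis unfolding g0_def
      by (rule tri; rule tame_estimates(2)[OF _ A(1) x y]; rule A(2)[OF x y] A(3)[OF x y] A(4)[OF x y])
  qed
  with main show ?thesis by (intro that[OF \<Delta>(1)]) auto
qed

section \<open>Passage to the limit\<close>

lemma const_tendsto: "((\<lambda>(H, h). const H h) \<longlongrightarrow> 1) (at (0, 0) within {0<..<H0} \<times> {0<..<H0})"
proof -
  let ?F = "at (0, 0) within {0<..<H0} \<times> {0<..<H0}"
  define \<sigma> where "\<sigma> = \<kappa> * real DIM('a)"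
  have \<sigma>: "0 < \<sigma>" using \<kappa>_pos by (simp add: \<sigma>_def)
  have ev: "\<forall>\<^sub>F z in ?F. 0 < fst z" "\<forall>\<^sub>F z in ?F. 0 < snd z"
    using eventually_at_0_within_square[of H0] by (eventually_elim, auto)+
  have f: "filterlim fst (at_right 0) ?F" "filterlim snd (at_right 0) ?F"
  proof -
    have t: "(fst \<longlongrightarrow> 0) ?F" "(snd \<longlongrightarrow> 0) ?F"
      using tendsto_fst_snd_at_0(1,2)[of "{0<..<H0} \<times> {0<..<H0}"] by (simp_all add: case_prod_beta')
    have "\<forall>\<^sub>F z in ?F. fst z \<in> {0<..} \<and> fst z \<noteq> 0" "\<forall>\<^sub>F z in ?F. snd z \<in> {0<..} \<and> snd z \<noteq> 0"
      using ev by (eventually_elim, simp)+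
    with t show "filterlim fst (at_right 0) ?F" "filterlim snd (at_right 0) ?F"
      unfolding filterlim_at by blast+
  qed
  have k1: "((\<lambda>z. G (fst z) * k (fst z)) \<longlongrightarrow> 1 / sqrt \<sigma>) ?F" "((\<lambda>z. G (snd z) * k (snd z)) \<longlongrightarrow> 1 / sqrt \<sigma>) ?F"
    using filterlim_compose[OF k_limit f(1)] filterlim_compose[OF k_limit f(2)] by (simp_all add: \<sigma>_def)
  have c1: "((\<lambda>z. c (fst z) (snd z) * (fst z + snd z)) \<longlongrightarrow> \<sigma>) ?F"
    using c_asymp[OF H0] by (simp add: case_prod_beta' \<sigma>_def mult.commute)
  have "((\<lambda>z. (G (fst z) * k (fst z)) * (G (snd z) * k (snd z)) * (c (fst z) (snd z) * (fst z + snd z))) \<longlongrightarrow> 1 / sqrt \<sigma> * (1 / sqrt \<sigma>) * \<sigma>) ?F"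
    by (intro tendsto_mult k1 c1)
  moreover have "1 / sqrt \<sigma> * (1 / sqrt \<sigma>) * \<sigma> = 1" using \<sigma> by simp
  ultimately show ?thesis by (simp add: const_def case_prod_beta')
qed

lemma const_sup_tendsto:
  "((\<lambda>Hbar. SUP (h, H)\<in>{0<..<Hbar} \<times> {0<..<Hbar}. ereal \<bar>const h H - 1\<bar>) \<longlongrightarrow> 0) (at_right 0)"
proof (rule order_tendstoI)
  fix a :: ereal assume a: "a < 0"
  show "\<forall>\<^sub>F Hbar in at_right 0. a < (SUP (h, H)\<in>{0<..<Hbar} \<times> {0<..<Hbar}. ereal \<bar>const h H - 1\<bar>)"
    using eventually_at_right_less[of "0::real"]
  proof eventually_elim
    case (elim Hbar)
    \<comment> \<open>The supremum over an empty set would be minus infinity in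
      \<open>ereal\<close>; the midpoint is a witness that it is nonnegative.\<close>
    have "a < ereal \<bar>const (Hbar/2) (Hbar/2) - 1\<bar>" using a by (rule less_le_trans) simp
    also have "\<dots> \<le> (SUP (h, H)\<in>{0<..<Hbar} \<times> {0<..<Hbar}. ereal \<bar>const h H - 1\<bar>)"
      using SUP_upper[of "(Hbar/2, Hbar/2)" "{0<..<Hbar} \<times> {0<..<Hbar}" "\<lambda>(h, H). ereal \<bar>const h H - 1\<bar>"] elim by simp
    finally show ?case .
  qed
next
  fix a :: ereal assume "0 < a"
  then obtain e where e: "0 < ereal e" "ereal e < a" using ereal_dense2 by blast
  have "\<forall>\<^sub>F z in at (0, 0) within {0<..<H0} \<times> {0<..<H0}. dist (case z of (H, h) \<Rightarrow> const H h) 1 < e"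
    using tendstoD[OF const_tendsto, of e] e by simp
  then obtain d where d: "0 < d" "\<And>z. z \<in> {0<..<H0} \<times> {0<..<H0} \<Longrightarrow> z \<noteq> (0, 0) \<Longrightarrow> dist z (0, 0) < d \<Longrightarrow>
      dist (case z of (H, h) \<Rightarrow> const H h) 1 < e"
    unfolding eventually_at by auto
  have "\<forall>\<^sub>F Hbar in at_right 0. 0 < Hbar \<and> Hbar < min H0 (d / 2)"
    using eventually_at_right_less[of "0::real"] order_tendstoD(2)[OF tendsto_ident_at, of 0 "min H0 (d / 2)" "{0<..}"] d(1) H0(1)
    by (auto elim: eventually_elim2)
  then show "\<forall>\<^sub>F Hbar in at_right 0. (SUP (h, H)\<in>{0<..<Hbar} \<times> {0<..<Hbar}. ereal \<bar>const h H - 1\<bar>) < a"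
  proof eventually_elim
    case (elim Hbar)
    have "(SUP (h, H)\<in>{0<..<Hbar} \<times> {0<..<Hbar}. ereal \<bar>const h H - 1\<bar>) \<le> ereal e"
    proof (rule SUP_least, clarify)
      fix h H :: real assume hH: "h \<in> {0<..<Hbar}" "H \<in> {0<..<Hbar}"
      \<comment> \<open>The distance to the origin is at most the sum of the coordinates, hence the
        bound \<open>d / 2\<close> on \<open>Hbar\<close>.\<close>
      have "dist (h, H) (0, 0) \<le> \<bar>h\<bar> + \<bar>H\<bar>"
        using sqrt_sum_squares_le_sum_abs[of h H] by (simp add: dist_Pair_Pair dist_real_def)
      also have "\<dots> < d" using hH elim by auto
      finally have "dist (case (h, H) of (H, h) \<Rightarrow> const H h) 1 < e" using hH elim by (intro d(2)) auto
      then show "ereal \<bar>const h H - 1\<bar> \<le> ereal e" by (simp add: dist_real_def)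
    qed
    then show ?case using e(2) by (rule le_less_trans)
  qed
qed

lemma approx_log_correlated: "approx_log_correlated M H0 D X"
proof -
  obtain A \<Delta> where \<Delta>: "((\<lambda>(H, h). \<Delta> H h) \<longlongrightarrow> 0) (at (0, 0) within {0<..<H0} \<times> {0<..<H0})"
    and g1: "\<And>H h x y. H \<in> {0<..<H0} \<Longrightarrow> h \<in> {0<..<H0} \<Longrightarrow> x \<in> D \<Longrightarrow> y \<in> D \<Longrightarrow>
       \<bar>g H h x y\<bar> \<le> (4 + 3 * A) / (H + h) + \<Delta> H h * (4 * (1 + A)) / (c H h * (H + h))"
    and g2: "\<And>H h x y. H \<in> {0<..<H0} \<Longrightarrow> h \<in> {0<..<H0} \<Longrightarrow> x \<in> D \<Longrightarrow> y \<in> D \<Longrightarrow> H + h \<le> H0 \<Longrightarrow>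
       \<bar>g H h x y - g0 x y\<bar> \<le> 3 * ((H + h) * (1 + 4 / H0\<^sup>2) * A) + \<Delta> H h * (4 * (1 + A)) / (c H h * (H + h))"
    and g3: "\<And>x y. x \<in> D \<Longrightarrow> y \<in> D \<Longrightarrow> \<bar>g0 x y\<bar> \<le> 3 * (1 + (1 + 1 / H0) * A)"
    by (rule g_estimates) blast
  let ?F = "at (0, 0) within {0<..<H0} \<times> {0<..<H0}"
  let ?b = "\<lambda>(H, h). 3 * ((H + h) * (1 + 4 / H0\<^sup>2) * A) + \<Delta> H h * (4 * (1 + A)) / (c H h * (H + h))"
  let ?s = "\<lambda>(H, h). SUP (x, y)\<in>D \<times> D. ereal \<bar>g H h x y - g0 x y\<bar>"
  \<comment> \<open>A point of \<open>D\<close> bounds the supremum from below by 0, as needed for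
    the sandwich argument.\<close>
  obtain x0 where x0: "x0 \<in> D" using domain by (auto simp: bounded_domain_def)
  have b: "(?b \<longlongrightarrow> 0) ?F"
  proof -
    have s: "\<kappa> * real DIM('a) \<noteq> 0" using \<kappa>_pos by simp
    have n: "((\<lambda>z. fst z + snd z) \<longlongrightarrow> 0) ?F" and d: "((\<lambda>z. \<Delta> (fst z) (snd z)) \<longlongrightarrow> 0) ?F"
      and cc: "((\<lambda>z. c (fst z) (snd z) * (fst z + snd z)) \<longlongrightarrow> \<kappa> * real DIM('a)) ?F"
      using tendsto_fst_snd_at_0(3)[of "{0<..<H0} \<times> {0<..<H0}"] \<Delta> c_asymp[OF H0] by (simp_all add: case_prod_beta' mult.commute)
    have "((\<lambda>z. 3 * ((fst z + snd z) * (1 + 4 / H0\<^sup>2) * A)) \<longlongrightarrow> 0) ?F"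
      by (rule tendsto_mult_right_zero, rule tendsto_mult_left_zero, rule tendsto_mult_left_zero, rule n)
    from tendsto_add[OF this tendsto_divide[OF tendsto_mult_left_zero[OF d] cc s]]
    show ?thesis by (simp add: case_prod_beta')
  qed
  have "(?s \<longlongrightarrow> 0) ?F"
  proof (rule tendsto_sandwich[where f="\<lambda>_. 0" and h="\<lambda>z. ereal (?b z)"])
    show "((\<lambda>z. ereal (?b z)) \<longlongrightarrow> 0) ?F" using b by (simp add: zero_ereal_def)
    show "((\<lambda>z. 0) \<longlongrightarrow> (0 :: ereal)) ?F" by simp
    show "\<forall>\<^sub>F z in ?F. 0 \<le> ?s z"
    proof (rule always_eventually, rule allI)
      fix z :: "real \<times> real"
      obtain H h where z: "z = (H, h)" by (cases z)
      have "0 \<le> ereal \<bar>g H h x0 x0 - g0 x0 x0\<bar>" by simp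
      also have "\<dots> \<le> ?s z"
        using SUP_upper[of "(x0, x0)" "D \<times> D" "\<lambda>(x, y). ereal \<bar>g H h x y - g0 x y\<bar>"] x0 by (simp add: z)
      finally show "0 \<le> ?s z" .
    qed
    have "\<forall>\<^sub>F z in ?F. (case z of (H, h) \<Rightarrow> H + h) < H0"
      using order_tendstoD(2)[OF tendsto_fst_snd_at_0(3) H0(1)] .
    then show "\<forall>\<^sub>F z in ?F. ?s z \<le> ereal (?b z)"
      using eventually_at_0_within_square[of H0]
    proof eventually_elim
      case (elim z)
      obtain H h where z: "z = (H, h)" by (cases z)
      have e: "H \<in> {0<..<H0}" "h \<in> {0<..<H0}" "H + h \<le> H0" using elim by (simp_all add: z)
      have "\<bar>g H h x y - g0 x y\<bar> \<le> ?b z" if "x \<in> D" "y \<in> D" for x y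
        unfolding z prod.case by (rule g2[OF e(1,2) that e(3)])
      then show ?case unfolding z prod.case by (intro SUP_least) (auto simp del: times_divide_eq_right)
    qed
  qed
  moreover have "bounded ((\<lambda>(x, y). g0 x y) ` (D \<times> D))"
  proof (rule boundedI)
    fix a assume "a \<in> (\<lambda>(x, y). g0 x y) ` (D \<times> D)"
    then obtain x y where "x \<in> D" "y \<in> D" "a = g0 x y" by auto
    then show "norm a \<le> 3 * (1 + (1 + 1 / H0) * A)" using g3[of x y] by (simp only: real_norm_def)
  qed
  moreover have "bounded ((\<lambda>(x, y). g H h x y) ` (D \<times> D))" if "H \<in> {0<..<H0}" "h \<in> {0<..<H0}" for H h
  proof (rule boundedI)
    fix a assume "a \<in> (\<lambda>(x, y). g H h x y) ` (D \<times> D)"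
    then obtain x y where "x \<in> D" "y \<in> D" "a = g H h x y" by auto
    then show "norm a \<le> (4 + 3 * A) / (H + h) + \<Delta> H h * (4 * (1 + A)) / (c H h * (H + h))"
      using g1[OF that, of x y] by (simp only: real_norm_def)
  qed
  ultimately show ?thesis
    unfolding approx_log_correlated_def
    using const_pos covariance_formula const_sup_tendsto by (intro exI[of _ const] exI[of _ g]) blast
qed

lemma normalized_field_log_correlated:
  "(\<forall>H\<in>{0<..<H0}. \<forall>x\<in>D. AE \<omega> in M. integrable lborel (\<lambda>u. B H u \<omega> * \<psi> u x)) \<and>
   centred_gaussian_family M ({0<..<H0} \<times> D) (\<lambda>(H, x). normalized_field \<psi> B H x) \<and>
   approx_log_correlated M H0 D (normalized_field \<psi> B)"
  using B_integrable normalized_field_gaussian approx_log_correlated by blast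

end

lemma (in cone_kernel) fbm_kernel_UNIV:
  "K = UNIV \<Longrightarrow> fbm_kernel H x s = norm (x - s) powr (H - real DIM('a) / 2) - norm s powr (H - real DIM('a) / 2)"
proof -
  assume "K = UNIV"
  then have "s \<in> K" for s by simp
  then show ?thesis by (simp add: fbm_kernel_def v_def)
qed

lemma half_line_fbm_kernel:
  "half_line.fbm_kernel H t = (\<lambda>s. (max (t - s) 0) powr (H - 1/2) - (max (- s) 0) powr (H - 1/2))"
  by (simp add: fun_eq_iff half_line.fbm_kernel_def half_line_v)

theorem theorem2p10:
  fixes M :: "'w measure" and H0 :: real
  assumes "prob_space M" and "0 < H0" and "H0 < 1/2"
  shows
    "(\<forall>(D :: real set) \<psi> W B.
        bounded_domain D \<and> \<psi> \<in> normalizing_kernels H0 D \<and> uniform_log_bound D \<psi> \<and>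
        two_sided_BM M W \<and> (mvn_family M H0 W B \<or> well_balanced_family M H0 W B) \<longrightarrow>
        (\<forall>H\<in>{0<..<H0}. \<forall>x\<in>D. AE \<omega> in M. integrable lborel (\<lambda>u. B H u \<omega> * \<psi> u x)) \<and>
        centred_gaussian_family M ({0<..<H0} \<times> D) (\<lambda>(H, x). normalized_field \<psi> B H x) \<and>
        approx_log_correlated M H0 D (normalized_field \<psi> B)) \<and>
     (\<forall>(D :: 'a::euclidean_space set) \<psi> W B.
        bounded_domain D \<and> \<psi> \<in> normalizing_kernels H0 D \<and> uniform_log_bound D \<psi> \<and>
        gaussian_white_noise M W \<and> white_noise_family M H0 W B \<longrightarrow>
        (\<forall>H\<in>{0<..<H0}. \<forall>x\<in>D. AE \<omega> in M. integrable lborel (\<lambda>u. B H u \<omega> * \<psi> u x)) \<and>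
        centred_gaussian_family M ({0<..<H0} \<times> D) (\<lambda>(H, x). normalized_field \<psi> B H x) \<and>
        approx_log_correlated M H0 D (normalized_field \<psi> B))"
proof (intro conjI; intro allI impI; elim conjE)
  interpret prob_space M by fact
  let ?I = "{(s, t). s \<le> (t::real)}" and ?S = "\<lambda>(s::real, t). {s<..t}"
  let ?Z = "\<lambda>W :: real \<Rightarrow> 'w \<Rightarrow> real. \<lambda>(s, t) \<omega>. W t \<omega> - W s \<omega>"
  fix D :: "real set" and \<psi> and W :: "real \<Rightarrow> 'w \<Rightarrow> real" and B :: "real \<Rightarrow> real \<Rightarrow> 'w \<Rightarrow> real"
  assume D: "bounded_domain D" "\<psi> \<in> normalizing_kernels H0 D" "uniform_log_bound D \<psi>"
    and W: "two_sided_BM M W" and B: "mvn_family M H0 W B \<or> well_balanced_family M H0 W B"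
  interpret noise: isonormal_noise M ?I ?S "?Z W" by (rule isonormal_Brownian_motion[OF W])
  from B show "(\<forall>H\<in>{0<..<H0}. \<forall>x\<in>D. AE \<omega> in M. integrable lborel (\<lambda>u. B H u \<omega> * \<psi> u x)) \<and>
      centred_gaussian_family M ({0<..<H0} \<times> D) (\<lambda>(H, x). normalized_field \<psi> B H x) \<and>
      approx_log_correlated M H0 D (normalized_field \<psi> B)"
  proof
    assume B: "mvn_family M H0 W B"
    interpret normalized_fbm M ?I ?S "?Z W" "{0<..}" 1 H0 mvn_const B D \<psi>
    proof unfold_locales
      fix H assume H: "H \<in> {0<..<H0}"
      show "\<exists>Y. wiener_integral M ?I ?S (?Z W) (half_line.fbm_kernel H x) Y \<and> (\<forall>\<omega>\<in>space M. B H x \<omega> = mvn_const H * Y \<omega>)" for x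
        using B H unfolding mvn_family_def BM_integral_def half_line_fbm_kernel by blast
      show "continuous_on UNIV (\<lambda>x. B H x \<omega>)" if "\<omega> \<in> space M" for \<omega>
        using B H that unfolding mvn_family_def by blast
      show "0 < mvn_const H" using H assms by (intro mvn_const_pos) auto
    next
      show "((\<lambda>H. Gamma H powr (1 / 2) * mvn_const H) \<longlongrightarrow> 1 / sqrt (1 * real DIM(real))) (at_right 0)"
        using mvn_const_limit by simp
    qed (use assms D in auto)
    show ?thesis by (rule normalized_field_log_correlated)
  next
    assume B: "well_balanced_family M H0 W B"
    \<comment> \<open>Here \<open>\<kappa>\<close> is the length 2 of the interval (-1, 1), against
      1 for the half-line: both directions contribute to the singularity at the origin.\<close>
    interpret radial: asymptotically_radial_kernel "UNIV :: real set" "unit_ball_vol (real DIM(real))"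
      by (rule asymptotically_radial_kernel_UNIV)
    have ker: "radial.fbm_kernel H t = (\<lambda>s. \<bar>t - s\<bar> powr (H - 1/2) - \<bar>s\<bar> powr (H - 1/2))" for H t
      by (simp add: fun_eq_iff radial.fbm_kernel_UNIV)
    interpret normalized_fbm M ?I ?S "?Z W" UNIV "unit_ball_vol (real DIM(real))" H0 "wb_const 1" B D \<psi>
    proof unfold_locales
      fix H assume H: "H \<in> {0<..<H0}"
      show "\<exists>Y. wiener_integral M ?I ?S (?Z W) (radial.fbm_kernel H x) Y \<and> (\<forall>\<omega>\<in>space M. B H x \<omega> = wb_const 1 H * Y \<omega>)" for x
        using B H unfolding well_balanced_family_def BM_integral_def ker by blast
      show "continuous_on UNIV (\<lambda>x. B H x \<omega>)" if "\<omega> \<in> space M" for \<omega>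
        using B H that unfolding well_balanced_family_def by blast
      show "0 < wb_const 1 H" using H assms by (intro wb_const_pos) auto
    next
      show "((\<lambda>H. Gamma H powr (1 / 2) * wb_const 1 H) \<longlongrightarrow> 1 / sqrt (unit_ball_vol (real DIM(real)) * real DIM(real))) (at_right 0)"
        using wb_const_limit[of 1] by simp
    qed (use assms D in auto)
    show ?thesis by (rule normalized_field_log_correlated)
  qed
next
  interpret prob_space M by fact
  fix D :: "'a set" and \<psi> and W :: "'a set \<Rightarrow> 'w \<Rightarrow> real" and B :: "real \<Rightarrow> 'a \<Rightarrow> 'w \<Rightarrow> real"
  assume D: "bounded_domain D" "\<psi> \<in> normalizing_kernels H0 D" "uniform_log_bound D \<psi>"
    and W: "gaussian_white_noise M W" and B: "white_noise_family M H0 W B"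
  interpret noise: isonormal_noise M finite_borel_sets "\<lambda>A. A" W by (rule isonormal_white_noise[OF W])
  interpret radial: asymptotically_radial_kernel "UNIV :: 'a set" "unit_ball_vol (real DIM('a))"
    by (rule asymptotically_radial_kernel_UNIV)
  have ker: "radial.fbm_kernel H x = (\<lambda>y. norm (x - y) powr (H - real DIM('a) / 2) - norm y powr (H - real DIM('a) / 2))" for H x
    by (simp add: fun_eq_iff radial.fbm_kernel_UNIV)
  have dim: "1 \<le> real DIM('a)" using DIM_positive[where 'a='a] by linarith
  interpret normalized_fbm M finite_borel_sets "\<lambda>A. A" W UNIV "unit_ball_vol (real DIM('a))" H0 "wb_const (real DIM('a))" B D \<psi>
  proof unfold_locales
    fix H assume H: "H \<in> {0<..<H0}"
    show "\<exists>Y. wiener_integral M finite_borel_sets (\<lambda>A. A) W (radial.fbm_kernel H x) Y \<and>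
        (\<forall>\<omega>\<in>space M. B H x \<omega> = wb_const (real DIM('a)) H * Y \<omega>)" for x
      using B H unfolding white_noise_family_def white_noise_integral_def ker by blast
    show "continuous_on UNIV (\<lambda>x. B H x \<omega>)" if "\<omega> \<in> space M" for \<omega>
      using B H that unfolding white_noise_family_def by blast
    show "0 < wb_const (real DIM('a)) H" using H assms dim by (intro wb_const_pos) auto
  next
    show "((\<lambda>H. Gamma H powr (1 / 2) * wb_const (real DIM('a)) H) \<longlongrightarrow> 1 / sqrt (unit_ball_vol (real DIM('a)) * real DIM('a))) (at_right 0)"
      by (rule wb_const_limit[OF dim])
  qed (use assms D in auto)
  show "(\<forall>H\<in>{0<..<H0}. \<forall>x\<in>D. AE \<omega> in M. integrable lborel (\<lambda>u. B H u \<omega> * \<psi> u x)) \<and>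
      centred_gaussian_family M ({0<..<H0} \<times> D) (\<lambda>(H, x). normalized_field \<psi> B H x) \<and>
      approx_log_correlated M H0 D (normalized_field \<psi> B)"
    by (rule normalized_field_log_correlated)
qed

end
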